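(* Let $\varphi$ be a growth function on $\mathbb{R}^n\times[0,\infty)$ and $s\in\mathbb{Z}_+$. (a) If $\varphi\in\mathbb{A}_1(\mathbb{R}^n)$, then there exist positive constants $C_1$ and $C_2$ such that, for all $f\in\mathcal{L}_{\varphi,1,s}(\mathbb{R}^n)$, all balls $B\subset\mathbb{R}^n$ and all $\alpha\in(0,\infty)$, $$\varphi\left(\left\{x\in B:\ \frac{|f(x)-P_B^sf(x)|}{\varphi(x,\|\chi_B\|_{L^\varphi(\mathbb{R}^n)}^{-1})}>\alpha\right\},\ \|\chi_B\|_{L^\varphi(\mathbb{R}^n)}^{-1}\right)\le C_1\exp\left\{-\frac{C_2\,\alpha}{\|f\|_{\mathcal{L}_{\varphi,1,s}(\mathbb{R}^n)}\|\chi_B\|_{L^\varphi(\mathbb{R}^n)}}\right\}.$$ (b) If $\varphi\in\mathbb{A}_q(\mathbb{R}^n)$ for some $q\in(1,\infty)$, then there exists a positive constant $C_3$ such that, for all $f\in\mathcal{L}_{\varphi,1,s}(\mathbb{R}^n)$, all balls $B\subset\mathbb{R}^n$ and all $\alpha\in(0,\infty)$, $$\varphi\left(\left\{x\in B:\ \frac{|f(x)-P_B^sf(x)|}{\varphi(x,\|\chi_B\|_{L^\varphi(\mathbb{R}^n)}^{-1})}>\alpha\right\},\ \|\chi_B\|_{L^\varphi(\mathbb{R}^n)}^{-1}\right)\le C_3\left[1+\frac{\alpha}{\|f\|_{\mathcal{L}_{\varphi,1,s}(\mathbb{R}^n)}\|\chi_B\|_{L^\varphi(\mathbb{R}^n)}}\right]^{-q'},$$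 where $1/q+1/q'=1$.
   Context: Notation: $\mathbb{Z}_+=\{0,1,2,\dots\}$; $\chi_E$ is the characteristic function of $E$; $|E|$ is Lebesgue measure. When $\|f\|_{\mathcal{L}_{\varphi,1,s}(\mathbb{R}^n)}=0$, the right-hand sides are read as $0$. Orlicz function: $\Phi:[0,\infty)\to[0,\infty)$ nondecreasing, $\Phi(0)=0$, $\Phi(t)>0$ for $t\in(0,\infty)$, $\lim_{t\to\infty}\Phi(t)=\infty$. Uniform types: let $\varphi:\mathbb{R}^n\times[0,\infty)\to[0,\infty)$ be such that $\varphi(x,\cdot)$ is an Orlicz function for every $x$. $\varphi$ is of uniformly upper type $p$ (resp. uniformly lower type $p$), $p\in[0,\infty)$, if there is $C>0$ such that $\varphi(x,\sigma t)\le C\sigma^p\varphi(x,t)$ for all $x\in\mathbb{R}^n$, $t\in[0,\infty)$ and $\sigma\in[1,\infty)$ (resp. $\sigma\in[0,1]$). Muckenhoupt condition: $\varphi\in\mathbb{A}_q(\mathbb{R}^n)$, $q\in[1,\infty)$, means that $\varphi$ is uniformly locally integrable, i.e. for all compact $K\subset\mathbb{R}^n$, $\int_K\sup_{t\in(0,\infty)}\{\varphi(x,t)[\int_K\varphi(y,t)\,dy]^{-1}\}\,dx<\infty$, and that $$\sup_{t\in(0,\infty)}\sup_{B}\frac{1}{|B|^q}\int_B\varphi(x,t)\,dx\left\{\int_B[\varphi(y,t)]^{-q'/q}\,dy\right\}^{q/q'}<\infty\quad(q\in(1,\infty),\ 1/q+1/q'=1),$$ $$\sup_{t\in(0,\infty)}\sup_{B}\frac1{|B|}\int_B\varphi(x,t)\,dx\left(\operatorname{ess\,sup}_{y\in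 B}[\varphi(y,t)]^{-1}\right)<\infty\quad(q=1),$$ with $B$ running over all balls of $\mathbb{R}^n$. $\mathbb{A}_\infty(\mathbb{R}^n)=\bigcup_{q\in[1,\infty)}\mathbb{A}_q(\mathbb{R}^n)$. Growth function: $\varphi:\mathbb{R}^n\times[0,\infty)\to[0,\infty)$ such that (i) $\varphi(x,\cdot)$ is an Orlicz function for all $x$ and $\varphi(\cdot,t)$ is measurable for all $t$; (ii) $\varphi\in\mathbb{A}_\infty(\mathbb{R}^n)$; (iii) $\varphi$ is of uniformly lower type $p$ for some $p\in(0,1]$ and of uniformly upper type $1$. For measurable $E\subset\mathbb{R}^n$ and $t\in[0,\infty)$, $\varphi(E,t):=\int_E\varphi(x,t)\,dx$. For a ball $B$, $\|\chi_B\|_{L^\varphi(\mathbb{R}^n)}:=\inf\{\lambda\in(0,\infty):\int_B\varphi(x,1/\lambda)\,dx\le1\}$. $\mathcal{P}_s(\mathbb{R}^n)$ is the set of polynomials on $\mathbb{R}^n$ of degree at most $s$. For a locally integrable $g$ and a ball $B$, $P_B^sg$ is the unique $P\in\mathcal{P}_s(\mathbb{R}^n)$ with $\int_B[g(x)-P(x)]Q(x)\,dx=0$ for all $Q\in\mathcal{P}_s(\mathbb{R}^n)$. $\mathcal{L}_{\varphi,1,s}(\mathbb{R}^n)$ is the space of locally integrable $f$ on $\mathbb{R}^n$ with $$\|f\|_{\mathcal{L}_{\varphi,1,s}(\mathbb{R}^n)}:=\sup_{B\subset\mathbb{R}^n}\frac1{\|\chi_B\|_{L^\varphi(\mathbb{R}^n)}}\int_B|f(x)-P_B^sf(x)|\,dx<\infty,$$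 the supremum being over all balls $B$. *)

theory Defs
  imports "HOL-Analysis.Analysis" "HOL-Probability.Essential_Supremum"
begin

text \<open>
  A function on \<open>\<real>\<^sup>n \<times> [0,\<infinity>)\<close> is represented by \<open>\<phi> :: real^'n \<Rightarrow> real \<Rightarrow> real\<close>; its values at
  negative second arguments are never constrained or used. Measurability and integrals refer to
  the completed measure \<^const>\<open>lebesgue\<close>. Integrals of nonnegative functions that may be
  infinite are taken in \<^typ>\<open>ennreal\<close>.
\<close>

subsection \<open>Growth functions\<close>

definition orlicz_function :: "(real \<Rightarrow> real) \<Rightarrow> bool" where
  "orlicz_function \<Phi> \<longleftrightarrow>
     (\<forall>t\<ge>0. 0 \<le> \<Phi> t) \<and> mono_on {0..} \<Phi> \<and> \<Phi> 0 = 0 \<and> (\<forall>t>0. 0 < \<Phi> t) \<and>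
     filterlim \<Phi> at_top at_top"

definition uniformly_upper_type :: "real \<Rightarrow> (real^'n \<Rightarrow> real \<Rightarrow> real) \<Rightarrow> bool" where
  "uniformly_upper_type p \<phi> \<longleftrightarrow>
     (\<exists>C>0. \<forall>x. \<forall>t\<ge>0. \<forall>\<sigma>\<ge>1. \<phi> x (\<sigma> * t) \<le> C * \<sigma> powr p * \<phi> x t)"

definition uniformly_lower_type :: "real \<Rightarrow> (real^'n \<Rightarrow> real \<Rightarrow> real) \<Rightarrow> bool" where
  "uniformly_lower_type p \<phi> \<longleftrightarrow>
     (\<exists>C>0. \<forall>x. \<forall>t\<ge>0. \<forall>\<sigma>\<in>{0..1}. \<phi> x (\<sigma> * t) \<le> C * \<sigma> powr p * \<phi> x t)"

definition mass :: "(real^'n \<Rightarrow> real \<Rightarrow> real) \<Rightarrow> (real^'n) set \<Rightarrow> real \<Rightarrow> ennreal" where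
  "mass \<phi> E t = (\<integral>\<^sup>+x\<in>E. ennreal (\<phi> x t) \<partial>lebesgue)"

definition balls :: "(real^'n) set set" where
  "balls = {ball x r |x r. 0 < r}"

definition uniformly_locally_integrable :: "(real^'n \<Rightarrow> real \<Rightarrow> real) \<Rightarrow> bool" where
  "uniformly_locally_integrable \<phi> \<longleftrightarrow>
     (\<forall>K. compact K \<longrightarrow>
       (\<integral>\<^sup>+x\<in>K. (SUP t\<in>{0<..}. ennreal (\<phi> x t) / mass \<phi> K t) \<partial>lebesgue) < top)"

text \<open>Real powers on \<open>[0,\<infinity>]\<close>, used for positive exponents only.\<close>

definition ennreal_powr :: "ennreal \<Rightarrow> real \<Rightarrow> ennreal" where
  "ennreal_powr x a = (if x = top then top else ennreal (enn2real x powr a))"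

text \<open>Intended for \<open>1 \<le> q\<close>. For \<open>1 < q\<close>, the number \<open>q / (q - 1)\<close> is the conjugate exponent \<open>q'\<close>.\<close>

definition muckenhoupt :: "real \<Rightarrow> (real^'n \<Rightarrow> real \<Rightarrow> real) set" where
  "muckenhoupt q = {\<phi>. uniformly_locally_integrable \<phi> \<and>
     (if q = 1 then
        (SUP t\<in>{0<..}. SUP B\<in>balls.
           ennreal (1 / measure lebesgue B) * mass \<phi> B t *
           esssup (restrict_space lebesgue B) (\<lambda>y. ennreal (1 / \<phi> y t))) < top
      else
        (let q' = q / (q - 1) in
          (SUP t\<in>{0<..}. SUP B\<in>balls.
             ennreal (1 / measure lebesgue B powr q) * mass \<phi> B t *
             ennreal_powr (\<integral>\<^sup>+y\<in>B. ennreal (\<phi> y t powr (- q' / q)) \<partial>lebesgue) (q / q')) < top))}"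

definition muckenhoupt_infinity :: "(real^'n \<Rightarrow> real \<Rightarrow> real) set" where
  "muckenhoupt_infinity = (\<Union>q\<in>{1..}. muckenhoupt q)"

definition growth_function :: "(real^'n \<Rightarrow> real \<Rightarrow> real) \<Rightarrow> bool" where
  "growth_function \<phi> \<longleftrightarrow>
     (\<forall>x. orlicz_function (\<phi> x)) \<and>
     (\<forall>t\<ge>0. (\<lambda>x. \<phi> x t) \<in> borel_measurable lebesgue) \<and>
     \<phi> \<in> muckenhoupt_infinity \<and>
     (\<exists>p. 0 < p \<and> p \<le> 1 \<and> uniformly_lower_type p \<phi>) \<and>
     uniformly_upper_type 1 \<phi>"

text \<open>The quasi-norm of the characteristic function of \<open>B\<close> in \<open>L\<^sup>\<phi>\<close>.\<close>

definition norm_chi :: "(real^'n \<Rightarrow> real \<Rightarrow> real) \<Rightarrow> (real^'n) set \<Rightarrow> real" where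
  "norm_chi \<phi> B = Inf {l. 0 < l \<and> mass \<phi> B (1 / l) \<le> 1}"

subsection \<open>Musielak--Orlicz Campanato spaces\<close>

text \<open>
  The sort \<open>{real_normed_field, euclidean_space}\<close> covers the scalars \<^typ>\<open>real\<close> and
  \<^typ>\<open>complex\<close> at the same time.
\<close>

definition polynomials ::
    "nat \<Rightarrow> (real^'n \<Rightarrow> 'b::{real_normed_field, euclidean_space}) set" where
  "polynomials s =
     {\<lambda>x. \<Sum>\<beta> | (\<Sum>i\<in>UNIV. \<beta> i) \<le> s. c \<beta> * of_real (\<Prod>i\<in>UNIV. (x $ i) ^ \<beta> i)
      |c :: ('n \<Rightarrow> nat) \<Rightarrow> 'b. True}"

definition locally_integrable ::
    "(real^'n \<Rightarrow> 'b::{real_normed_field, euclidean_space}) \<Rightarrow> bool" where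
  "locally_integrable f \<longleftrightarrow> (\<forall>K. compact K \<longrightarrow> f absolutely_integrable_on K)"

text \<open>\<open>min_poly s B g\<close> is the polynomial \<open>P\<^sub>B\<^sup>s g\<close>.\<close>

definition min_poly ::
    "nat \<Rightarrow> (real^'n) set \<Rightarrow> (real^'n \<Rightarrow> 'b::{real_normed_field, euclidean_space}) \<Rightarrow> real^'n \<Rightarrow> 'b" where
  "min_poly s B g = (THE P. P \<in> polynomials s \<and>
     (\<forall>Q\<in>polynomials s. (LINT x:B|lebesgue. (g x - P x) * Q x) = 0))"

definition campanato_means ::
    "(real^'n \<Rightarrow> real \<Rightarrow> real) \<Rightarrow> nat \<Rightarrow> (real^'n \<Rightarrow> 'b::{real_normed_field, euclidean_space}) \<Rightarrow> real set" where
  "campanato_means \<phi> s f =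
     (\<lambda>B. 1 / norm_chi \<phi> B * (LINT x:B|lebesgue. norm (f x - min_poly s B f x))) ` balls"

definition campanato_space ::
    "(real^'n \<Rightarrow> real \<Rightarrow> real) \<Rightarrow> nat \<Rightarrow> (real^'n \<Rightarrow> 'b::{real_normed_field, euclidean_space}) set" where
  "campanato_space \<phi> s = {f. locally_integrable f \<and> bdd_above (campanato_means \<phi> s f)}"

definition campanato_norm ::
    "(real^'n \<Rightarrow> real \<Rightarrow> real) \<Rightarrow> nat \<Rightarrow> (real^'n \<Rightarrow> 'b::{real_normed_field, euclidean_space}) \<Rightarrow> real" where
  "campanato_norm \<phi> s f = Sup (campanato_means \<phi> s f)"

definition level_set ::
    "(real^'n \<Rightarrow> real \<Rightarrow> real) \<Rightarrow> nat \<Rightarrow> (real^'n \<Rightarrow> 'b::{real_normed_field, euclidean_space})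
      \<Rightarrow> (real^'n) set \<Rightarrow> real \<Rightarrow> (real^'n) set" where
  "level_set \<phi> s f B \<alpha> =
     {x \<in> B. norm (f x - min_poly s B f x) / \<phi> x (1 / norm_chi \<phi> B) > \<alpha>}"

end

theory Submission
  imports Defs
begin

text \<open>
  Fix a ball \<open>B\<close> and put \<open>t = 1 / norm_chi \<phi> B\<close>, \<open>w = \<phi>(\<cdot>, t)\<close>, \<open>W(E) = \<integral>\<^sub>E w\<close> and
  \<open>N = \<parallel>f\<parallel> norm_chi \<phi> B\<close>. The type conditions on \<open>\<phi>\<close> give \<open>W(B) \<le> C\<close>, and for every ball \<open>B'\<close>
  whose mass \<open>W(B')\<close> is bounded they give \<open>norm_chi \<phi> B' \<le> K W(B') norm_chi \<phi> B\<close>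
  (\<open>norm_chi_le_mass\<close>). Muckenhoupt weights are doubling, so this applies to all balls of comparable or smaller size near \<open>B\<close>,
  and on them the Campanato condition turns into one about the
  single weight \<open>w\<close>: the integral of \<open>\<bar>f - P\<^bsub>B'\<^esub>f\<bar>\<close> over \<open>B'\<close> is at most \<open>K N W(B')\<close>. What remains is
  the weighted John--Nirenberg inequality of Muckenhoupt and Wheeden for the function
  \<open>\<bar>f - P\<^sub>Bf\<bar> / w\<close>.

  It is proved by a Calderon--Zygmund stopping time. Let \<open>Q\<close> be a cube with oscillation
  \<open>u\<^sub>Q = \<bar>f - P\<bar>\<close>, where \<open>P\<close> is the minimizing polynomial of the ball inscribed in \<open>Q\<close>; the cube
  circumscribed about \<open>B\<close> then has \<open>P = P\<^sub>Bf\<close>. Let the \<open>Q'\<close> be the maximal dyadic subcubes on which the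
  integral of \<open>u\<^sub>Q\<close> exceeds \<open>s a W(Q')\<close>, with \<open>a\<close> comparable to \<open>N\<close>. Outside them
  \<open>u\<^sub>Q \<le> s a w\<close>; together they have mass at most \<open>W(Q) / s\<close>; and on each of them \<open>u\<^sub>Q\<close> exceeds
  \<open>u\<^bsub>Q'\<^esub>\<close> by at most a constant times \<open>a W(Q') / \<bar>Q'\<bar>\<close>, because a polynomial of bounded degree is
  controlled on a ball by its mean there (\<open>calderon_zygmund\<close>, \<open>polynomials_bound_ball\<close>). So if
  \<open>G(\<beta>)\<close> bounds \<open>W({u\<^sub>Q > \<beta> a w}) / W(Q)\<close> for all cubes, and \<open>h(\<beta>)\<close> bounds the proportion of a cube
  on which \<open>\<beta> w\<close> is smaller than a constant times the mean of \<open>w\<close>, then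
  \<open>G(\<beta>) \<le> (G(\<beta>\<^sub>2) + h(\<beta>\<^sub>1)) / s\<close> whenever \<open>\<beta>\<^sub>1 + \<beta>\<^sub>2 \<le> \<beta>\<close> and \<open>s \<le> \<beta>\<close> (\<open>superlevel_recursion\<close>).

  For an \<open>A\<^sub>1\<close> weight \<open>h\<close> vanishes beyond a fixed threshold, so each fixed increase of \<open>\<beta>\<close> halves
  \<open>G\<close>, which is exponential decay (\<open>superlevel_exponential\<close>). For an \<open>A\<^sub>q\<close> weight the negative power of
  \<open>w\<close> in the Muckenhoupt condition and Chebyshev's inequality give \<open>h(\<beta>) \<le> H \<beta> powr -q'\<close>, and for
  a large threshold \<open>s\<close> the recursion with \<open>\<beta>\<^sub>1 = \<beta>\<^sub>2 = \<beta> / 2\<close> preserves this decay (\<open>superlevel_power\<close>). The constants are uniform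
  in \<open>B\<close>, since the Muckenhoupt constants of \<open>\<phi>(\<cdot>, t)\<close> are uniform in \<open>t\<close>.
\<close>

section \<open>Polynomials of bounded degree\<close>

abbreviation multi_indices :: "nat \<Rightarrow> ('n::finite \<Rightarrow> nat) set" where
  "multi_indices s \<equiv> {\<beta>. (\<Sum>i\<in>UNIV. \<beta> i) \<le> s}"

definition monomial :: "('n::finite \<Rightarrow> nat) \<Rightarrow> real^'n \<Rightarrow> real" where
  "monomial \<beta> x = (\<Prod>i\<in>UNIV. (x $ i) ^ \<beta> i)"

lemma finite_multi_indices: "finite (multi_indices s :: ('n::finite \<Rightarrow> nat) set)"
proof (rule finite_subset)
  show "multi_indices s \<subseteq> (PiE UNIV (\<lambda>_. {..s}) :: ('n \<Rightarrow> nat) set)"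
  proof
    fix \<beta> :: "'n \<Rightarrow> nat" assume \<beta>: "\<beta> \<in> multi_indices s"
    have "\<beta> i \<le> s" for i
      using member_le_sum[of i UNIV \<beta>] \<beta> by simp
    then show "\<beta> \<in> PiE UNIV (\<lambda>_. {..s})" by auto
  qed
  show "finite (PiE UNIV (\<lambda>_. {..s}) :: ('n \<Rightarrow> nat) set)"
    by (intro finite_PiE) auto
qed

lemma monomial_mult: "monomial \<beta> x * monomial \<gamma> x = monomial (\<lambda>i. \<beta> i + \<gamma> i) x"
  by (simp add: monomial_def prod.distrib power_add)

lemma continuous_on_monomial [continuous_intros]: "continuous_on A (monomial \<beta>)"
  unfolding monomial_def by (intro continuous_intros)

lemma polynomials_iff:
  "P \<in> polynomials s \<longleftrightarrow> (\<exists>c. P = (\<lambda>x. \<Sum>\<beta>\<in>multi_indices s. c \<beta> * of_real (monomial \<beta> x)))"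
  by (auto simp: polynomials_def monomial_def)

lemma polynomialsE:
  assumes "P \<in> polynomials s"
  obtains c where "P = (\<lambda>x. \<Sum>\<beta>\<in>multi_indices s. c \<beta> * of_real (monomial \<beta> x))"
  using assms by (auto simp: polynomials_iff)

lemma continuous_on_polynomials:
  "P \<in> polynomials s \<Longrightarrow> continuous_on A P"
  by (erule polynomialsE) (auto intro!: continuous_intros)

lemma polynomials_add:
  assumes "P \<in> polynomials s" "Q \<in> polynomials s"
  shows "(\<lambda>x. P x + Q x) \<in> polynomials s"
proof -
  obtain c where P: "P = (\<lambda>x. \<Sum>\<beta>\<in>multi_indices s. c \<beta> * of_real (monomial \<beta> x))"
    using assms(1) by (rule polynomialsE)
  obtain d where Q: "Q = (\<lambda>x. \<Sum>\<beta>\<in>multi_indices s. d \<beta> * of_real (monomial \<beta> x))"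
    using assms(2) by (rule polynomialsE)
  show ?thesis
    by (auto simp: P Q polynomials_iff sum.distrib[symmetric] distrib_right[symmetric]
        intro!: exI[of _ "\<lambda>\<beta>. c \<beta> + d \<beta>"])
qed

lemma polynomials_cmult:
  assumes "P \<in> polynomials s"
  shows "(\<lambda>x. a * P x) \<in> polynomials s"
proof -
  obtain c where P: "P = (\<lambda>x. \<Sum>\<beta>\<in>multi_indices s. c \<beta> * of_real (monomial \<beta> x))"
    using assms by (rule polynomialsE)
  show ?thesis
    by (auto simp: P polynomials_iff sum_distrib_left mult.assoc
        intro!: exI[of _ "\<lambda>\<beta>. a * c \<beta>"])
qed

lemma polynomials_diff:
  assumes "P \<in> polynomials s" "Q \<in> polynomials s"
  shows "(\<lambda>x. P x - Q x) \<in> polynomials s"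
  using polynomials_add[OF assms(1) polynomials_cmult[OF assms(2), of "-1"]] by simp

lemma polynomials_zero: "(\<lambda>x. 0) \<in> polynomials s"
  by (auto simp: polynomials_iff intro!: exI[of _ "\<lambda>_. 0"])

lemma polynomials_sum:
  assumes "\<And>i. i \<in> I \<Longrightarrow> P i \<in> polynomials s"
  shows "(\<lambda>x. \<Sum>i\<in>I. P i x) \<in> polynomials s"
  using assms
  by (induction I rule: infinite_finite_induct) (auto simp: polynomials_zero intro!: polynomials_add)

lemma polynomials_monomial:
  assumes "\<beta> \<in> multi_indices s"
  shows "(\<lambda>x. of_real (monomial \<beta> x)) \<in> polynomials s"
proof -
  have "(\<lambda>x. of_real (monomial \<beta> x)) =
      (\<lambda>x. \<Sum>\<gamma>\<in>multi_indices s. (if \<gamma> = \<beta> then 1 else 0) * of_real (monomial \<gamma> x))"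
    using assms
    by (simp add: if_distrib[of "\<lambda>z. z * _"] sum.delta[OF finite_multi_indices] cong: if_cong)
  then show ?thesis unfolding polynomials_iff by (rule exI[of _ "\<lambda>\<gamma>. if \<gamma> = \<beta> then 1 else 0"])
qed

lemma polynomials_mult:
  assumes "P \<in> polynomials s" "Q \<in> polynomials t"
  shows "(\<lambda>x. P x * Q x) \<in> polynomials (s + t)"
proof -
  obtain c where P: "P = (\<lambda>x. \<Sum>\<beta>\<in>multi_indices s. c \<beta> * of_real (monomial \<beta> x))"
    using assms(1) by (rule polynomialsE)
  obtain d where Q: "Q = (\<lambda>x. \<Sum>\<beta>\<in>multi_indices t. d \<beta> * of_real (monomial \<beta> x))"
    using assms(2) by (rule polynomialsE)
  have "(\<lambda>x. P x * Q x) = (\<lambda>x. \<Sum>\<beta>\<in>multi_indices s. \<Sum>\<gamma>\<in>multi_indices t.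
      (c \<beta> * d \<gamma>) * of_real (monomial (\<lambda>i. \<beta> i + \<gamma> i) x))"
    unfolding P Q monomial_mult[symmetric] sum_product
    by (auto simp: fun_eq_iff algebra_simps intro!: sum.cong)
  moreover have "\<dots> \<in> polynomials (s + t)"
    by (intro polynomials_sum polynomials_cmult polynomials_monomial)
      (auto simp: sum.distrib intro: add_mono)
  ultimately show ?thesis by simp
qed

lemma polynomials_const: "(\<lambda>x. a) \<in> polynomials s"
  using polynomials_cmult[OF polynomials_monomial[of "\<lambda>_. 0" s], of a]
  by (simp add: monomial_def)

lemma polynomials_power:
  assumes "P \<in> polynomials s"
  shows "(\<lambda>x. P x ^ k) \<in> polynomials (k * s)"
  by (induction k) (auto intro: polynomials_const polynomials_mult[OF assms])

lemma polynomials_prod: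
  assumes "finite I" "\<And>i. i \<in> I \<Longrightarrow> P i \<in> polynomials (k i)"
  shows "(\<lambda>x. \<Prod>i\<in>I. P i x) \<in> polynomials (\<Sum>i\<in>I. k i)"
  using assms by (induction I) (auto intro: polynomials_const polynomials_mult)

lemma polynomials_mono:
  assumes "s \<le> t" "P \<in> polynomials s"
  shows "P \<in> polynomials t"
  using polynomials_mult[OF assms(2) polynomials_const[of 1 "t - s"]] assms(1) by simp

lemma polynomials_coordinate:
  "(\<lambda>x :: real^'n. of_real (x $ i) :: 'b::{real_normed_field,euclidean_space}) \<in> polynomials 1"
proof -
  have "(\<lambda>x. of_real (monomial (\<lambda>j. if j = i then 1 else 0) x)) \<in> polynomials 1"
    by (rule polynomials_monomial) simp
  moreover have "monomial (\<lambda>j. if j = i then 1 else 0) x = x $ i" for x :: "real^'n"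
    by (simp add: monomial_def if_distrib[of "\<lambda>e. _ ^ e"] cong: if_cong)
  ultimately show ?thesis by simp
qed

text \<open>
  Affine invariance is what makes the constants in the estimates for polynomials independent of the
  ball: everything can be transported to the unit ball.
\<close>

lemma polynomials_affine:
  fixes P :: "real^'n \<Rightarrow> 'b::{real_normed_field,euclidean_space}"
  assumes "P \<in> polynomials s"
  shows "(\<lambda>x. P (c + r *\<^sub>R x)) \<in> polynomials s"
proof -
  obtain d where P: "P = (\<lambda>x. \<Sum>\<beta>\<in>multi_indices s. d \<beta> * of_real (monomial \<beta> x))"
    using assms by (rule polynomialsE)
  have "(\<lambda>x. of_real (monomial \<beta> (c + r *\<^sub>R x)) :: 'b) \<in> polynomials s"
    if "\<beta> \<in> multi_indices s" for \<beta>
  proof (rule polynomials_mono)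
    have "(\<lambda>x. of_real (c $ i) + of_real r * of_real (x $ i) :: 'b) \<in> polynomials 1" for i
      by (intro polynomials_add polynomials_const polynomials_cmult polynomials_coordinate)
    from polynomials_power[OF this]
    show "(\<lambda>x. of_real (monomial \<beta> (c + r *\<^sub>R x)) :: 'b) \<in> polynomials (\<Sum>i\<in>UNIV. \<beta> i)"
      unfolding monomial_def of_real_prod
      by (intro polynomials_prod) (auto simp: of_real_power)
  qed (use that in auto)
  then show ?thesis
    unfolding P by (intro polynomials_sum polynomials_cmult)
qed

text \<open>
  The variables are eliminated one at a time. Once the exponents in the coordinates \<open>J\<close> have been
  prescribed to agree with \<open>\<kappa>\<close>, the remaining sum, as a function of one further coordinate \<open>i\<close>, is a
  polynomial with infinitely many roots, so its coefficient at the power \<open>\<kappa> i\<close> vanishes.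
\<close>

lemma monomials_independent:
  fixes c :: "('n::finite \<Rightarrow> nat) \<Rightarrow> real" and A :: "'n \<Rightarrow> real set"
  assumes fin: "finite I" and inf: "\<And>i. infinite (A i)"
    and zero: "\<And>x. (\<And>i. x $ i \<in> A i) \<Longrightarrow> (\<Sum>\<beta>\<in>I. c \<beta> * monomial \<beta> x) = 0"
    and \<kappa>: "\<kappa> \<in> I"
  shows "c \<kappa> = 0"
proof -
  have agree: "(\<Sum>\<beta> | \<beta> \<in> I \<and> (\<forall>i\<in>J. \<beta> i = \<kappa> i). c \<beta> * (\<Prod>i\<in>-J. (x $ i) ^ \<beta> i)) = 0"
    if "\<And>i. x $ i \<in> A i" for J and x :: "real^'n"
    using finite[of J] that
  proof (induction J arbitrary: x rule: finite_induct)
    case empty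
    then show ?case using zero[of x] by (simp add: monomial_def)
  next
    case (insert i J)
    define n where "n = \<kappa> i + (\<Sum>\<beta>\<in>I. \<beta> i)"
    have n: "\<beta> i \<le> n" if "\<beta> \<in> I" for \<beta>
      using member_le_sum[OF that, of "\<lambda>\<beta>. \<beta> i"] fin by (simp add: n_def)
    define S where "S = {\<beta>. \<beta> \<in> I \<and> (\<forall>i\<in>J. \<beta> i = \<kappa> i)}"
    have finS: "finite S" using fin by (simp add: S_def)
    define g where "g \<beta> = c \<beta> * (\<Prod>j\<in>-insert i J. (x $ j) ^ \<beta> j)" for \<beta>
    define d where "d m = (\<Sum>\<beta> | \<beta> \<in> S \<and> \<beta> i = m. g \<beta>)" for m
    have "A i \<subseteq> {t. (\<Sum>m\<le>n. d m * t ^ m) = 0}"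
    proof safe
      fix t assume t: "t \<in> A i"
      define x' where "x' = (\<chi> j. if j = i then t else x $ j)"
      have x': "x' $ j \<in> A j" for j using insert.prems t by (simp add: x'_def)
      have split: "- J = insert i (- insert i J)" using insert.hyps by auto
      have "(\<Sum>m\<le>n. d m * t ^ m) = (\<Sum>m\<le>n. \<Sum>\<beta> | \<beta> \<in> S \<and> \<beta> i = m. g \<beta> * t ^ \<beta> i)"
        unfolding d_def by (auto simp: sum_distrib_right intro!: sum.cong)
      also have "\<dots> = (\<Sum>\<beta>\<in>S. g \<beta> * t ^ \<beta> i)"
        by (rule sum.group) (use finS n in \<open>auto simp: S_def\<close>)
      also have "\<dots> = (\<Sum>\<beta>\<in>S. c \<beta> * (\<Prod>j\<in>-J. (x' $ j) ^ \<beta> j))"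
      proof (intro sum.cong refl)
        fix \<beta>
        have "(\<Prod>j\<in>-J. (x' $ j) ^ \<beta> j) = t ^ \<beta> i * (\<Prod>j\<in>-insert i J. (x $ j) ^ \<beta> j)"
          by (subst split) (auto simp: x'_def intro!: prod.cong)
        then show "g \<beta> * t ^ \<beta> i = c \<beta> * (\<Prod>j\<in>-J. (x' $ j) ^ \<beta> j)"
          by (simp add: g_def)
      qed
      also have "\<dots> = 0" using insert.IH[OF x'] by (simp add: S_def)
      finally show "(\<Sum>m\<le>n. d m * t ^ m) = 0" .
    qed
    with inf[of i] have "infinite {t. (\<Sum>m\<le>n. d m * t ^ m) = 0}"
      using finite_subset by blast
    then have "d (\<kappa> i) = 0"
      using polyfun_rootbound_finite[of n d] n_def by (metis le_add1)
    moreover have "{\<beta>. \<beta> \<in> S \<and> \<beta> i = \<kappa> i} = {\<beta>. \<beta> \<in> I \<and> (\<forall>j\<in>insert i J. \<beta> j = \<kappa> j)}"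
      by (auto simp: S_def)
    ultimately show ?case by (simp add: d_def g_def)
  qed
  obtain x :: "real^'n" where x: "\<And>i. x $ i \<in> A i"
  proof -
    have "\<exists>a. a \<in> A i" for i using inf[of i] by (metis finite.emptyI equals0I)
    then obtain a where "\<And>i. a i \<in> A i" by metis
    then show ?thesis using that[of "\<chi> i. a i"] by simp
  qed
  have "(\<Sum>\<beta> | \<beta> \<in> I \<and> (\<forall>i\<in>UNIV. \<beta> i = \<kappa> i). c \<beta>) = 0"
    using agree[OF x, of UNIV] by simp
  moreover have "{\<beta>. \<beta> \<in> I \<and> (\<forall>i\<in>UNIV. \<beta> i = \<kappa> i)} = {\<kappa>}" using \<kappa> by auto
  ultimately show ?thesis by simp
qed

text \<open>
  Gram--Schmidt, phrased for the matrix alone: enlarging the index set by \<open>k\<close>, subtract from the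
  new vector its projection onto the old ones. Definiteness makes the remainder non-null, so it can
  be used to correct a solution of the smaller system in the coordinate \<open>k\<close>.
\<close>

lemma gram_system_solvable:
  fixes G :: "'i \<Rightarrow> 'i \<Rightarrow> real"
  assumes "finite I" and sym: "\<And>i j. G i j = G j i"
    and "\<And>c. (\<Sum>i\<in>I. \<Sum>j\<in>I. c i * c j * G j i) = 0 \<Longrightarrow> (\<forall>i\<in>I. c i = 0)"
  shows "\<exists>c. \<forall>i\<in>I. (\<Sum>j\<in>I. c j * G j i) = y i"
  using assms(1,3)
proof (induction I arbitrary: y)
  case empty
  then show ?case by simp
next
  case (insert k I)
  have def: "\<forall>i\<in>I. c i = 0" if "(\<Sum>i\<in>I. \<Sum>j\<in>I. c i * c j * G j i) = 0" for c
  proof -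
    let ?c = "\<lambda>i. if i = k then 0 else c i"
    have "(\<Sum>i\<in>insert k I. \<Sum>j\<in>insert k I. ?c i * ?c j * G j i) = (\<Sum>i\<in>I. \<Sum>j\<in>I. ?c i * ?c j * G j i)"
      using insert.hyps by simp
    also have "\<dots> = (\<Sum>i\<in>I. \<Sum>j\<in>I. c i * c j * G j i)"
      using insert.hyps by (intro sum.cong) auto
    finally show ?thesis using insert.prems[of ?c] that insert.hyps(2) by (metis insertCI)
  qed
  obtain d where d: "\<forall>i\<in>I. (\<Sum>j\<in>I. d j * G j i) = G k i"
    using insert.IH[OF def] by blast
  obtain c0 where c0: "\<forall>i\<in>I. (\<Sum>j\<in>I. c0 j * G j i) = y i"
    using insert.IH[OF def] by blast
  define \<gamma> where "\<gamma> i = G k i - (\<Sum>j\<in>I. d j * G j i)" for i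
  have \<gamma>0: "\<gamma> i = 0" if "i \<in> I" for i using d that by (simp add: \<gamma>_def)
  \<comment> \<open>the remainder of the new vector after projection, which is orthogonal to the old ones\<close>
  define e where "e j = (if j = k then 1 else - d j)" for j
  have e\<gamma>: "(\<Sum>j\<in>insert k I. e j * G j i) = \<gamma> i" for i
  proof -
    have "(\<Sum>j\<in>I. e j * G j i) = (\<Sum>j\<in>I. - (d j * G j i))"
      using insert.hyps by (intro sum.cong) (auto simp: e_def)
    then show ?thesis using insert.hyps by (simp add: e_def \<gamma>_def sum_negf)
  qed
  have "(\<Sum>i\<in>insert k I. \<Sum>j\<in>insert k I. e i * e j * G j i) = (\<Sum>i\<in>insert k I. e i * \<gamma> i)"
    by (simp only: e\<gamma>[symmetric] sum_distrib_left mult.assoc)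
  also have "\<dots> = \<gamma> k" using insert.hyps \<gamma>0 by (simp add: e_def)
  finally have \<gamma>k: "\<gamma> k \<noteq> 0" using insert.prems[of e] by (auto simp: e_def)
  define \<tau> where "\<tau> = (y k - (\<Sum>j\<in>I. c0 j * G j k)) / \<gamma> k"
  define c where "c j = (if j = k then \<tau> else c0 j - \<tau> * d j)" for j
  have c: "(\<Sum>j\<in>insert k I. c j * G j i) = (\<Sum>j\<in>I. c0 j * G j i) + \<tau> * \<gamma> i" for i
  proof -
    have "(\<Sum>j\<in>I. c j * G j i) = (\<Sum>j\<in>I. c0 j * G j i - \<tau> * (d j * G j i))"
      using insert.hyps by (intro sum.cong) (auto simp: c_def algebra_simps)
    then show ?thesis using insert.hyps
      by (simp add: c_def \<gamma>_def sum_subtractf sum_distrib_left algebra_simps)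
  qed
  have "\<forall>i\<in>insert k I. (\<Sum>j\<in>insert k I. c j * G j i) = y i"
    unfolding c using c0 \<gamma>0 \<gamma>k by (auto simp: \<tau>_def)
  then show ?case by blast
qed

section \<open>The minimizing polynomial exists\<close>

lemma integrable_lebesgue_on_ball_continuous:
  fixes g :: "real^'n \<Rightarrow> 'b::euclidean_space"
  assumes "continuous_on UNIV g"
  shows "integrable (lebesgue_on (ball c r)) g"
proof -
  obtain a b where ab: "ball c r \<subseteq> cbox a b"
    using bounded_subset_cbox_symmetric[OF bounded_ball] by metis
  have "g absolutely_integrable_on cbox a b"
    by (rule absolutely_integrable_continuous) (use assms continuous_on_subset in blast)
  then have "set_integrable lebesgue (ball c r) g"
    by (rule set_integrable_subset) (use ab in auto)
  then show ?thesis by (simp add: set_integrable_def integrable_restrict_space)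
qed

lemma set_integral_eq_lebesgue_on_ball:
  fixes g :: "real^'n \<Rightarrow> 'b::euclidean_space"
  shows "(LINT x:ball c r|lebesgue. g x) = integral\<^sup>L (lebesgue_on (ball c r)) g"
  by (simp add: set_lebesgue_integral_def integral_restrict_space)

text \<open>
  On any ball there is a basis of real polynomials dual to the monomials. It gives both the
  minimizing polynomial (as a combination of the dual basis with the moments of the function) and a
  formula for the coefficients of a polynomial as integrals over the ball.
\<close>

lemma ex_dual_basis:
  assumes "r > 0"
  shows "\<exists>K :: ('n::finite \<Rightarrow> nat) \<Rightarrow> ('n \<Rightarrow> nat) \<Rightarrow> real.
    \<forall>\<beta>\<in>multi_indices s. \<forall>\<gamma>\<in>multi_indices s.
      integral\<^sup>L (lebesgue_on (ball c r))
        (\<lambda>x. (\<Sum>\<delta>\<in>multi_indices s. K \<beta> \<delta> * monomial \<delta> x) * monomial \<gamma> x) = (if \<beta> = \<gamma> then 1 else 0)"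
proof -
  let ?M = "lebesgue_on (ball c r)"
  let ?I = "multi_indices s :: ('n \<Rightarrow> nat) set"
  have int: "integrable ?M g" if "continuous_on UNIV g" for g :: "real^'n \<Rightarrow> real"
    using that by (rule integrable_lebesgue_on_ball_continuous)
  define G where "G \<beta> \<gamma> = integral\<^sup>L ?M (\<lambda>x. monomial \<beta> x * monomial \<gamma> x)" for \<beta> \<gamma> :: "'n \<Rightarrow> nat"
  have definite: "\<forall>\<beta>\<in>?I. a \<beta> = 0" if "(\<Sum>\<beta>\<in>?I. \<Sum>\<gamma>\<in>?I. a \<beta> * a \<gamma> * G \<gamma> \<beta>) = 0" for a
  proof -
    define p where "p x = (\<Sum>\<beta>\<in>?I. a \<beta> * monomial \<beta> x)" for x
    have cp: "continuous_on UNIV p" unfolding p_def by (intro continuous_intros)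
    have "(\<Sum>\<beta>\<in>?I. \<Sum>\<gamma>\<in>?I. a \<beta> * a \<gamma> * G \<gamma> \<beta>) =
        integral\<^sup>L ?M (\<lambda>x. \<Sum>\<beta>\<in>?I. \<Sum>\<gamma>\<in>?I. a \<beta> * a \<gamma> * (monomial \<gamma> x * monomial \<beta> x))"
      unfolding G_def
      by (subst Bochner_Integration.integral_sum
            , intro int continuous_intros
            , subst Bochner_Integration.integral_sum
            , intro int continuous_intros, simp)
    also have "\<dots> = integral\<^sup>L ?M (\<lambda>x. p x * p x)"
      unfolding p_def sum_product by (simp add: mult_ac)
    finally have "integral\<^sup>L ?M (\<lambda>x. p x * p x) = 0" using that by simp
    then have "AE x in ?M. p x * p x = 0"
      by (subst (asm) integral_nonneg_eq_0_iff_AE) (auto intro!: int continuous_intros cp)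
    then have ae: "AE x in lebesgue. x \<in> ball c r \<longrightarrow> p x = 0"
      by (simp add: AE_restrict_space_iff)
    have opn: "open {x \<in> ball c r. p x \<noteq> 0}"
    proof -
      have "{x \<in> ball c r. p x \<noteq> 0} = ball c r \<inter> p -` (- {0})" by auto
      then show ?thesis
        using cp by (metis open_Int open_ball open_vimage open_Compl closed_singleton)
    qed
    have "{x \<in> ball c r. p x \<noteq> 0} \<in> null_sets lebesgue"
      using ae opn by (subst AE_iff_null_sets) auto
    with opn have zero: "p x = 0" if "x \<in> ball c r" for x
      using open_not_negligible that unfolding negligible_iff_null_sets by blast
    \<comment> \<open>the cube with corner \<open>c\<close> and side \<open>\<epsilon>\<close> lies in the ball, so the coordinates range over infinite sets\<close>
    define \<epsilon> where "\<epsilon> = r / real (CARD('n) + 1)"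
    have \<epsilon>: "\<epsilon> > 0" using assms by (simp add: \<epsilon>_def)
    show ?thesis
    proof
      fix \<kappa> assume "\<kappa> \<in> ?I"
      show "a \<kappa> = 0"
      proof (rule monomials_independent[OF finite_multi_indices _ _ \<open>\<kappa> \<in> ?I\<close>, of "\<lambda>i. {c $ i .. c $ i + \<epsilon>}"])
        fix x :: "real^'n" assume x: "\<And>i. x $ i \<in> {c $ i .. c $ i + \<epsilon>}"
        have "norm (x - c) \<le> (\<Sum>i\<in>UNIV. \<bar>(x - c) $ i\<bar>)" by (rule norm_le_l1_cart)
        also have "\<dots> \<le> (\<Sum>i\<in>(UNIV :: 'n set). \<epsilon>)"
          using x by (intro sum_mono) (simp add: abs_le_iff algebra_simps)
        also have "\<dots> < r" using assms by (simp add: \<epsilon>_def field_simps)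
        finally have "x \<in> ball c r" by (simp add: dist_norm norm_minus_commute)
        then show "(\<Sum>\<beta>\<in>?I. a \<beta> * monomial \<beta> x) = 0" using zero by (simp add: p_def)
      qed (use \<epsilon> in auto)
    qed
  qed
  have "\<exists>k. \<forall>\<gamma>\<in>?I. (\<Sum>\<delta>\<in>?I. k \<delta> * G \<delta> \<gamma>) = (if \<beta> = \<gamma> then 1 else 0)" for \<beta>
    by (rule gram_system_solvable[OF finite_multi_indices _ definite]) (simp add: G_def mult.commute)
  then obtain K where K: "\<And>\<beta>. \<forall>\<gamma>\<in>?I. (\<Sum>\<delta>\<in>?I. K \<beta> \<delta> * G \<delta> \<gamma>) = (if \<beta> = \<gamma> then 1 else 0)"
    using choice[of "\<lambda>\<beta> k. \<forall>\<gamma>\<in>?I. (\<Sum>\<delta>\<in>?I. k \<delta> * G \<delta> \<gamma>) = (if \<beta> = \<gamma> then 1 else 0)"] by blast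
  have "integral\<^sup>L ?M (\<lambda>x. (\<Sum>\<delta>\<in>?I. K \<beta> \<delta> * monomial \<delta> x) * monomial \<gamma> x) = (\<Sum>\<delta>\<in>?I. K \<beta> \<delta> * G \<delta> \<gamma>)"
    for \<beta> \<gamma>
    unfolding G_def sum_distrib_right mult.assoc
    by (subst Bochner_Integration.integral_sum, intro int continuous_intros, simp)
  then show ?thesis using K by (intro exI[of _ K]) auto
qed

lemma integral_sum_of_real:
  fixes d :: "'i \<Rightarrow> 'b::{real_normed_field,euclidean_space}" and h :: "'i \<Rightarrow> real^'n \<Rightarrow> real"
  assumes h: "\<And>i. continuous_on UNIV (h i)"
  shows "integral\<^sup>L (lebesgue_on (ball c r)) (\<lambda>x. \<Sum>i\<in>I. d i * of_real (h i x)) =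
    (\<Sum>i\<in>I. d i * of_real (integral\<^sup>L (lebesgue_on (ball c r)) (h i)))"
proof -
  let ?M = "lebesgue_on (ball c r)"
  have "integral\<^sup>L ?M (\<lambda>x. \<Sum>i\<in>I. d i * of_real (h i x)) =
      (\<Sum>i\<in>I. integral\<^sup>L ?M (\<lambda>x. d i * of_real (h i x)))"
    by (intro Bochner_Integration.integral_sum integrable_lebesgue_on_ball_continuous continuous_intros h)
  also have "\<dots> = (\<Sum>i\<in>I. d i * of_real (integral\<^sup>L ?M (h i)))"
  proof (intro sum.cong refl)
    fix i
    have "integral\<^sup>L ?M (\<lambda>x. d i * of_real (h i x)) = d i * integral\<^sup>L ?M (\<lambda>x. of_real (h i x))"
      by (intro Bochner_Integration.integral_mult_right integrable_lebesgue_on_ball_continuous continuous_intros h)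
    also have "integral\<^sup>L ?M (\<lambda>x. of_real (h i x) :: 'b) = of_real (integral\<^sup>L ?M (h i))"
      by (intro integral_bounded_linear bounded_linear_of_real integrable_lebesgue_on_ball_continuous h)
    finally show "integral\<^sup>L ?M (\<lambda>x. d i * of_real (h i x)) = d i * of_real (integral\<^sup>L ?M (h i))" .
  qed
  finally show ?thesis .
qed

lemma integral_against_dual_basis:
  fixes d :: "('n::finite \<Rightarrow> nat) \<Rightarrow> 'b::{real_normed_field,euclidean_space}"
    and K :: "('n \<Rightarrow> nat) \<Rightarrow> ('n \<Rightarrow> nat) \<Rightarrow> real"
  assumes K: "\<forall>\<beta>\<in>multi_indices s. \<forall>\<gamma>\<in>multi_indices s.
      integral\<^sup>L (lebesgue_on (ball c r))
        (\<lambda>x. (\<Sum>\<delta>\<in>multi_indices s. K \<beta> \<delta> * monomial \<delta> x) * monomial \<gamma> x) = (if \<beta> = \<gamma> then 1 else 0)"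
    and \<beta>: "\<beta> \<in> multi_indices s"
  shows "integral\<^sup>L (lebesgue_on (ball c r)) (\<lambda>x. (\<Sum>\<gamma>\<in>multi_indices s. d \<gamma> * of_real (monomial \<gamma> x)) *
    of_real (\<Sum>\<delta>\<in>multi_indices s. K \<beta> \<delta> * monomial \<delta> x)) = d \<beta>"
proof -
  let ?M = "lebesgue_on (ball c r)"
  let ?I = "multi_indices s :: ('n \<Rightarrow> nat) set"
  define k where "k x = (\<Sum>\<delta>\<in>?I. K \<beta> \<delta> * monomial \<delta> x)" for x
  have ck [continuous_intros]: "continuous_on A k" for A unfolding k_def by (intro continuous_intros)
  have "integral\<^sup>L ?M (\<lambda>x. (\<Sum>\<gamma>\<in>?I. d \<gamma> * of_real (monomial \<gamma> x)) * of_real (k x)) =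
      integral\<^sup>L ?M (\<lambda>x. \<Sum>\<gamma>\<in>?I. d \<gamma> * of_real (k x * monomial \<gamma> x))"
    by (simp add: sum_distrib_left sum_distrib_right mult_ac)
  also have "\<dots> = (\<Sum>\<gamma>\<in>?I. d \<gamma> * of_real (integral\<^sup>L ?M (\<lambda>x. k x * monomial \<gamma> x)))"
    by (intro integral_sum_of_real continuous_intros)
  also have "\<dots> = (\<Sum>\<gamma>\<in>?I. if \<gamma> = \<beta> then d \<gamma> else 0)"
    using K \<beta> by (intro sum.cong refl) (auto simp: k_def)
  also have "\<dots> = d \<beta>" using \<beta> by (simp add: sum.delta[OF finite_multi_indices])
  finally show ?thesis by (simp add: k_def)
qed

lemma integrable_times_continuous_on_ball:
  fixes g h :: "real^'n \<Rightarrow> 'b::{real_normed_field,euclidean_space}"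
  assumes g: "integrable (lebesgue_on (ball c r)) g" and h: "continuous_on UNIV h"
  shows "integrable (lebesgue_on (ball c r)) (\<lambda>x. g x * h x)"
proof -
  have "compact (h ` cball c r)"
    using h by (intro compact_continuous_image) (auto intro: continuous_on_subset)
  then obtain M where M: "\<And>x. x \<in> cball c r \<Longrightarrow> norm (h x) \<le> M"
    using compact_imp_bounded bounded_iff by (metis imageI)
  have [measurable]: "h \<in> borel_measurable (lebesgue_on (ball c r))"
    by (rule borel_measurable_integrable[OF integrable_lebesgue_on_ball_continuous[OF h]])
  show ?thesis
  proof (rule Bochner_Integration.integrable_bound)
    show "integrable (lebesgue_on (ball c r)) (\<lambda>x. M * norm (g x))"
      using g by simp
    show "AE x in lebesgue_on (ball c r). norm (g x * h x) \<le> norm (M * norm (g x))"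
    proof (rule AE_I2)
      fix x assume "x \<in> space (lebesgue_on (ball c r))"
      then have "norm (h x) \<le> M" using M[of x] by simp
      then show "norm (g x * h x) \<le> norm (M * norm (g x))"
        using mult_right_mono[of "norm (h x)" M "norm (g x)"] by (simp add: norm_mult mult.commute)
    qed
  qed (use g in \<open>auto intro: borel_measurable_integrable\<close>)
qed

text \<open>
  The minimizing polynomial is a definite description, so this is the statement that the polynomial
  exists and is unique. Testing against real polynomials is enough for uniqueness, even though the
  bilinear form \<open>\<integral> P Q\<close> is not definite over the complex numbers: pairing with a real dual basis
  returns the coefficients.
\<close>

lemma min_poly_in_polynomials:
  fixes g :: "real^'n \<Rightarrow> 'b::{real_normed_field,euclidean_space}"
  assumes r: "r > 0" and g: "set_integrable lebesgue (ball c r) g"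
  shows "min_poly s (ball c r) g \<in> polynomials s"
proof -
  let ?M = "lebesgue_on (ball c r)"
  let ?I = "multi_indices s :: ('n \<Rightarrow> nat) set"
  have g': "integrable ?M g"
    using g by (simp add: set_integrable_def integrable_restrict_space)
  obtain K :: "('n \<Rightarrow> nat) \<Rightarrow> ('n \<Rightarrow> nat) \<Rightarrow> real" where
    K: "\<forall>\<beta>\<in>?I. \<forall>\<gamma>\<in>?I. integral\<^sup>L ?M
        (\<lambda>x. (\<Sum>\<delta>\<in>?I. K \<beta> \<delta> * monomial \<delta> x) * monomial \<gamma> x) = (if \<beta> = \<gamma> then 1 else 0)"
    using ex_dual_basis[OF r, of s c] by (rule exE)
  define k where "k \<beta> x = (\<Sum>\<delta>\<in>?I. K \<beta> \<delta> * monomial \<delta> x)" for \<beta> x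
  have k_poly: "(\<lambda>x. of_real (k \<beta> x) :: 'b) \<in> polynomials s" for \<beta>
    by (auto simp: k_def polynomials_iff intro!: exI[of _ "\<lambda>\<delta>. of_real (K \<beta> \<delta>)"])
  have ck: "continuous_on A (k \<beta>)" for A \<beta>
    unfolding k_def by (intro continuous_intros)
  define \<mu> where "\<mu> \<gamma> = integral\<^sup>L ?M (\<lambda>x. g x * of_real (monomial \<gamma> x))" for \<gamma>
  define P where "P x = (\<Sum>\<beta>\<in>?I. \<mu> \<beta> * of_real (k \<beta> x))" for x
  have P: "P \<in> polynomials s"
    unfolding P_def by (intro polynomials_sum polynomials_cmult k_poly)
  let ?orth = "\<lambda>P. \<forall>Q\<in>polynomials s. (LINT x:ball c r|lebesgue. (g x - P x) * Q x) = 0"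
  have intP: "integrable ?M (\<lambda>x. R x * Q x)" if "R \<in> polynomials s" "Q \<in> polynomials s"
    for R Q :: "real^'n \<Rightarrow> 'b"
    using that by (intro integrable_lebesgue_on_ball_continuous continuous_intros continuous_on_polynomials)
  have intg: "integrable ?M (\<lambda>x. g x * Q x)" if "Q \<in> polynomials s" for Q :: "real^'n \<Rightarrow> 'b"
    by (rule integrable_times_continuous_on_ball[OF g' continuous_on_polynomials[OF that]])
  have orthD: "integral\<^sup>L ?M (\<lambda>x. g x * Q x) = integral\<^sup>L ?M (\<lambda>x. R x * Q x)"
    if "R \<in> polynomials s" "Q \<in> polynomials s" "?orth R" for R Q
  proof -
    have "0 = integral\<^sup>L ?M (\<lambda>x. g x * Q x - R x * Q x)"
      using that by (simp add: set_integral_eq_lebesgue_on_ball left_diff_distrib)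
    then show ?thesis using that intg intP by simp
  qed
  have moments: "integral\<^sup>L ?M (\<lambda>x. P x * of_real (monomial \<gamma> x)) = \<mu> \<gamma>" if \<gamma>: "\<gamma> \<in> ?I" for \<gamma>
  proof -
    have "integral\<^sup>L ?M (\<lambda>x. P x * of_real (monomial \<gamma> x)) =
        integral\<^sup>L ?M (\<lambda>x. \<Sum>\<beta>\<in>?I. \<mu> \<beta> * of_real (k \<beta> x * monomial \<gamma> x))"
      by (simp add: P_def sum_distrib_right mult.assoc)
    also have "\<dots> = (\<Sum>\<beta>\<in>?I. \<mu> \<beta> * of_real (integral\<^sup>L ?M (\<lambda>x. k \<beta> x * monomial \<gamma> x)))"
      by (intro integral_sum_of_real continuous_intros ck)
    also have "\<dots> = (\<Sum>\<beta>\<in>?I. if \<beta> = \<gamma> then \<mu> \<beta> else 0)"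
      using K \<gamma> by (intro sum.cong refl) (auto simp: k_def)
    also have "\<dots> = \<mu> \<gamma>" using \<gamma> by (simp add: sum.delta[OF finite_multi_indices])
    finally show ?thesis .
  qed
  have orthP: "?orth P"
  proof
    fix Q :: "real^'n \<Rightarrow> 'b" assume "Q \<in> polynomials s"
    then obtain q where Q: "Q = (\<lambda>x. \<Sum>\<gamma>\<in>?I. q \<gamma> * of_real (monomial \<gamma> x))"
      by (rule polynomialsE)
    have int1: "integrable ?M (\<lambda>x. q \<gamma> * (P x * of_real (monomial \<gamma> x)))" for \<gamma>
      by (intro integrable_lebesgue_on_ball_continuous continuous_intros continuous_on_polynomials[OF P])
    have int2: "integrable ?M (\<lambda>x. q \<gamma> * (g x * of_real (monomial \<gamma> x)))" for \<gamma>
      by (intro Bochner_Integration.integrable_mult_right integrable_times_continuous_on_ball[OF g'] continuous_intros)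
    have "integral\<^sup>L ?M (\<lambda>x. (g x - P x) * Q x) = integral\<^sup>L ?M (\<lambda>x. \<Sum>\<gamma>\<in>?I.
        q \<gamma> * (g x * of_real (monomial \<gamma> x)) - q \<gamma> * (P x * of_real (monomial \<gamma> x)))"
      unfolding Q sum_distrib_left by (intro Bochner_Integration.integral_cong refl sum.cong)
        (auto simp: algebra_simps)
    also have "\<dots> = (\<Sum>\<gamma>\<in>?I. integral\<^sup>L ?M (\<lambda>x. q \<gamma> * (g x * of_real (monomial \<gamma> x)))
        - integral\<^sup>L ?M (\<lambda>x. q \<gamma> * (P x * of_real (monomial \<gamma> x))))"
      by (subst Bochner_Integration.integral_sum, intro Bochner_Integration.integrable_diff int1 int2,
          intro sum.cong refl Bochner_Integration.integral_diff int1 int2)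
    also have "\<dots> = 0"
      by (intro sum.neutral ballI) (simp add: moments, simp add: \<mu>_def)
    finally show "(LINT x:ball c r|lebesgue. (g x - P x) * Q x) = 0"
      by (simp add: set_integral_eq_lebesgue_on_ball)
  qed
  have unique: "R = P" if R: "R \<in> polynomials s" "?orth R" for R
  proof -
    obtain d where d: "R = (\<lambda>x. \<Sum>\<gamma>\<in>?I. d \<gamma> * of_real (monomial \<gamma> x))"
      using R(1) by (rule polynomialsE)
    obtain e where e: "P = (\<lambda>x. \<Sum>\<gamma>\<in>?I. e \<gamma> * of_real (monomial \<gamma> x))"
      using P by (rule polynomialsE)
    have "d \<beta> = e \<beta>" if "\<beta> \<in> ?I" for \<beta>
    proof -
      have "d \<beta> = integral\<^sup>L ?M (\<lambda>x. R x * of_real (k \<beta> x))"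
        unfolding d k_def by (rule integral_against_dual_basis[OF K that, symmetric])
      also have "\<dots> = integral\<^sup>L ?M (\<lambda>x. P x * of_real (k \<beta> x))"
        using orthD[OF R(1) k_poly R(2)] orthD[OF P k_poly orthP] by simp
      also have "\<dots> = e \<beta>"
        unfolding e k_def by (rule integral_against_dual_basis[OF K that])
      finally show ?thesis .
    qed
    then show ?thesis unfolding d e by (auto intro!: sum.cong)
  qed
  have "min_poly s (ball c r) g = P"
    unfolding min_poly_def by (rule the_equality, intro conjI P orthP, erule conjE, rule unique)
  then show ?thesis using P by simp
qed


section \<open>Polynomials are controlled by their means on balls\<close>

lemma abs_monomial_le:
  assumes "norm x \<le> R" "1 \<le> R" "\<beta> \<in> multi_indices s"
  shows "\<bar>monomial \<beta> x\<bar> \<le> R ^ s"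
proof -
  have "\<bar>monomial \<beta> x\<bar> = (\<Prod>i\<in>UNIV. \<bar>x $ i\<bar> ^ \<beta> i)"
    by (simp add: monomial_def abs_prod power_abs)
  also have "\<dots> \<le> (\<Prod>i\<in>UNIV. R ^ \<beta> i)"
    using component_le_norm_cart[of x] assms
    by (intro prod_mono conjI power_mono) (auto intro: order_trans)
  also have "\<dots> = R ^ (\<Sum>i\<in>UNIV. \<beta> i)" by (simp add: power_sum)
  also have "\<dots> \<le> R ^ s" using assms by (intro power_increasing) auto
  finally show ?thesis .
qed

text \<open>
  The dual basis expresses each coefficient as an integral of the polynomial against a bounded
  kernel, so the \<open>L\<^sup>1\<close> norm on the unit ball controls the coefficients, and these control the values.
\<close>

lemma polynomials_bound_unit_ball:
  assumes R: "1 \<le> R"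
  shows "\<exists>C>0. \<forall>P \<in> (polynomials s :: (real^'n \<Rightarrow> 'b::{real_normed_field,euclidean_space}) set).
    \<forall>x. norm x \<le> R \<longrightarrow> norm (P x) \<le> C * integral\<^sup>L (lebesgue_on (ball 0 1)) (\<lambda>y. norm (P y))"
proof -
  let ?M = "lebesgue_on (ball (0 :: real^'n) 1)"
  let ?I = "multi_indices s :: ('n \<Rightarrow> nat) set"
  obtain K :: "('n \<Rightarrow> nat) \<Rightarrow> ('n \<Rightarrow> nat) \<Rightarrow> real" where
    K: "\<forall>\<beta>\<in>?I. \<forall>\<gamma>\<in>?I. integral\<^sup>L ?M
        (\<lambda>x. (\<Sum>\<delta>\<in>?I. K \<beta> \<delta> * monomial \<delta> x) * monomial \<gamma> x) = (if \<beta> = \<gamma> then 1 else 0)"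
    using ex_dual_basis[OF zero_less_one, of s 0] by (rule exE)
  define B where "B \<beta> = (\<Sum>\<delta>\<in>?I. \<bar>K \<beta> \<delta>\<bar>)" for \<beta>
  define C where "C = (\<Sum>\<beta>\<in>?I. B \<beta>) * R ^ s + 1"
  have B0: "B \<beta> \<ge> 0" for \<beta> by (simp add: B_def sum_nonneg)
  have C: "C > 0" unfolding C_def using R B0 by (intro add_nonneg_pos mult_nonneg_nonneg sum_nonneg) auto
  have "norm (P x) \<le> C * integral\<^sup>L ?M (\<lambda>y. norm (P y))"
    if P: "P \<in> polynomials s" and x: "norm x \<le> R" for P :: "real^'n \<Rightarrow> 'b" and x
  proof -
    obtain d where d: "P = (\<lambda>x. \<Sum>\<gamma>\<in>?I. d \<gamma> * of_real (monomial \<gamma> x))"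
      using P by (rule polynomialsE)
    define N where "N = integral\<^sup>L ?M (\<lambda>y. norm (P y))"
    have N: "N \<ge> 0" by (simp add: N_def)
    have cP: "continuous_on A P" for A using P by (rule continuous_on_polynomials)
    have dB: "norm (d \<beta>) \<le> B \<beta> * N" if "\<beta> \<in> ?I" for \<beta>
    proof -
      define k where "k y = (\<Sum>\<delta>\<in>?I. K \<beta> \<delta> * monomial \<delta> y)" for y
      have ck: "continuous_on A k" for A unfolding k_def by (intro continuous_intros)
      have kB: "\<bar>k y\<bar> \<le> B \<beta>" if "y \<in> ball 0 1" for y
      proof -
        have "\<bar>k y\<bar> \<le> (\<Sum>\<delta>\<in>?I. \<bar>K \<beta> \<delta>\<bar> * 1)"
          unfolding k_def
        proof (rule sum_abs[THEN order_trans], rule sum_mono)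
          fix \<delta> assume "\<delta> \<in> ?I"
          then have "\<bar>monomial \<delta> y\<bar> \<le> 1" using abs_monomial_le[of y 1 \<delta> s] that by simp
          then show "\<bar>K \<beta> \<delta> * monomial \<delta> y\<bar> \<le> \<bar>K \<beta> \<delta>\<bar> * 1"
            unfolding abs_mult by (intro mult_left_mono) auto
        qed
        then show ?thesis by (simp add: B_def)
      qed
      have "norm (d \<beta>) = norm (integral\<^sup>L ?M (\<lambda>y. P y * of_real (k y)))"
        unfolding d k_def by (subst integral_against_dual_basis[OF K that]) simp
      also have "\<dots> \<le> integral\<^sup>L ?M (\<lambda>y. norm (P y * of_real (k y)))"
        by (rule integral_norm_bound)
      also have "\<dots> \<le> integral\<^sup>L ?M (\<lambda>y. B \<beta> * norm (P y))"
      proof (rule integral_mono)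
        fix y assume "y \<in> space ?M"
        then have "\<bar>k y\<bar> \<le> B \<beta>" using kB by simp
        then show "norm (P y * of_real (k y)) \<le> B \<beta> * norm (P y)"
          by (simp add: norm_mult mult.commute mult_right_mono)
      qed (intro integrable_lebesgue_on_ball_continuous continuous_intros cP ck)+
      finally show ?thesis by (simp add: N_def)
    qed
    have "norm (P x) \<le> (\<Sum>\<beta>\<in>?I. B \<beta> * N * R ^ s)"
      unfolding d
    proof (rule norm_sum[THEN order_trans], rule sum_mono)
      fix \<beta> assume \<beta>: "\<beta> \<in> ?I"
      show "norm (d \<beta> * of_real (monomial \<beta> x)) \<le> B \<beta> * N * R ^ s"
        unfolding norm_mult norm_of_real
        using dB[OF \<beta>] abs_monomial_le[OF x R \<beta>] B0 N by (intro mult_mono) auto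
    qed
    also have "\<dots> = (\<Sum>\<beta>\<in>?I. B \<beta>) * R ^ s * N"
      by (simp add: sum_distrib_left sum_distrib_right mult_ac)
    also have "\<dots> \<le> C * N" using N by (intro mult_right_mono) (auto simp: C_def)
    finally show ?thesis by (simp add: N_def)
  qed
  then show ?thesis using C by blast
qed

lemma polynomials_bound_ball:
  assumes R: "1 \<le> R"
  shows "\<exists>C>0. \<forall>P \<in> (polynomials s :: (real^'n \<Rightarrow> 'b::{real_normed_field,euclidean_space}) set).
    \<forall>c r z x. 0 < r \<longrightarrow> 0 \<le> z \<longrightarrow> (\<integral>\<^sup>+y\<in>ball c r. ennreal (norm (P y)) \<partial>lebesgue) \<le> ennreal z \<longrightarrow>
      x \<in> ball c (R * r) \<longrightarrow> norm (P x) \<le> C * z / r ^ CARD('n)"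
proof -
  obtain C where C: "C > 0" and bound: "\<And>(P :: real^'n \<Rightarrow> 'b) x. P \<in> polynomials s \<Longrightarrow> norm x \<le> R \<Longrightarrow>
      norm (P x) \<le> C * integral\<^sup>L (lebesgue_on (ball 0 1)) (\<lambda>y. norm (P y))"
    using polynomials_bound_unit_ball[OF R] by metis
  have "norm (P x) \<le> C * z / r ^ CARD('n)"
    if P: "P \<in> polynomials s" and r: "0 < r" and z: "0 \<le> z"
      and int: "(\<integral>\<^sup>+y\<in>ball c r. ennreal (norm (P y)) \<partial>lebesgue) \<le> ennreal z"
      and x: "x \<in> ball c (R * r)" for P :: "real^'n \<Rightarrow> 'b" and c r z x
  proof -
    define Q where "Q y = P (c + r *\<^sub>R y)" for y
    have Q: "Q \<in> polynomials s" unfolding Q_def by (rule polynomials_affine[OF P])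
    have cP: "continuous_on UNIV P" and cQ: "continuous_on UNIV Q"
      using P Q by (auto intro: continuous_on_polynomials)
    have [measurable]: "P \<in> borel_measurable borel" "Q \<in> borel_measurable borel"
      using cP cQ by (auto intro: borel_measurable_continuous_onI)
    have [measurable]: "ball a b \<in> sets borel" for a :: "real^'n" and b by simp
    let ?f = "\<lambda>y. ennreal (norm (P y)) * indicator (ball c r) y"
    let ?g = "\<lambda>y. ennreal (norm (Q y)) * indicator (ball 0 1) y"
    have fg: "?f (c + r *\<^sub>R y) = ?g y" for y
      using r by (auto simp: Q_def indicator_def dist_norm)
    have "(\<integral>\<^sup>+y. ?f y \<partial>lebesgue) = (\<integral>\<^sup>+y. ?f y \<partial>lborel)"
      by (rule nn_integral_completion)
    also have "\<dots> = (\<integral>\<^sup>+y. ?f y \<partial>density (distr lborel borel (\<lambda>y. c + r *\<^sub>R y)) (\<lambda>_. \<bar>r\<bar> ^ DIM(real^'n)))"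
      using r by (subst lborel_affine[of r c]) auto
    also have "\<dots> = ennreal (r ^ CARD('n)) * (\<integral>\<^sup>+y. ?g y \<partial>lborel)"
      using r by (subst nn_integral_density; (subst nn_integral_distr)?; (subst nn_integral_cmult)?)
        (measurable, simp_all add: fg)
    also have "(\<integral>\<^sup>+y. ?g y \<partial>lborel) = (\<integral>\<^sup>+y. ?g y \<partial>lebesgue)"
      by (rule nn_integral_completion[symmetric])
    also have "\<dots> = (\<integral>\<^sup>+y. ennreal (norm (Q y)) \<partial>lebesgue_on (ball 0 1))"
      by (subst nn_integral_restrict_space) auto
    also have "\<dots> = ennreal (integral\<^sup>L (lebesgue_on (ball 0 1)) (\<lambda>y. norm (Q y)))"
      by (intro nn_integral_eq_integral integrable_lebesgue_on_ball_continuous continuous_intros cQ) auto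
    finally have "ennreal (r ^ CARD('n)) * ennreal (integral\<^sup>L (lebesgue_on (ball 0 1)) (\<lambda>y. norm (Q y))) \<le> ennreal z"
      using int by simp
    then have "r ^ CARD('n) * integral\<^sup>L (lebesgue_on (ball 0 1)) (\<lambda>y. norm (Q y)) \<le> z"
      using r z by (simp add: ennreal_mult[symmetric] ennreal_le_iff)
    then have I: "integral\<^sup>L (lebesgue_on (ball 0 1)) (\<lambda>y. norm (Q y)) \<le> z / r ^ CARD('n)"
      using r by (simp add: field_simps)
    define y where "y = (1 / r) *\<^sub>R (x - c)"
    have xy: "x = c + r *\<^sub>R y" using r by (simp add: y_def)
    have "norm y = norm (x - c) / r" using r by (simp add: y_def)
    moreover have "norm (x - c) < R * r" using x by (simp add: dist_norm norm_minus_commute)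
    ultimately have "norm y \<le> R" using r by (simp add: pos_divide_le_eq)
    then have "norm (P x) \<le> C * integral\<^sup>L (lebesgue_on (ball 0 1)) (\<lambda>y. norm (Q y))"
      using bound[OF Q] by (simp add: xy Q_def)
    also have "\<dots> \<le> C * (z / r ^ CARD('n))" using I C by (intro mult_left_mono) auto
    finally show ?thesis by simp
  qed
  then show ?thesis using C by blast
qed

section \<open>Stopping times along nested partitions\<close>

lemma sets_lebesgue_Collect_less:
  fixes f g :: "'a::euclidean_space \<Rightarrow> real"
  assumes "S \<in> sets lebesgue" and [measurable]: "f \<in> borel_measurable lebesgue" "g \<in> borel_measurable lebesgue"
  shows "{y \<in> S. f y < g y} \<in> sets lebesgue"
proof -
  have "{y \<in> space lebesgue. f y < g y} \<in> sets lebesgue" by measurable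
  from sets.Int[OF assms(1) this] show ?thesis by (simp add: Int_def)
qed

text \<open>
  A stopping time only uses that the cubes of generation \<open>k\<close> are the fibres of a map \<open>idx k\<close> with
  countably many values, that each generation refines the previous one, and that the cubes around a
  point shrink to it.
\<close>

locale nested_partitions =
  fixes idx :: "nat \<Rightarrow> 'a::euclidean_space \<Rightarrow> 'j::countable"
  assumes idx_Suc: "idx (Suc k) x = idx (Suc k) y \<Longrightarrow> idx k x = idx k y"
    and sets_idx: "{y. idx k y = j} \<in> sets lebesgue"
    and idx_fine: "open U \<Longrightarrow> x \<in> U \<Longrightarrow> \<exists>k\<ge>k0. {y. idx k y = idx k x} \<subseteq> U"
begin

definition cell :: "nat \<Rightarrow> 'j \<Rightarrow> 'a set" where
  "cell k j = {y. idx k y = j}"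

lemma mem_cell [simp]: "y \<in> cell k j \<longleftrightarrow> idx k y = j"
  by (simp add: cell_def)

lemma sets_cell [measurable, simp]: "cell k j \<in> sets lebesgue"
  unfolding cell_def by (rule sets_idx)

lemma idx_mono:
  assumes "k \<le> l" "idx l x = idx l y"
  shows "idx k x = idx k y"
  using assms
proof (induction l rule: dec_induct)
  case (step m)
  then show ?case using idx_Suc[of m x y] by blast
qed

lemma cell_subset:
  assumes "k \<le> l"
  shows "cell l (idx l x) \<subseteq> cell k (idx k x)"
proof
  fix y assume "y \<in> cell l (idx l x)"
  then show "y \<in> cell k (idx k x)" using idx_mono[OF assms, of y x] by simp
qed

text \<open>
  The maximal cells, from generation \<open>k0\<close> on, that contain a point of \<open>S\<close> and satisfy \<open>p\<close>.
\<close>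

definition first_cells :: "nat \<Rightarrow> (nat \<Rightarrow> 'j \<Rightarrow> bool) \<Rightarrow> 'a set \<Rightarrow> (nat \<times> 'j) set" where
  "first_cells k0 p S = {(k, idx k x) |k x. x \<in> S \<and> k0 \<le> k \<and> p k (idx k x) \<and>
     (\<forall>l. k0 \<le> l \<and> l < k \<longrightarrow> \<not> p l (idx l x))}"

lemma first_cellsE:
  assumes "A \<in> first_cells k0 p S"
  obtains k x where "A = (k, idx k x)" "x \<in> S" "k0 \<le> k" "p k (idx k x)"
    "\<forall>l. k0 \<le> l \<and> l < k \<longrightarrow> \<not> p l (idx l x)"
  using assms unfolding first_cells_def mem_Collect_eq by (elim exE conjE) (rule that)

text \<open>
  All points of a cell have the same ancestors, so a point lying in two of these cells determines
  both of them as its first cell satisfying \<open>p\<close>.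
\<close>

lemma disjoint_first_cells: "disjoint_family_on (case_prod cell) (first_cells k0 p S)"
proof -
  have eq: "k = l" if "k \<le> l" "k0 \<le> k" "k0 \<le> l" "idx k z = idx k x" "idx l z = idx l y"
    "p k (idx k x)" "\<forall>m. k0 \<le> m \<and> m < l \<longrightarrow> \<not> p m (idx m y)" for k l x y z
    using that idx_mono[OF that(1) that(5)] by (metis le_neq_implies_less)
  have "A = B" if in_A: "A \<in> first_cells k0 p S" and in_B: "B \<in> first_cells k0 p S"
    and z: "z \<in> case_prod cell A" "z \<in> case_prod cell B" for A B z
  proof -
    obtain k x where A: "A = (k, idx k x)" "x \<in> S" "k0 \<le> k" "p k (idx k x)"
        "\<forall>m. k0 \<le> m \<and> m < k \<longrightarrow> \<not> p m (idx m x)"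
      using in_A by (rule first_cellsE)
    obtain l y where B: "B = (l, idx l y)" "y \<in> S" "k0 \<le> l" "p l (idx l y)"
        "\<forall>m. k0 \<le> m \<and> m < l \<longrightarrow> \<not> p m (idx m y)"
      using in_B by (rule first_cellsE)
    have "k = l"
      using eq[of k l z x y] eq[of l k z y x] A B z by (metis case_prod_conv linorder_le_cases mem_cell)
    then show ?thesis using A B z by auto
  qed
  then show ?thesis unfolding disjoint_family_on_def by blast
qed

lemma first_cells_cover:
  assumes "x \<in> S" "k0 \<le> k" "p k (idx k x)"
  shows "x \<in> (\<Union>A\<in>first_cells k0 p S. case_prod cell A)"
proof -
  define m where "m = (LEAST m. k0 \<le> m \<and> p m (idx m x))"
  have "k0 \<le> m \<and> p m (idx m x)"
    unfolding m_def by (rule LeastI[of _ k]) (use assms in simp)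
  moreover have "\<not> p l (idx l x)" if "k0 \<le> l" "l < m" for l
    using not_less_Least[of l "\<lambda>m. k0 \<le> m \<and> p m (idx m x)"] that by (auto simp: m_def)
  ultimately have "(m, idx m x) \<in> first_cells k0 p S"
    using assms(1) by (auto simp: first_cells_def)
  then show ?thesis by (rule UN_I) simp
qed

lemma emeasure_Union_cells:
  assumes "sets M = sets lebesgue" "disjoint_family_on (case_prod cell) F"
  shows "emeasure M (\<Union>A\<in>F. case_prod cell A) = (\<integral>\<^sup>+A. emeasure M (case_prod cell A) \<partial>count_space F)"
  by (rule emeasure_UN_countable) (use assms in \<open>auto split: prod.splits\<close>)

lemma sets_Union_cells [measurable, simp]: "(\<Union>A\<in>F. case_prod cell A) \<in> sets lebesgue"
  by (rule sets.countable_UN') (auto split: prod.splits)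

text \<open>
  A one-sided form of the differentiation theorem for integrals. If \<open>u > c w\<close> on a set of positive
  measure, cover this set by a slightly larger open set and decompose the latter into maximal cells
  that meet the set. Each of these cells satisfies the hypothesis on averages, so summation gives
  \<open>\<integral> u \<le> c \<integral> w\<close> over the set in the limit, which is absurd.
\<close>

lemma AE_le_of_cell_averages:
  fixes u w :: "'a \<Rightarrow> real"
  assumes [measurable]: "u \<in> borel_measurable lebesgue" "w \<in> borel_measurable lebesgue"
    and fin: "emeasure (density lebesgue w) (cell k0 j0) < \<infinity>"
    and w: "\<And>x. 0 \<le> w x" and c: "0 \<le> c"
    and E [measurable]: "E \<in> sets lebesgue" and E_sub: "E \<subseteq> cell k0 j0"
    and avg: "\<And>x k. x \<in> E \<Longrightarrow> k0 \<le> k \<Longrightarrow>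
      emeasure (density lebesgue u) (cell k (idx k x)) \<le> ennreal c * emeasure (density lebesgue w) (cell k (idx k x))"
  shows "AE x in lebesgue. x \<in> E \<longrightarrow> u x \<le> c * w x"
proof -
  let ?S = "cell k0 j0"
  let ?\<mu> = "density lebesgue w" and ?\<nu> = "density lebesgue u"
  define E' where "E' = {x \<in> E. c * w x < u x}"
  have E' [measurable]: "E' \<in> sets lebesgue"
  proof -
    have "{x \<in> space lebesgue. x \<in> E \<and> c * w x < u x} \<in> sets lebesgue" by measurable
    then show ?thesis by (simp add: E'_def)
  qed
  \<comment> \<open>cells inside \<open>T\<close> that meet \<open>E'\<close> cover \<open>E'\<close>, and every one of them satisfies the average bound\<close>
  have open_cover: "emeasure ?\<nu> E' \<le> ennreal c * emeasure ?\<mu> (?S \<inter> T)" if T: "open T" "E' \<subseteq> T" for T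
  proof -
    let ?F = "first_cells k0 (\<lambda>k j. cell k j \<subseteq> T) E'"
    have E'F: "E' \<subseteq> (\<Union>A\<in>?F. case_prod cell A)"
    proof
      fix x assume x: "x \<in> E'"
      then obtain k where "k \<ge> k0" "cell k (idx k x) \<subseteq> T"
        using idx_fine[of T x k0] T unfolding cell_def by blast
      with x show "x \<in> (\<Union>A\<in>?F. case_prod cell A)" by (intro first_cells_cover)
    qed
    have sub: "(\<Union>A\<in>?F. case_prod cell A) \<subseteq> ?S \<inter> T"
    proof (rule UN_least)
      fix A assume "A \<in> ?F"
      then obtain k x where "A = (k, idx k x)" "x \<in> E'" "k0 \<le> k" "cell k (idx k x) \<subseteq> T"
        by (auto simp: first_cells_def)
      moreover from this have "idx k0 x = j0" using E_sub by (auto simp: E'_def)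
      ultimately show "case_prod cell A \<subseteq> ?S \<inter> T" using cell_subset[of k0 k x] by auto
    qed
    have "emeasure ?\<nu> E' \<le> emeasure ?\<nu> (\<Union>A\<in>?F. case_prod cell A)"
      by (rule emeasure_mono[OF E'F]) simp
    also have "\<dots> = (\<integral>\<^sup>+A. emeasure ?\<nu> (case_prod cell A) \<partial>count_space ?F)"
      by (rule emeasure_Union_cells[OF _ disjoint_first_cells]) simp
    also have "\<dots> \<le> (\<integral>\<^sup>+A. ennreal c * emeasure ?\<mu> (case_prod cell A) \<partial>count_space ?F)"
      by (rule nn_integral_mono) (auto simp: first_cells_def E'_def intro: avg)
    also have "\<dots> = ennreal c * (\<integral>\<^sup>+A. emeasure ?\<mu> (case_prod cell A) \<partial>count_space ?F)"
      by (rule nn_integral_cmult) simp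
    also have "\<dots> = ennreal c * emeasure ?\<mu> (\<Union>A\<in>?F. case_prod cell A)"
      by (subst emeasure_Union_cells[OF _ disjoint_first_cells]) simp_all
    also have "\<dots> \<le> ennreal c * emeasure ?\<mu> (?S \<inter> T)"
      using T by (intro mult_left_mono emeasure_mono[OF sub]) auto
    finally show ?thesis .
  qed
  have "\<exists>T. open T \<and> E' \<subseteq> T \<and> emeasure lebesgue (T - E') < ennreal (inverse (real (Suc n)))" for n
    using sets_lebesgue_outer_open[OF E', of "inverse (real (Suc n))"] by (metis inverse_positive_iff_positive of_nat_0_less_iff zero_less_Suc)
  then obtain T where T: "\<And>n. open (T n)" "\<And>n. E' \<subseteq> T n"
      "\<And>n. emeasure lebesgue (T n - E') < ennreal (inverse (real (Suc n)))"
    by metis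
  \<comment> \<open>a decreasing sequence, so that continuity from above applies to the finite measure on \<open>?S\<close>\<close>
  define U where "U n = (\<Inter>m\<le>n. T m)" for n
  have oU: "open (U n)" for n unfolding U_def using T by (intro open_INT) auto
  have EU: "E' \<subseteq> U n" for n using T by (auto simp: U_def)
  have UT: "U n \<subseteq> T n" for n by (auto simp: U_def)
  have [measurable]: "U n \<in> sets lebesgue" for n using oU by auto
  have null: "(\<Inter>n. ?S \<inter> U n) - E' \<in> null_sets lebesgue"
  proof -
    have "emeasure lebesgue ((\<Inter>n. ?S \<inter> U n) - E') \<le> ennreal (inverse (real (Suc n)))" for n
    proof -
      have "emeasure lebesgue ((\<Inter>n. ?S \<inter> U n) - E') \<le> emeasure lebesgue (T n - E')"
        using UT T(1)[of n] by (intro emeasure_mono) (blast, auto intro!: sets.Diff E')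
      with T(3)[of n] show ?thesis by simp
    qed
    then have "emeasure lebesgue ((\<Inter>n. ?S \<inter> U n) - E') \<le> ennreal 0"
      by (intro tendsto_lowerbound[OF tendsto_ennrealI[OF LIMSEQ_inverse_real_of_nat]]) auto
    then show ?thesis by (intro null_setsI) auto
  qed
  have "emeasure ?\<nu> E' \<le> ennreal c * emeasure ?\<mu> (?S \<inter> U n)" for n
    by (rule open_cover[OF oU EU])
  moreover have "(\<lambda>n. ennreal c * emeasure ?\<mu> (?S \<inter> U n)) \<longlonglongrightarrow> ennreal c * emeasure ?\<mu> (\<Inter>n. ?S \<inter> U n)"
  proof (intro ennreal_tendsto_cmult Lim_emeasure_decseq)
    show "decseq (\<lambda>n. ?S \<inter> U n)" by (fastforce simp: decseq_def U_def)
    show "emeasure ?\<mu> (?S \<inter> U n) \<noteq> \<infinity>" for n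
      using emeasure_mono[of "?S \<inter> U n" ?S ?\<mu>] fin by (auto simp: top_unique)
  qed auto
  ultimately have "emeasure ?\<nu> E' \<le> ennreal c * emeasure ?\<mu> (\<Inter>n. ?S \<inter> U n)"
    by (intro tendsto_lowerbound[of _ _ sequentially]) auto
  also have "emeasure ?\<mu> (\<Inter>n. ?S \<inter> U n) = emeasure ?\<mu> E'"
  proof -
    have "emeasure ?\<mu> (\<Inter>n. ?S \<inter> U n) = emeasure ?\<mu> (E' \<union> ((\<Inter>n. ?S \<inter> U n) - E'))"
      using EU E_sub by (intro arg_cong2[where f=emeasure]) (auto simp: E'_def)
    also have "\<dots> = emeasure ?\<mu> E'"
    proof (rule emeasure_Un_null_set)
      have "AE x in lebesgue. x \<in> (\<Inter>n. ?S \<inter> U n) - E' \<longrightarrow> ennreal (w x) = 0"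
        using AE_not_in[OF null] by eventually_elim blast
      then show "(\<Inter>n. ?S \<inter> U n) - E' \<in> null_sets ?\<mu>"
        using null_setsD2[OF null] by (subst null_sets_density_iff) auto
    qed simp
    finally show ?thesis .
  qed
  finally have le: "emeasure ?\<nu> E' \<le> ennreal c * emeasure ?\<mu> E'" .
  have finE': "emeasure ?\<mu> E' < \<infinity>"
    using emeasure_mono[of E' ?S ?\<mu>] fin E_sub by (auto simp: E'_def intro: le_less_trans)
  have \<nu>: "emeasure ?\<nu> E' = (\<integral>\<^sup>+x. ennreal (u x) * indicator E' x \<partial>lebesgue)"
    by (rule emeasure_density) auto
  have \<mu>: "ennreal c * emeasure ?\<mu> E' = (\<integral>\<^sup>+x. ennreal (c * w x) * indicator E' x \<partial>lebesgue)"
    using c w by (subst emeasure_density) (auto simp: nn_integral_cmult[symmetric] ennreal_mult mult.assoc)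
  have fin\<mu>: "ennreal c * emeasure ?\<mu> E' < \<infinity>"
    using finE' by (simp add: ennreal_mult_less_top)
  then have fin2: "(\<integral>\<^sup>+x. ennreal (c * w x) * indicator E' x \<partial>lebesgue) \<noteq> \<infinity>"
    unfolding \<mu> by (rule less_imp_neq)
  have "(\<integral>\<^sup>+x. ennreal (u x) * indicator E' x - ennreal (c * w x) * indicator E' x \<partial>lebesgue) =
      emeasure ?\<nu> E' - ennreal c * emeasure ?\<mu> E'"
    unfolding \<nu> \<mu> by (intro nn_integral_diff fin2) (auto simp: E'_def indicator_def intro!: AE_I2 ennreal_leI)
  also have "\<dots> = 0" using le le_less_trans[OF le fin\<mu>] by (simp add: diff_eq_0_iff_ennreal)
  finally have "AE x in lebesgue. ennreal (u x) * indicator E' x - ennreal (c * w x) * indicator E' x = 0"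
    by (subst (asm) nn_integral_0_iff_AE) auto
  then show ?thesis
  proof (eventually_elim, safe)
    fix x assume x: "ennreal (u x) * indicator E' x - ennreal (c * w x) * indicator E' x = 0" "x \<in> E"
    show "u x \<le> c * w x"
    proof (rule ccontr)
      assume "\<not> u x \<le> c * w x"
      then have "x \<in> E'" "c * w x < u x" using x(2) by (auto simp: E'_def)
      moreover have "0 \<le> c * w x" using c w by simp
      ultimately show False using x(1) by (simp add: ennreal_minus)
    qed
  qed
qed

end


section \<open>Iterating the stopping time\<close>

text \<open>
  The data of the John--Nirenberg argument in a top cell \<open>cell 0 j0\<close>: a weight \<open>w\<close> that is doubling
  along the tree of cells, and for every cell an oscillation \<open>u k j\<close>. In the application \<open>u k j\<close> is
  the distance between a fixed function and a polynomial attached to the cell, and \<open>change\<close> expresses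
  that replacing the polynomial of a cell by that of a subcell costs at most a mean value.
\<close>

locale oscillation = nested_partitions idx
  for idx :: "nat \<Rightarrow> 'a::euclidean_space \<Rightarrow> 'j::countable" +
  fixes w :: "'a \<Rightarrow> real" and u :: "nat \<Rightarrow> 'j \<Rightarrow> 'a \<Rightarrow> real" and j0 :: 'j
    and a D \<kappa> :: real
  assumes w_measurable [measurable]: "w \<in> borel_measurable lebesgue"
    and w_pos: "\<And>x. 0 < w x"
    and u_measurable [measurable]: "\<And>k j. u k j \<in> borel_measurable lebesgue"
    and finite_weight: "emeasure (density lebesgue w) (cell 0 j0) < \<infinity>"
    and a: "0 < a" and D: "0 < D" and \<kappa>: "0 < \<kappa>"
    and mean: "\<And>k x. idx 0 x = j0 \<Longrightarrow> emeasure (density lebesgue (u k (idx k x))) (cell k (idx k x)) \<le>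
        ennreal (a * measure (density lebesgue w) (cell k (idx k x)))"
    and doubling: "\<And>k x. idx 0 x = j0 \<Longrightarrow> measure (density lebesgue w) (cell k (idx k x)) \<le>
        D * measure (density lebesgue w) (cell (Suc k) (idx (Suc k) x))"
    and change: "\<And>k l x y z. idx 0 x = j0 \<Longrightarrow> k \<le> l \<Longrightarrow> 0 \<le> z \<Longrightarrow>
        emeasure (density lebesgue (u k (idx k x))) (cell l (idx l x)) \<le> ennreal z \<Longrightarrow>
        idx l y = idx l x \<Longrightarrow>
        u k (idx k x) y \<le> u l (idx l x) y +
          \<kappa> * (z + a * measure (density lebesgue w) (cell l (idx l x))) / measure lebesgue (cell l (idx l x))"
begin

abbreviation \<mu> :: "'a measure" where "\<mu> \<equiv> density lebesgue w"

definition weight :: "nat \<times> 'j \<Rightarrow> real" where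
  "weight A = measure \<mu> (case_prod cell A)"

definition density_on :: "nat \<times> 'j \<Rightarrow> real" where
  "density_on A = weight A / measure lebesgue (case_prod cell A)"

definition cells :: "(nat \<times> 'j) set" where
  "cells = {(k, idx k x) |k x. idx 0 x = j0}"

definition superlevel :: "real \<Rightarrow> nat \<times> 'j \<Rightarrow> 'a set" where
  "superlevel \<beta> A = {y \<in> case_prod cell A. \<beta> * a * w y < case_prod u A y}"

lemma weight_nonneg: "0 \<le> weight A"
  by (simp add: weight_def)

lemma emeasure_cell_finite:
  assumes "A \<in> cells"
  shows "emeasure \<mu> (case_prod cell A) < \<infinity>"
proof -
  obtain k x where A: "A = (k, idx k x)" "idx 0 x = j0" using assms unfolding cells_def by blast
  have "emeasure \<mu> (case_prod cell A) \<le> emeasure \<mu> (cell 0 j0)"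
    using cell_subset[of 0 k x] A by (intro emeasure_mono) auto
  with finite_weight show ?thesis by (metis le_less_trans)
qed

lemma emeasure_cell:
  assumes "A \<in> cells"
  shows "emeasure \<mu> (case_prod cell A) = ennreal (weight A)"
  using emeasure_cell_finite[OF assms] unfolding weight_def
  by (intro emeasure_eq_ennreal_measure) auto

lemma sets_case_prod_cell [measurable, simp]: "case_prod cell A \<in> sets lebesgue"
  by (cases A) simp

lemma sets_superlevel [measurable, simp]: "superlevel \<beta> A \<in> sets lebesgue"
  unfolding superlevel_def
  by (rule sets_lebesgue_Collect_less) (cases A; simp)+

text \<open>
  Stop at the first cells on which the integral of the oscillation of \<open>A\<close> exceeds \<open>s a\<close> times the mass.
  The masses of these cells are summed by disjointness. The parent of a stopping cell is not
  stopped, so doubling bounds the integral over the stopping cell from above as well, and this is the bound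
  that \<open>change\<close> needs.
\<close>

lemma calderon_zygmund:
  assumes A: "A \<in> cells" and s: "1 \<le> s"
  obtains F where "F \<subseteq> cells" "disjoint_family_on (case_prod cell) F"
    "ennreal s * emeasure \<mu> (\<Union>B\<in>F. case_prod cell B) \<le> ennreal (weight A)"
    "AE y in lebesgue. y \<in> case_prod cell A - (\<Union>B\<in>F. case_prod cell B) \<longrightarrow> case_prod u A y \<le> s * a * w y"
    "\<And>B y. B \<in> F \<Longrightarrow> y \<in> case_prod cell B \<Longrightarrow>
      case_prod u A y \<le> case_prod u B y + \<kappa> * (s * D + 1) * a * density_on B"
proof -
  obtain k x0 where A_eq: "A = (k, idx k x0)" and x0: "idx 0 x0 = j0"
    using A unfolding cells_def by blast
  let ?j = "idx k x0"
  let ?\<nu> = "density lebesgue (u k ?j)"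
  define bad where "bad l i \<longleftrightarrow> ennreal (s * a * weight (l, i)) < emeasure ?\<nu> (cell l i)" for l i
  define F where "F = first_cells k bad (cell k ?j)"
  let ?V = "\<Union>B\<in>F. case_prod cell B"
  \<comment> \<open>so every stopping cell has a parent that lies in \<open>A\<close> and was not stopped\<close>
  have good_top: "\<not> bad k ?j"
  proof -
    have "a * weight A \<le> s * a * weight A"
      using s a weight_nonneg[of A] mult_right_mono[of 1 s "a * weight A"] by simp
    then show ?thesis
      using mean[OF x0, of k] by (auto simp: bad_def weight_def A_eq not_less intro: order_trans ennreal_leI)
  qed
  have in_top: "idx 0 x = j0" if "idx k x = ?j" for x
    using idx_mono[OF le0 that] x0 by simp
  have F: "\<exists>l x. B = (Suc l, idx (Suc l) x) \<and> idx k x = ?j \<and> k \<le> l \<and> bad (Suc l) (idx (Suc l) x)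
      \<and> \<not> bad l (idx l x)" if in_F: "B \<in> F" for B
  proof -
    obtain m x where m: "B = (m, idx m x)" "x \<in> cell k ?j" "k \<le> m" "bad m (idx m x)"
      "\<forall>l. k \<le> l \<and> l < m \<longrightarrow> \<not> bad l (idx l x)"
      using in_F unfolding F_def by (rule first_cellsE)
    moreover from m(2) have "idx k x = ?j" by simp
    moreover have "m \<noteq> k" using m(4) good_top \<open>idx k x = ?j\<close> by metis
    ultimately obtain l where l: "m = Suc l" "k \<le> l" by (cases m) auto
    then have "\<not> bad l (idx l x)" using m(5) by simp
    with m l \<open>idx k x = ?j\<close> show ?thesis by blast
  qed
  have F_cells: "F \<subseteq> cells"
    using F in_top unfolding cells_def by blast
  have disj: "disjoint_family_on (case_prod cell) F"
    unfolding F_def by (rule disjoint_first_cells)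
  have V_sub: "?V \<subseteq> cell k ?j"
  proof (rule UN_least)
    fix B assume "B \<in> F"
    then obtain l x where "B = (Suc l, idx (Suc l) x)" "idx k x = ?j" "k \<le> l" using F by blast
    then show "case_prod cell B \<subseteq> cell k ?j" using cell_subset[of k "Suc l" x] by simp
  qed
  have small: "ennreal s * emeasure \<mu> ?V \<le> ennreal (weight A)"
  proof -
    have "ennreal (s * a) * emeasure \<mu> ?V = (\<integral>\<^sup>+B. ennreal (s * a) * emeasure \<mu> (case_prod cell B) \<partial>count_space F)"
      by (subst emeasure_Union_cells[OF _ disj]) (simp_all add: nn_integral_cmult)
    also have "\<dots> \<le> (\<integral>\<^sup>+B. emeasure ?\<nu> (case_prod cell B) \<partial>count_space F)"
    proof (rule nn_integral_mono)
      fix B assume "B \<in> space (count_space F)"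
      then have B: "B \<in> F" by simp
      then have "ennreal (s * a * weight B) < emeasure ?\<nu> (case_prod cell B)"
        using F[OF B] by (auto simp: bad_def)
      moreover have "ennreal (s * a) * emeasure \<mu> (case_prod cell B) = ennreal (s * a * weight B)"
        using B F_cells s a weight_nonneg[of B] by (subst emeasure_cell) (auto simp: ennreal_mult)
      ultimately show "ennreal (s * a) * emeasure \<mu> (case_prod cell B) \<le> emeasure ?\<nu> (case_prod cell B)"
        by simp
    qed
    also have "\<dots> = emeasure ?\<nu> ?V"
      by (rule emeasure_Union_cells[OF _ disj, symmetric]) simp
    also have "\<dots> \<le> emeasure ?\<nu> (cell k ?j)"
      by (rule emeasure_mono[OF V_sub]) simp
    also have "\<dots> \<le> ennreal (a * weight A)"
      using mean[OF x0] by (simp add: weight_def A_eq)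
    finally have "ennreal a * (ennreal s * emeasure \<mu> ?V) \<le> ennreal a * ennreal (weight A)"
      using a s weight_nonneg[of A] by (simp add: ennreal_mult mult_ac)
    then show ?thesis using a by (simp add: ennreal_mult_le_mult_iff)
  qed
  have ae: "AE y in lebesgue. y \<in> case_prod cell A - ?V \<longrightarrow> case_prod u A y \<le> s * a * w y"
  proof -
    have "AE y in lebesgue. y \<in> cell k ?j - ?V \<longrightarrow> u k ?j y \<le> s * a * w y"
    proof (rule AE_le_of_cell_averages[of _ _ k ?j])
      show "emeasure \<mu> (cell k ?j) < \<infinity>" using emeasure_cell_finite[OF A] by (simp add: A_eq)
      fix x l assume x: "x \<in> cell k ?j - ?V" "k \<le> l"
      then have "\<not> bad l (idx l x)" using first_cells_cover[of x "cell k ?j" k l bad] by (auto simp: F_def)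
      moreover have "(l, idx l x) \<in> cells" using x in_top by (auto simp: cells_def)
      ultimately show "emeasure ?\<nu> (cell l (idx l x)) \<le> ennreal (s * a) * emeasure \<mu> (cell l (idx l x))"
        using emeasure_cell[of "(l, idx l x)"] s a weight_nonneg
        by (simp add: bad_def not_less ennreal_mult)
    qed (use s a w_pos in \<open>auto simp: less_imp_le\<close>)
    then show ?thesis by (simp add: A_eq)
  qed
  have step: "case_prod u A y \<le> case_prod u B y + \<kappa> * (s * D + 1) * a * density_on B"
    if B: "B \<in> F" and y: "y \<in> case_prod cell B" for B y
  proof -
    obtain l x where lx: "B = (Suc l, idx (Suc l) x)" "idx k x = ?j" "k \<le> l" "\<not> bad l (idx l x)"
      using F[OF B] by blast
    have x: "idx 0 x = j0" using in_top[OF lx(2)] .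
    have "emeasure ?\<nu> (case_prod cell B) \<le> emeasure ?\<nu> (cell l (idx l x))"
      using cell_subset[of l "Suc l" x] lx by (intro emeasure_mono) auto
    also have "\<dots> \<le> ennreal (s * a * weight (l, idx l x))"
      using lx by (simp add: bad_def not_less)
    also have "\<dots> \<le> ennreal (s * a * (D * weight B))"
      using doubling[OF x, of l] s a by (intro ennreal_leI mult_left_mono) (auto simp: weight_def lx)
    finally have z: "emeasure (density lebesgue (u k (idx k x))) (cell (Suc l) (idx (Suc l) x))
        \<le> ennreal (s * a * (D * weight B))"
      using lx by simp
    have "u k (idx k x) y \<le> u (Suc l) (idx (Suc l) x) y +
          \<kappa> * (s * a * (D * weight B) + a * measure \<mu> (cell (Suc l) (idx (Suc l) x))) /
            measure lebesgue (cell (Suc l) (idx (Suc l) x))"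
      by (rule change[OF x _ _ z]) (use lx y s a D weight_nonneg[of B] in auto)
    then show ?thesis
      by (simp add: A_eq lx density_on_def weight_def algebra_simps add_divide_distrib)
  qed
  show ?thesis by (rule that[OF F_cells disj small ae step])
qed

text \<open>
  Above the level \<open>s\<close> the superlevel set is contained in the stopping cells up to a null set. There,
  splitting \<open>\<beta>\<close> into \<open>\<beta>1 + \<beta>2\<close>, either the new oscillation exceeds \<open>\<beta>2 a w\<close> or the cost of the
  change of cell exceeds \<open>\<beta>1 a w\<close>. The gain is the factor \<open>1 / s\<close> from the total mass of the stopping cells.
\<close>

lemma superlevel_recursion:
  assumes A: "A \<in> cells" and s: "1 \<le> s" and \<beta>: "s \<le> \<beta>" "\<beta>1 + \<beta>2 \<le> \<beta>" and gh: "0 \<le> g" "0 \<le> h"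
    and g: "\<And>B. B \<in> cells \<Longrightarrow> emeasure \<mu> (superlevel \<beta>2 B) \<le> ennreal (g * weight B)"
    and h: "\<And>B. B \<in> cells \<Longrightarrow>
      emeasure \<mu> {y \<in> case_prod cell B. \<beta>1 * w y < \<kappa> * (s * D + 1) * density_on B} \<le> ennreal (h * weight B)"
  shows "emeasure \<mu> (superlevel \<beta> A) \<le> ennreal ((g + h) / s * weight A)"
proof -
  obtain F where F: "F \<subseteq> cells" "disjoint_family_on (case_prod cell) F"
    "ennreal s * emeasure \<mu> (\<Union>B\<in>F. case_prod cell B) \<le> ennreal (weight A)"
    "AE y in lebesgue. y \<in> case_prod cell A - (\<Union>B\<in>F. case_prod cell B) \<longrightarrow> case_prod u A y \<le> s * a * w y"
    "\<And>B y. B \<in> F \<Longrightarrow> y \<in> case_prod cell B \<Longrightarrow>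
      case_prod u A y \<le> case_prod u B y + \<kappa> * (s * D + 1) * a * density_on B"
    by (rule calderon_zygmund[OF A s]) blast
  let ?V = "\<Union>B\<in>F. case_prod cell B"
  define T where "T B = {y \<in> case_prod cell B. \<beta>1 * w y < \<kappa> * (s * D + 1) * density_on B}" for B
  have T [measurable]: "T B \<in> sets lebesgue" for B
    unfolding T_def by (rule sets_lebesgue_Collect_less) simp_all
  have disj: "disjoint_family_on (\<lambda>B. superlevel \<beta>2 B \<union> T B) F"
    using F(2) unfolding disjoint_family_on_def superlevel_def T_def by blast
  have mem: "y \<in> (\<Union>B\<in>F. superlevel \<beta>2 B \<union> T B)"
    if y: "y \<in> superlevel \<beta> A" and ae: "y \<in> case_prod cell A - ?V \<longrightarrow> case_prod u A y \<le> s * a * w y" for y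
  proof -
    have pos: "0 < a * w y" using a w_pos by simp
    have "s * (a * w y) \<le> \<beta> * (a * w y)" using \<beta>(1) pos by (intro mult_right_mono) auto
    moreover have "y \<in> case_prod cell A" "\<beta> * (a * w y) < case_prod u A y"
      using y by (simp_all add: superlevel_def mult.assoc)
    ultimately have "y \<in> ?V" using ae by (auto simp only: Diff_iff mult.assoc)
    then obtain B where B: "B \<in> F" "y \<in> case_prod cell B" by blast
    have "(\<beta>1 + \<beta>2) * (a * w y) \<le> \<beta> * (a * w y)" using \<beta>(2) pos by (intro mult_right_mono) auto
    also have "\<dots> < case_prod u B y + \<kappa> * (s * D + 1) * a * density_on B"
      using F(5)[OF B] y by (auto simp: superlevel_def mult.assoc)
    finally have *: "\<beta>2 * a * w y < case_prod u B y \<or>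
        a * (\<beta>1 * w y) < a * (\<kappa> * (s * D + 1) * density_on B)"
      by (auto simp: algebra_simps)
    have "y \<in> superlevel \<beta>2 B \<union> T B"
      using * B(2) a mult_less_cancel_left_pos[OF a] by (auto simp: superlevel_def T_def)
    with B show ?thesis by blast
  qed
  have cnt: "countable F" by simp
  have sets_U: "(\<Union>B\<in>F. superlevel \<beta>2 B \<union> T B) \<in> sets lebesgue"
    by (intro sets.countable_UN' cnt) auto
  have "emeasure \<mu> (superlevel \<beta> A) \<le> emeasure \<mu> (\<Union>B\<in>F. superlevel \<beta>2 B \<union> T B)"
  proof (rule emeasure_mono_AE)
    show "AE y in \<mu>. y \<in> superlevel \<beta> A \<longrightarrow> y \<in> (\<Union>B\<in>F. superlevel \<beta>2 B \<union> T B)"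
    proof (subst AE_density)
      show "AE y in lebesgue. 0 < ennreal (w y) \<longrightarrow>
          y \<in> superlevel \<beta> A \<longrightarrow> y \<in> (\<Union>B\<in>F. superlevel \<beta>2 B \<union> T B)"
        using F(4) by eventually_elim (intro impI, rule mem, assumption, blast)
    qed simp
  qed (use sets_U in simp)
  also have "\<dots> = (\<integral>\<^sup>+B. emeasure \<mu> (superlevel \<beta>2 B \<union> T B) \<partial>count_space F)"
    by (rule emeasure_UN_countable[OF _ cnt disj]) auto
  also have "\<dots> \<le> (\<integral>\<^sup>+B. ennreal (g + h) * emeasure \<mu> (case_prod cell B) \<partial>count_space F)"
  proof (rule nn_integral_mono)
    fix B assume "B \<in> space (count_space F)"
    then have B: "B \<in> cells" using F(1) by auto
    have "emeasure \<mu> (superlevel \<beta>2 B \<union> T B) \<le> emeasure \<mu> (superlevel \<beta>2 B) + emeasure \<mu> (T B)"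
      by (rule emeasure_subadditive) auto
    also have "\<dots> \<le> ennreal (g * weight B) + ennreal (h * weight B)"
      using g[OF B] h[OF B] unfolding T_def by (rule add_mono)
    also have "\<dots> = ennreal (g + h) * emeasure \<mu> (case_prod cell B)"
      using gh weight_nonneg[of B] by (simp add: emeasure_cell[OF B] ennreal_plus[symmetric] ennreal_mult[symmetric] distrib_right del: ennreal_plus)
    finally show "emeasure \<mu> (superlevel \<beta>2 B \<union> T B) \<le> ennreal (g + h) * emeasure \<mu> (case_prod cell B)" .
  qed
  also have "\<dots> = ennreal (g + h) * emeasure \<mu> ?V"
    by (subst emeasure_Union_cells[OF _ F(2)]) (simp_all add: nn_integral_cmult)
  also have "\<dots> = ennreal ((g + h) / s) * (ennreal s * emeasure \<mu> ?V)"
    using gh s by (simp add: mult.assoc[symmetric] ennreal_mult[symmetric])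
  also have "\<dots> \<le> ennreal ((g + h) / s) * ennreal (weight A)"
    by (intro mult_left_mono F(3)) simp
  also have "\<dots> = ennreal ((g + h) / s * weight A)"
    using gh s weight_nonneg[of A] by (simp add: ennreal_mult[symmetric])
  finally show ?thesis .
qed

lemma superlevel_trivial:
  assumes "A \<in> cells"
  shows "emeasure \<mu> (superlevel \<beta> A) \<le> ennreal (weight A)"
  unfolding emeasure_cell[OF assms, symmetric]
  by (intro emeasure_mono) (auto simp: superlevel_def)

text \<open>
  With an \<open>A\<^sub>1\<close> weight the cost of changing the cell never exceeds \<open>L a w\<close>. With \<open>s = 2\<close>, every
  increase of the level by \<open>L\<close> therefore halves the mass.
\<close>

lemma superlevel_exponential:
  assumes A1: "\<And>B. B \<in> cells \<Longrightarrow> AE y in lebesgue. y \<in> case_prod cell B \<longrightarrow> density_on B \<le> A * w y"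
    and A: "0 < A" and L: "2 \<le> L" "\<kappa> * (2 * D + 1) * A \<le> L" and \<beta>: "0 \<le> \<beta>" and Q: "Q \<in> cells"
  shows "emeasure \<mu> (superlevel \<beta> Q) \<le> ennreal (2 * exp (- (ln 2 / L * \<beta>)) * weight Q)"
proof -
  have iter: "emeasure \<mu> (superlevel \<beta> B) \<le> ennreal ((1/2) ^ n * weight B)" if "real n * L \<le> \<beta>" "B \<in> cells" for n \<beta> B
    using that
  proof (induction n arbitrary: \<beta> B)
    case 0
    then show ?case using superlevel_trivial by simp
  next
    case (Suc n)
    have "emeasure \<mu> (superlevel \<beta> B) \<le> ennreal (((1/2) ^ n + 0) / 2 * weight B)"
    proof (rule superlevel_recursion[OF Suc.prems(2), of 2 \<beta> L "\<beta> - L"])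
      have "0 \<le> real n * L" using L by simp
      then have "L \<le> \<beta>" using Suc.prems(1) by (simp add: distrib_right)
      then show "2 \<le> \<beta>" using L by simp
      show "emeasure \<mu> (superlevel (\<beta> - L) C) \<le> ennreal ((1/2) ^ n * weight C)" if "C \<in> cells" for C
        using Suc.IH[of "\<beta> - L" C] Suc.prems(1) that by (simp add: distrib_right)
      show "emeasure \<mu> {y \<in> case_prod cell C. L * w y < \<kappa> * (2 * D + 1) * density_on C} \<le> ennreal (0 * weight C)"
        if C: "C \<in> cells" for C
      proof -
        have meas: "{y \<in> case_prod cell C. L * w y < \<kappa> * (2 * D + 1) * density_on C} \<in> sets lebesgue"
          by (rule sets_lebesgue_Collect_less) simp_all
        have "AE y in lebesgue. y \<notin> {y \<in> case_prod cell C. L * w y < \<kappa> * (2 * D + 1) * density_on C}"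
          using A1[OF C]
        proof eventually_elim
          fix y assume 1: "y \<in> case_prod cell C \<longrightarrow> density_on C \<le> A * w y"
          show "y \<notin> {y \<in> case_prod cell C. L * w y < \<kappa> * (2 * D + 1) * density_on C}"
          proof
          assume "y \<in> {y \<in> case_prod cell C. L * w y < \<kappa> * (2 * D + 1) * density_on C}"
          with 1 have y: "density_on C \<le> A * w y" "L * w y < \<kappa> * (2 * D + 1) * density_on C"
            by blast+
          have "\<kappa> * (2 * D + 1) * density_on C \<le> \<kappa> * (2 * D + 1) * (A * w y)"
            using \<kappa> D y by (intro mult_left_mono) auto
          also have "\<dots> \<le> L * w y"
            using mult_right_mono[OF L(2), of "w y"] w_pos[of y] by (simp add: mult.assoc)
          finally show False using y by simp
          qed
        qed
        then have "{y \<in> case_prod cell C. L * w y < \<kappa> * (2 * D + 1) * density_on C} \<in> null_sets \<mu>"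
          using meas by (subst null_sets_density_iff) (auto elim!: eventually_mono)
        then show ?thesis by (simp add: null_sets_def)
      qed
    qed auto
    then show ?case by simp
  qed
  define n where "n = nat \<lfloor>\<beta> / L\<rfloor>"
  have n: "real n \<le> \<beta> / L" "\<beta> / L < real n + 1"
    using \<beta> L by (auto simp: n_def of_nat_nat)
  have "(1/2 :: real) ^ n = exp (- (ln 2 * real n))"
    by (simp add: exp_minus exp_of_nat2_mult power_one_over inverse_eq_divide)
  also have "\<dots> \<le> exp (ln 2 - ln 2 / L * \<beta>)"
    using n mult_left_mono[of "\<beta> / L" "real n + 1" "ln 2"] by (simp add: algebra_simps)
  also have "\<dots> = 2 * exp (- (ln 2 / L * \<beta>))" by (simp add: exp_diff exp_minus field_simps)
  finally have "(1/2 :: real) ^ n \<le> 2 * exp (- (ln 2 / L * \<beta>))" .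
  then have "ennreal ((1/2) ^ n * weight Q) \<le> ennreal (2 * exp (- (ln 2 / L * \<beta>)) * weight Q)"
    by (intro ennreal_leI mult_right_mono weight_nonneg)
  with iter[OF _ Q, of n \<beta>] n L show ?thesis
    by (auto simp: field_simps intro: order_trans)
qed

text \<open>
  Induction on the dyadic size of \<open>\<beta>\<close>. Replacing \<open>\<beta>\<close> by \<open>\<beta> / 2\<close> loses a factor \<open>2 powr r\<close> in the
  inductive bound, and adding the cost of the change of cell loses another factor \<open>2\<close>; the choice of \<open>s\<close>
  compensates exactly for both. Below level \<open>s\<close> the bound is trivial because of the first condition on \<open>M\<close>.
\<close>

lemma superlevel_power:
  assumes Aq: "\<And>B \<rho>. B \<in> cells \<Longrightarrow> 0 < \<rho> \<Longrightarrow>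
      emeasure \<mu> {y \<in> case_prod cell B. \<rho> * w y < density_on B} \<le> ennreal (H * \<rho> powr - r * weight B)"
    and H: "0 \<le> H" and r: "0 < r" and s: "s = 2 powr (r + 1)"
    and M: "s powr r \<le> M" "H * (\<kappa> * (s * D + 1)) powr r \<le> M"
    and \<beta>: "0 < \<beta>" and Q: "Q \<in> cells"
  shows "emeasure \<mu> (superlevel \<beta> Q) \<le> ennreal (M * \<beta> powr - r * weight Q)"
proof -
  have s2: "2 \<le> s" unfolding s using powr_mono[of 1 "r + 1" 2] r by simp
  have M0: "0 < M" using M(1) s2 by (smt (verit) powr_gt_zero)
  have iter: "emeasure \<mu> (superlevel \<beta> B) \<le> ennreal (M * \<beta> powr - r * weight B)"
    if "\<beta> \<le> 2 ^ n * s" "0 < \<beta>" "B \<in> cells" for n \<beta> B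
    using that
  proof (induction n arbitrary: \<beta> B)
    case 0
    have "1 = \<beta> powr r * \<beta> powr - r" using 0 by (simp add: powr_minus)
    also have "\<dots> \<le> M * \<beta> powr - r"
      using 0 M(1) r powr_mono2[of r \<beta> s] by (intro mult_right_mono) auto
    finally have "1 * weight B \<le> M * \<beta> powr - r * weight B"
      by (intro mult_right_mono weight_nonneg)
    then show ?case using superlevel_trivial[OF 0(3)] by (auto intro: order_trans ennreal_leI)
  next
    case (Suc n)
    show ?case
    proof (cases "\<beta> \<le> s")
      case True
      have "1 = \<beta> powr r * \<beta> powr - r" using Suc.prems by (simp add: powr_minus)
      also have "\<dots> \<le> M * \<beta> powr - r"
        using True Suc.prems M(1) r powr_mono2[of r \<beta> s] by (intro mult_right_mono) auto
      finally have "1 * weight B \<le> M * \<beta> powr - r * weight B"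
        by (intro mult_right_mono weight_nonneg)
      then show ?thesis using superlevel_trivial[OF Suc.prems(3)] by (auto intro: order_trans ennreal_leI)
    next
      case False
      define c where "c = \<kappa> * (s * D + 1)"
      have c: "0 < c" using \<kappa> D s2 by (simp add: c_def add_pos_pos)
      define g where "g = M * (\<beta> / 2) powr - r"
      define h where "h = H * (\<beta> / (2 * c)) powr - r"
      have "emeasure \<mu> (superlevel \<beta> B) \<le> ennreal ((g + h) / s * weight B)"
      proof (rule superlevel_recursion[OF Suc.prems(3), of s \<beta> "\<beta> / 2" "\<beta> / 2"])
        show "emeasure \<mu> (superlevel (\<beta> / 2) C) \<le> ennreal (g * weight C)" if "C \<in> cells" for C
          unfolding g_def using Suc.IH[of "\<beta> / 2" C] Suc.prems that by simp
        show "emeasure \<mu> {y \<in> case_prod cell C. \<beta> / 2 * w y < \<kappa> * (s * D + 1) * density_on C} \<le> ennreal (h * weight C)"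
          if "C \<in> cells" for C
        proof -
          have "{y \<in> case_prod cell C. \<beta> / 2 * w y < \<kappa> * (s * D + 1) * density_on C} =
              {y \<in> case_prod cell C. \<beta> / (2 * c) * w y < density_on C}"
            unfolding c_def[symmetric] using c by (auto simp: field_simps)
          then show ?thesis unfolding h_def using Aq[OF that, of "\<beta> / (2 * c)"] c Suc.prems by simp
        qed
      qed (use s2 False H M0 in \<open>auto simp: g_def h_def\<close>)
      also have "(g + h) / s \<le> M * \<beta> powr - r"
      proof -
        have g: "g = M * 2 powr r * \<beta> powr - r"
          using Suc.prems by (simp add: g_def powr_divide powr_minus field_simps)
        have h: "h = H * c powr r * 2 powr r * \<beta> powr - r"
          using Suc.prems c by (simp add: h_def powr_divide powr_minus powr_mult field_simps)
        have le: "H * c powr r * 2 powr r \<le> M * 2 powr r"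
          using M(2) by (intro mult_right_mono) (simp_all add: c_def)
        have "g + h \<le> (M * 2 powr r + M * 2 powr r) * \<beta> powr - r"
          unfolding g h distrib_right by (intro add_mono mult_right_mono le) auto
        also have "\<dots> = s * (M * \<beta> powr - r)" by (simp add: s powr_add)
        finally show ?thesis using s2 by (simp add: field_simps)
      qed
      then have "ennreal ((g + h) / s * weight B) \<le> ennreal (M * \<beta> powr - r * weight B)"
        by (intro ennreal_leI mult_right_mono weight_nonneg)
      finally show ?thesis .
    qed
  qed
  obtain n :: nat where n: "\<beta> / s < 2 ^ n" using real_arch_pow[of 2 "\<beta> / s"] by auto
  show ?thesis by (rule iter[of \<beta> n]) (use n \<beta> Q s2 in \<open>auto simp: field_simps\<close>)
qed

end

section \<open>Balls and masses\<close>

lemma ball_in_balls: "0 < r \<Longrightarrow> ball c r \<in> balls"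
  by (auto simp: balls_def)

lemma ballsE:
  assumes "B \<in> balls"
  obtains c r where "B = ball c r" "0 < r"
  using assms by (auto simp: balls_def)

lemma sets_balls [simp]: "B \<in> balls \<Longrightarrow> B \<in> sets lebesgue"
  by (auto elim!: ballsE)

lemma emeasure_balls_finite: "B \<in> balls \<Longrightarrow> emeasure lebesgue B < \<infinity>"
  using lmeasurable_ball by (auto elim!: ballsE simp: fmeasurable_def)

lemma measure_balls_pos: "B \<in> balls \<Longrightarrow> 0 < measure lebesgue B"
  by (auto elim!: ballsE simp: content_ball_pos)

lemma mass_eq_emeasure:
  assumes "(\<lambda>x. \<phi> x t) \<in> borel_measurable lebesgue" "E \<in> sets lebesgue"
  shows "mass \<phi> E t = emeasure (density lebesgue (\<lambda>x. ennreal (\<phi> x t))) E"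
  using assms unfolding mass_def by (subst emeasure_density) auto

lemma mass_mono: "E \<subseteq> F \<Longrightarrow> mass \<phi> E t \<le> mass \<phi> F t"
  unfolding mass_def by (intro nn_integral_mono) (auto simp: indicator_def)

text \<open>
  Positivity of the integrals in the Muckenhoupt conditions; it excludes that finiteness of a
  product is due to a factor \<open>0\<close>.
\<close>

lemma set_nn_integral_pos:
  fixes f :: "'a::euclidean_space \<Rightarrow> real"
  assumes [measurable]: "f \<in> borel_measurable lebesgue" and E [measurable]: "E \<in> sets lebesgue"
    and pos: "\<And>x. 0 < f x" "0 < measure lebesgue E"
  shows "0 < (\<integral>\<^sup>+x\<in>E. ennreal (f x) \<partial>lebesgue)"
proof (rule ccontr)
  assume "\<not> 0 < (\<integral>\<^sup>+x\<in>E. ennreal (f x) \<partial>lebesgue)"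
  then have "(\<integral>\<^sup>+x\<in>E. ennreal (f x) \<partial>lebesgue) = 0" by (simp add: zero_less_iff_neq_zero)
  then have "AE x in lebesgue. ennreal (f x) * indicator E x = 0"
    by (subst (asm) nn_integral_0_iff_AE) auto
  then have "AE x in lebesgue. x \<notin> E"
    by eventually_elim (use pos(1) in \<open>auto simp: indicator_def less_le not_less split: if_splits\<close>)
  then have "E \<in> null_sets lebesgue" using E by (simp add: AE_iff_null_sets)
  then have "measure lebesgue E = 0" by (rule measure_eq_0_null_sets)
  then show False using pos(2) by simp
qed


section \<open>Muckenhoupt weights\<close>

text \<open>
  A finite supremum also forces every mass \<open>mass \<phi> B t\<close> to be finite, since the essential supremum
  of \<open>1 / \<phi>\<close> is positive.
\<close>

lemma muckenhoupt_oneD: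
  fixes \<phi> :: "real^'n \<Rightarrow> real \<Rightarrow> real"
  assumes A1: "\<phi> \<in> muckenhoupt 1"
    and pos: "\<And>x t. 0 < t \<Longrightarrow> 0 < \<phi> x t"
  obtains A where "0 < A" "\<And>t B. 0 < t \<Longrightarrow> B \<in> balls \<Longrightarrow> mass \<phi> B t < \<infinity>"
    "\<And>t B. 0 < t \<Longrightarrow> B \<in> balls \<Longrightarrow>
       AE y in lebesgue. y \<in> B \<longrightarrow> enn2real (mass \<phi> B t) / measure lebesgue B \<le> A * \<phi> y t"
proof -
  define S where "S = (SUP t\<in>{0<..}. SUP B\<in>balls. ennreal (1 / measure lebesgue B) * mass \<phi> B t *
           esssup (restrict_space lebesgue B) (\<lambda>y. ennreal (1 / \<phi> y t)))"
  have S: "S < top" using A1 by (simp add: muckenhoupt_def S_def)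
  define A where "A = enn2real S + 1"
  have A: "0 < A" by (simp add: A_def add_nonneg_pos)
  have SA: "S \<le> ennreal A" using S by (cases S) (auto simp: A_def)
  have *: "mass \<phi> B t < \<infinity> \<and> (AE y in lebesgue. y \<in> B \<longrightarrow> enn2real (mass \<phi> B t) / measure lebesgue B \<le> A * \<phi> y t)"
    if t: "0 < t" and B: "B \<in> balls" for t B
  proof -
    let ?e = "esssup (restrict_space lebesgue B) (\<lambda>y. ennreal (1 / \<phi> y t))"
    have "ennreal (1 / measure lebesgue B) * mass \<phi> B t * ?e \<le> S"
      unfolding S_def using t B by (intro SUP_upper2[of t] SUP_upper2[of B]) auto
    then have le: "ennreal (1 / measure lebesgue B) * mass \<phi> B t * ?e \<le> ennreal A"
      using SA by (rule order_trans)
    have "AE y in restrict_space lebesgue B. ennreal (1 / \<phi> y t) \<le> ?e"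
      by (rule esssup_AE)
    then have ae: "AE y in lebesgue. y \<in> B \<longrightarrow> ennreal (1 / \<phi> y t) \<le> ?e"
      using B by (simp add: AE_restrict_space_iff)
    have "\<exists>y. y \<in> B \<and> ennreal (1 / \<phi> y t) \<le> ?e"
    proof (rule ccontr)
      assume no: "\<nexists>y. y \<in> B \<and> ennreal (1 / \<phi> y t) \<le> ?e"
      from ae have "AE y in lebesgue. y \<notin> B" by eventually_elim (use no in blast)
      then have "B \<in> null_sets lebesgue" using B by (simp add: AE_iff_null_sets)
      then show False using measure_balls_pos[OF B] measure_eq_0_null_sets by fastforce
    qed
    then obtain y where y: "ennreal (1 / \<phi> y t) \<le> ?e" by blast
    moreover have "0 < 1 / \<phi> y t" using pos[OF t] by simp
    ultimately have e: "0 < ?e" by (metis ennreal_less_zero_iff less_le_trans)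
    have fin: "mass \<phi> B t < \<infinity>"
    proof (rule ccontr)
      assume "\<not> mass \<phi> B t < \<infinity>"
      then have "mass \<phi> B t = top" by (simp add: less_top[symmetric])
      then show False using le e measure_balls_pos[OF B]
        by (simp add: ennreal_mult_top ennreal_top_mult ennreal_top_eq_mult_iff top_unique zero_less_iff_neq_zero split: if_splits)
    qed
    define m where "m = enn2real (mass \<phi> B t)"
    have m: "mass \<phi> B t = ennreal m" "0 \<le> m" using fin by (simp_all add: m_def)
    have "AE y in lebesgue. y \<in> B \<longrightarrow> m / measure lebesgue B \<le> A * \<phi> y t"
      using ae
    proof eventually_elim
      case (elim y)
      show ?case
      proof
        assume "y \<in> B"
        then have "ennreal (1 / measure lebesgue B) * ennreal m * ennreal (1 / \<phi> y t) \<le> ennreal A"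
          using elim le unfolding m(1) by (meson mult_left_mono order_trans zero_le)
        then have "1 / measure lebesgue B * m * (1 / \<phi> y t) \<le> A"
          using A m pos[OF t, of y] by (simp add: ennreal_mult[symmetric] less_imp_le)
        then show "m / measure lebesgue B \<le> A * \<phi> y t"
          using pos[OF t, of y] measure_balls_pos[OF B]
            by (simp add: field_simps)
      qed
    qed
    with fin show ?thesis by (simp add: m_def)
  qed
  show ?thesis by (rule that[OF A]) (use * in blast)+
qed

text \<open>
  The exponents are those of the conjugate exponent written out: \<open>q / q' = q - 1\<close> and
  \<open>- q' / q = - 1 / (q - 1)\<close>. The mass of a ball is finite because the other factor
  in the Muckenhoupt condition is positive, and the integral of the negative power is finite because
  the mass is positive.
\<close>

lemma muckenhouptD:
  fixes \<phi> :: "real^'n \<Rightarrow> real \<Rightarrow> real"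
  assumes Aq: "\<phi> \<in> muckenhoupt q" and q: "1 < q"
    and meas: "\<And>t. 0 < t \<Longrightarrow> (\<lambda>x. \<phi> x t) \<in> borel_measurable lebesgue"
    and pos: "\<And>x t. 0 < t \<Longrightarrow> 0 < \<phi> x t"
  obtains A where "0 < A" "\<And>t B. 0 < t \<Longrightarrow> B \<in> balls \<Longrightarrow> mass \<phi> B t < \<infinity>"
    "\<And>t B. 0 < t \<Longrightarrow> B \<in> balls \<Longrightarrow> (\<integral>\<^sup>+y\<in>B. ennreal (\<phi> y t powr (- 1 / (q - 1))) \<partial>lebesgue) \<le>
        ennreal ((A / (enn2real (mass \<phi> B t) / measure lebesgue B)) powr (1 / (q - 1)) * measure lebesgue B)"
proof -
  define q' where "q' = q / (q - 1)"
  have q': "q / q' = q - 1" "- q' / q = - 1 / (q - 1)" using q by (simp_all add: q'_def field_simps)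
  define S where "S = (SUP t\<in>{0<..}. SUP B\<in>balls. ennreal (1 / measure lebesgue B powr q) * mass \<phi> B t *
           ennreal_powr (\<integral>\<^sup>+y\<in>B. ennreal (\<phi> y t powr (- 1 / (q - 1))) \<partial>lebesgue) (q - 1))"
  have S: "S < top" using Aq q by (simp add: muckenhoupt_def S_def Let_def q'[symmetric])
  define A where "A = enn2real S + 1"
  have A: "0 < A" by (simp add: A_def add_nonneg_pos)
  have SA: "S \<le> ennreal A" using S by (cases S) (auto simp: A_def)
  have *: "mass \<phi> B t < \<infinity> \<and> (\<integral>\<^sup>+y\<in>B. ennreal (\<phi> y t powr (- 1 / (q - 1))) \<partial>lebesgue) \<le>
        ennreal ((A / (enn2real (mass \<phi> B t) / measure lebesgue B)) powr (1 / (q - 1)) * measure lebesgue B)"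
    if t: "0 < t" and B: "B \<in> balls" for t B
  proof -
    have [measurable]: "(\<lambda>x. \<phi> x t) \<in> borel_measurable lebesgue" by (rule meas[OF t])
    define b where "b = measure lebesgue B"
    have b: "0 < b" using measure_balls_pos[OF B] by (simp add: b_def)
    define I where "I = (\<integral>\<^sup>+y\<in>B. ennreal (\<phi> y t powr (- 1 / (q - 1))) \<partial>lebesgue)"
    have Ipos: "0 < I"
      unfolding I_def by (rule set_nn_integral_pos) (use B pos[OF t] measure_balls_pos[OF B] in \<open>auto simp: less_imp_neq[symmetric]\<close>)
    have Wpos: "0 < mass \<phi> B t"
      unfolding mass_def by (rule set_nn_integral_pos) (use B pos[OF t] measure_balls_pos[OF B] in auto)
    have "ennreal (1 / b powr q) * mass \<phi> B t * ennreal_powr I (q - 1) \<le> S"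
      unfolding S_def I_def b_def using t B by (intro SUP_upper2[of t] SUP_upper2[of B]) auto
    then have le: "ennreal (1 / b powr q) * mass \<phi> B t * ennreal_powr I (q - 1) \<le> ennreal A"
      using SA by (rule order_trans)
    have Ppos: "0 < ennreal_powr I (q - 1)"
      using Ipos by (auto simp: ennreal_powr_def enn2real_eq_0_iff)
    have fin: "mass \<phi> B t < \<infinity>"
    proof (rule ccontr)
      assume "\<not> mass \<phi> B t < \<infinity>"
      then have "mass \<phi> B t = top" by (simp add: less_top[symmetric])
      then show False using le Ppos b
        by (simp add: ennreal_mult_top ennreal_top_mult ennreal_top_eq_mult_iff top_unique zero_less_iff_neq_zero split: if_splits)
    qed
    have finI: "I < \<infinity>"
    proof (rule ccontr)
      assume "\<not> I < \<infinity>"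
      then have "ennreal_powr I (q - 1) = top" by (simp add: less_top[symmetric] ennreal_powr_def)
      then show False using le Wpos b
        by (simp add: ennreal_mult_top ennreal_top_mult ennreal_top_eq_mult_iff top_unique zero_less_iff_neq_zero split: if_splits)
    qed
    define m where "m = enn2real (mass \<phi> B t)"
    have m: "mass \<phi> B t = ennreal m" "0 < m" using fin Wpos by (auto simp: m_def enn2real_positive_iff)
    define i where "i = enn2real I"
    have i: "I = ennreal i" "0 < i" using finI Ipos by (auto simp: i_def enn2real_positive_iff)
    have "ennreal (1 / b powr q * m * i powr (q - 1)) \<le> ennreal A"
      using le m i by (simp add: ennreal_powr_def ennreal_mult[symmetric])
    then have "1 / b powr q * m * i powr (q - 1) \<le> A" using A by simp
    then have "i powr (q - 1) \<le> A / (m / b) * b powr (q - 1)"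
      using m b i by (simp add: field_simps powr_diff)
    then have "(i powr (q - 1)) powr (1 / (q - 1)) \<le> (A / (m / b) * b powr (q - 1)) powr (1 / (q - 1))"
      using q by (intro powr_mono2) auto
    moreover have "(i powr (q - 1)) powr (1 / (q - 1)) = i" using q i by (simp add: powr_powr)
    moreover have "(A / (m / b) * b powr (q - 1)) powr (1 / (q - 1)) = (A / (m / b)) powr (1 / (q - 1)) * b"
      using q A m b by (subst powr_mult) (auto simp: powr_powr)
    ultimately have "i \<le> (A / (m / b)) powr (1 / (q - 1)) * b" by simp
    then show ?thesis
      unfolding I_def[symmetric] m_def[symmetric] b_def[symmetric] using fin i by (simp add: ennreal_leI)
  qed
  show ?thesis by (rule that[OF A]) (use * in blast)+
qed


text \<open>
  Integrating the pointwise bound over a subset \<open>E\<close> that fills a fixed part of the ball gives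
  doubling; the second claim transfers the \<open>A\<^sub>1\<close> condition from balls to such subsets.
\<close>

lemma A1_subset_estimates:
  fixes w :: "real^'n \<Rightarrow> real"
  assumes [measurable]: "w \<in> borel_measurable lebesgue" and w: "\<And>x. 0 < w x"
    and B: "B \<in> balls" and fin: "emeasure (density lebesgue w) B < \<infinity>"
    and E [measurable]: "E \<in> sets lebesgue" and EB: "E \<subseteq> B"
    and \<eta>: "0 < \<eta>" "\<eta> * measure lebesgue B \<le> measure lebesgue E" and A: "0 < A"
    and A1: "AE y in lebesgue. y \<in> B \<longrightarrow> measure (density lebesgue w) B / measure lebesgue B \<le> A * w y"
  shows "measure (density lebesgue w) B \<le> A / \<eta> * measure (density lebesgue w) E"
    and "AE y in lebesgue. y \<in> E \<longrightarrow> measure (density lebesgue w) E / measure lebesgue E \<le> A / \<eta> * w y"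
proof -
  let ?\<omega> = "density lebesgue w"
  define b where "b = measure lebesgue B"
  have b: "0 < b" using measure_balls_pos[OF B] by (simp add: b_def)
  define e where "e = measure lebesgue E"
  have e1: "\<eta> * b \<le> e" using \<eta> by (simp add: e_def b_def)
  have e: "\<eta> * b \<le> e" "0 < e" using e1 mult_pos_pos[OF \<eta>(1) b] by linarith+
  have finE: "emeasure ?\<omega> E < \<infinity>"
    using emeasure_mono[OF EB, of ?\<omega>] B fin by (auto intro: le_less_trans)
  have eE: "emeasure lebesgue E = ennreal e"
    unfolding e_def using emeasure_mono[OF EB, of lebesgue] emeasure_balls_finite[OF B] B
    by (intro emeasure_eq_ennreal_measure) auto
  define W where "W = measure ?\<omega> B"
  have W0: "0 \<le> W" by (simp add: W_def)
  have "ennreal (W / b) * ennreal e = (\<integral>\<^sup>+y. ennreal (W / b) * indicator E y \<partial>lebesgue)"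
    by (simp add: nn_integral_cmult_indicator eE)
  also have "\<dots> \<le> (\<integral>\<^sup>+y. ennreal A * (ennreal (w y) * indicator E y) \<partial>lebesgue)"
    using A1
  proof (intro nn_integral_mono_AE, eventually_elim)
    case (elim y)
    then show ?case using EB A w[of y]
      by (auto simp: indicator_def W_def b_def ennreal_mult[symmetric] less_imp_le intro!: ennreal_leI)
  qed
  also have "\<dots> = ennreal A * emeasure ?\<omega> E"
    by (subst nn_integral_cmult) (auto simp: emeasure_density)
  also have "\<dots> = ennreal (A * measure ?\<omega> E)"
    using finE A by (subst emeasure_eq_ennreal_measure) (auto simp: ennreal_mult)
  finally have "W / b * e \<le> A * measure ?\<omega> E"
    using A W0 b e by (simp add: ennreal_mult[symmetric])
  moreover have "W / b * (\<eta> * b) \<le> W / b * e" using e W0 b by (intro mult_left_mono) auto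
  ultimately have "\<eta> * W \<le> A * measure ?\<omega> E" using b by (simp add: mult.commute)
  then show "measure ?\<omega> B \<le> A / \<eta> * measure ?\<omega> E" using \<eta> by (simp add: W_def field_simps)
  have "measure ?\<omega> E \<le> W"
    unfolding W_def using EB B fin by (intro measure_mono_fmeasurable) (auto simp: fmeasurable_def)
  then have "measure ?\<omega> E / e \<le> W / (\<eta> * b)"
    using e \<eta> b W0 by (intro frac_le) auto
  then have le: "measure ?\<omega> E / e \<le> W / b / \<eta>" by (simp add: mult.commute)
  show "AE y in lebesgue. y \<in> E \<longrightarrow> measure ?\<omega> E / measure lebesgue E \<le> A / \<eta> * w y"
    using A1
  proof eventually_elim
    case (elim y)
    show ?case
    proof
      assume "y \<in> E"
      then have "W / b / \<eta> \<le> A * w y / \<eta>"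
        using elim EB \<eta> by (intro divide_right_mono) (auto simp: W_def b_def)
      then show "measure ?\<omega> E / measure lebesgue E \<le> A / \<eta> * w y"
        using le by (simp add: e_def)
    qed
  qed
qed

text \<open>
  Both claims come from Chebyshev's inequality for the negative power of \<open>w\<close>: a set on which \<open>w\<close>
  is small compared to its mean over the ball has small Lebesgue measure, hence \<open>w\<close> cannot be
  concentrated outside \<open>E\<close>; and it has small \<open>w\<close>-mass, with a decay given by the conjugate exponent
  \<open>q' = q / (q - 1)\<close>.
\<close>

lemma Aq_subset_estimates:
  fixes w :: "real^'n \<Rightarrow> real"
  assumes [measurable]: "w \<in> borel_measurable lebesgue" and w: "\<And>x. 0 < w x"
    and B: "B \<in> balls" and fin: "emeasure (density lebesgue w) B < \<infinity>"
    and E [measurable]: "E \<in> sets lebesgue" and EB: "E \<subseteq> B"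
    and \<eta>: "0 < \<eta>" "\<eta> * measure lebesgue B \<le> measure lebesgue E" and A: "0 < A" and q: "1 < q"
    and Aq: "(\<integral>\<^sup>+y\<in>B. ennreal (w y powr (- 1 / (q - 1))) \<partial>lebesgue) \<le>
        ennreal ((A / (measure (density lebesgue w) B / measure lebesgue B)) powr (1 / (q - 1)) * measure lebesgue B)"
  shows "measure (density lebesgue w) B \<le> A * (2 / \<eta>) powr q * measure (density lebesgue w) E"
    and "0 < \<rho> \<Longrightarrow>
      emeasure (density lebesgue w) {y \<in> E. \<rho> * w y < measure (density lebesgue w) E / measure lebesgue E}
      \<le> ennreal (A powr (1 / (q - 1)) * \<eta> powr (- q / (q - 1)) * \<rho> powr (- q / (q - 1)) * measure (density lebesgue w) E)"
proof -
  let ?\<omega> = "density lebesgue w"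
  define p where "p = 1 / (q - 1)"
  have p: "0 < p" "p * (q - 1) = 1" using q by (auto simp: p_def)
  define b where "b = measure lebesgue B"
  have b: "0 < b" using measure_balls_pos[OF B] by (simp add: b_def)
  define e where "e = measure lebesgue E"
  have e1: "\<eta> * b \<le> e" using \<eta> by (simp add: e_def b_def)
  have e: "\<eta> * b \<le> e" "0 < e" using e1 mult_pos_pos[OF \<eta>(1) b] by linarith+
  have eE: "emeasure lebesgue E = ennreal e"
    unfolding e_def using emeasure_mono[OF EB, of lebesgue] emeasure_balls_finite[OF B] B
    by (intro emeasure_eq_ennreal_measure) auto
  have finE: "emeasure ?\<omega> E < \<infinity>"
    using emeasure_mono[OF EB, of ?\<omega>] B fin by (auto intro: le_less_trans)
  define W where "W = measure ?\<omega> E"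
  have WE: "emeasure ?\<omega> E = ennreal W"
    using finE unfolding W_def by (intro emeasure_eq_ennreal_measure) auto
  have "0 < emeasure ?\<omega> E"
    using set_nn_integral_pos[of w E] w e by (simp add: emeasure_density e_def)
  then have W: "0 < W" unfolding WE by simp
  have WB: "W \<le> measure ?\<omega> B"
    unfolding W_def using EB B fin by (intro measure_mono_fmeasurable) (auto simp: fmeasurable_def)
  define m where "m = measure ?\<omega> B / b"
  have m: "0 < m" using W WB b by (simp add: m_def)
  have Aq': "(\<integral>\<^sup>+y\<in>B. ennreal (w y powr - p) \<partial>lebesgue) \<le> ennreal ((A / m) powr p * b)"
    using Aq by (simp add: p_def m_def b_def)
  have [measurable]: "B \<in> sets lebesgue" using B by simp
  have low: "{y \<in> E. w y < \<tau>} \<in> sets lebesgue" for \<tau>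
  proof -
    have "{y \<in> space lebesgue. w y < \<tau>} \<in> sets lebesgue" by measurable
    from sets.Int[OF E this] show ?thesis by (simp add: Int_def)
  qed
  \<comment> \<open>Chebyshev; \<open>d = p\<close> gives Lebesgue measure and \<open>d = 1 + p\<close> gives the mass of \<open>w\<close>\<close>
  have sub: "(\<integral>\<^sup>+y\<in>{y \<in> E. w y < \<tau>}. ennreal (w y powr (d - p)) \<partial>lebesgue) \<le> ennreal (\<tau> powr d * ((A / m) powr p * b))"
    if \<tau>: "0 < \<tau>" and d: "0 \<le> d" for \<tau> d
  proof -
    have "(\<integral>\<^sup>+y\<in>{y \<in> E. w y < \<tau>}. ennreal (w y powr (d - p)) \<partial>lebesgue) \<le>
        (\<integral>\<^sup>+y. ennreal (\<tau> powr d) * (ennreal (w y powr - p) * indicator B y) \<partial>lebesgue)"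
    proof (rule nn_integral_mono)
      fix y
      have "w y powr (d - p) \<le> \<tau> powr d * w y powr - p" if "w y < \<tau>"
      proof -
        have "w y powr (d - p) = w y powr d * w y powr - p"
          using w[of y] by (simp add: powr_add[symmetric])
        also have "\<dots> \<le> \<tau> powr d * w y powr - p"
          using that w[of y] d by (intro mult_right_mono powr_mono2) auto
        finally show ?thesis .
      qed
      then show "ennreal (w y powr (d - p)) * indicator {y \<in> E. w y < \<tau>} y \<le>
          ennreal (\<tau> powr d) * (ennreal (w y powr - p) * indicator B y)"
        using EB by (auto simp: indicator_def ennreal_mult[symmetric] intro!: ennreal_leI)
    qed
    also have "\<dots> = ennreal (\<tau> powr d) * (\<integral>\<^sup>+y\<in>B. ennreal (w y powr - p) \<partial>lebesgue)"
      by (rule nn_integral_cmult) simp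
    also have "\<dots> \<le> ennreal (\<tau> powr d) * ennreal ((A / m) powr p * b)"
      by (intro mult_left_mono Aq') simp
    also have "\<dots> = ennreal (\<tau> powr d * ((A / m) powr p * b))"
      using b by (simp add: ennreal_mult[symmetric])
    finally show ?thesis .
  qed
  show "measure ?\<omega> B \<le> A * (2 / \<eta>) powr q * measure ?\<omega> E"
  proof -
    \<comment> \<open>the level for which Chebyshev bounds the measure of the sublevel set by half of \<open>\<eta> b\<close>\<close>
    define \<tau> where "\<tau> = m / A * (\<eta> / 2) powr (q - 1)"
    have \<tau>: "0 < \<tau>" using m A \<eta> by (simp add: \<tau>_def)
    let ?L = "{y \<in> E. w y < \<tau>}"
    have "emeasure lebesgue ?L = (\<integral>\<^sup>+y\<in>?L. ennreal (w y powr (p - p)) \<partial>lebesgue)"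
      using low w by (auto simp: less_imp_neq[symmetric] intro!: nn_integral_cong)
    also have "\<dots> \<le> ennreal (\<tau> powr p * ((A / m) powr p * b))" using \<tau> p by (intro sub) auto
    also have "\<tau> powr p * ((A / m) powr p * b) = \<eta> / 2 * b"
      using m A \<eta> p by (simp add: \<tau>_def powr_mult powr_divide powr_powr mult.commute[of "q - 1"])
    also have "ennreal (\<eta> / 2 * b) \<le> ennreal (e / 2)" using e by (intro ennreal_leI) simp
    finally have L: "emeasure lebesgue ?L \<le> ennreal (e / 2)" .
    have "emeasure lebesgue (E - ?L) = emeasure lebesgue E - emeasure lebesgue ?L"
      using low L by (intro emeasure_Diff) (auto simp: top_unique)
    also have "\<dots> \<ge> ennreal e - ennreal (e / 2)"
      unfolding eE using L by (intro ennreal_minus_mono) auto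
    finally have "ennreal (e / 2) \<le> emeasure lebesgue (E - ?L)" using e by (simp add: ennreal_minus)
    then have "ennreal \<tau> * ennreal (e / 2) \<le> ennreal \<tau> * emeasure lebesgue (E - ?L)"
      by (intro mult_left_mono) auto
    also have "\<dots> = (\<integral>\<^sup>+y. ennreal \<tau> * indicator (E - ?L) y \<partial>lebesgue)"
      using low by (subst nn_integral_cmult_indicator) auto
    also have "\<dots> \<le> (\<integral>\<^sup>+y. ennreal (w y) * indicator E y \<partial>lebesgue)"
      by (intro nn_integral_mono) (auto simp: indicator_def intro!: ennreal_leI)
    also have "\<dots> = ennreal W" by (simp add: WE[symmetric] emeasure_density)
    finally have "\<tau> * (e / 2) \<le> W" using \<tau> e W by (simp add: ennreal_mult[symmetric])
    moreover have "\<tau> * (\<eta> * b / 2) \<le> \<tau> * (e / 2)" using \<tau> e by (intro mult_left_mono) auto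
    ultimately have "\<tau> * (\<eta> * b / 2) \<le> W" by simp
    moreover have "\<tau> * (\<eta> * b / 2) = measure ?\<omega> B / A * (\<eta> / 2) powr q"
      using b \<eta> by (simp add: \<tau>_def m_def powr_diff)
    ultimately have "measure ?\<omega> B / A * (\<eta> / 2) powr q \<le> W" by metis
    moreover obtain X where "(\<eta> / 2) powr q = X" "(2 / \<eta>) powr q = 1 / X" "0 < X"
      using \<eta> by (simp add: powr_divide)
    ultimately show ?thesis
      using A unfolding W_def[symmetric] by (simp only:) (simp add: field_simps)
  qed
  show "emeasure ?\<omega> {y \<in> E. \<rho> * w y < measure ?\<omega> E / measure lebesgue E}
      \<le> ennreal (A powr (1 / (q - 1)) * \<eta> powr (- q / (q - 1)) * \<rho> powr (- q / (q - 1)) * measure ?\<omega> E)"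
    if \<rho>: "0 < \<rho>"
  proof -
    define \<tau> where "\<tau> = W / e / \<rho>"
    have \<tau>: "0 < \<tau>" using W e \<rho> by (simp add: \<tau>_def)
    have p1: "- q / (q - 1) = - (1 + p)" using q by (simp add: p_def field_simps)
    have set_eq: "{y \<in> E. \<rho> * w y < W / e} = {y \<in> E. w y < \<tau>}"
      unfolding \<tau>_def pos_less_divide_eq[OF \<rho>] by (simp add: mult.commute)
    have "emeasure ?\<omega> {y \<in> E. w y < \<tau>} = (\<integral>\<^sup>+y\<in>{y \<in> E. w y < \<tau>}. ennreal (w y powr ((1 + p) - p)) \<partial>lebesgue)"
      using low w by (subst emeasure_density) (auto simp: less_imp_le intro!: nn_integral_cong)
    also have "\<dots> \<le> ennreal (\<tau> powr (1 + p) * ((A / m) powr p * b))" using \<tau> p by (intro sub) auto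
    also have "\<tau> powr (1 + p) * ((A / m) powr p * b) \<le> A powr p * \<eta> powr - (1 + p) * \<rho> powr - (1 + p) * W"
    proof -
      have "(A / m) powr p * b = A powr p * b powr (1 + p) * measure ?\<omega> B powr - p"
      proof -
        have "A / m = A * b / measure ?\<omega> B" by (simp add: m_def)
        then have "(A / m) powr p = A powr p * b powr p * measure ?\<omega> B powr - p"
          using A b W WB by (simp add: powr_divide powr_mult powr_minus_divide)
        then show ?thesis using b by (simp add: powr_add)
      qed
      also have "\<dots> \<le> A powr p * (e / \<eta>) powr (1 + p) * W powr - p"
      proof (intro mult_mono mult_left_mono)
        show "b powr (1 + p) \<le> (e / \<eta>) powr (1 + p)"
          using e \<eta> b p by (intro powr_mono2) (auto simp: field_simps)
        show "measure ?\<omega> B powr - p \<le> W powr - p" using WB W p by (intro powr_mono2') auto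
      qed auto
      finally have "\<tau> powr (1 + p) * ((A / m) powr p * b) \<le>
          \<tau> powr (1 + p) * (A powr p * (e / \<eta>) powr (1 + p) * W powr - p)"
        by (intro mult_left_mono) auto
      also have "\<dots> = A powr p * \<eta> powr - (1 + p) * \<rho> powr - (1 + p) * (W powr (1 + p) * W powr - p)"
        using W e \<rho> \<eta> unfolding \<tau>_def powr_divide powr_minus by (simp add: powr_divide powr_minus field_simps)
      also have "W powr (1 + p) * W powr - p = W" using W by (simp add: powr_add[symmetric])
      finally show ?thesis .
    qed
    finally have "emeasure ?\<omega> {y \<in> E. w y < \<tau>} \<le> ennreal (A powr p * \<eta> powr - (1 + p) * \<rho> powr - (1 + p) * W)"
      by (simp add: ennreal_leI)
    then show ?thesis unfolding p1 p_def[symmetric] W_def[symmetric] e_def[symmetric] set_eq .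
  qed
qed


section \<open>Quasi-norms of characteristic functions of balls\<close>

lemma growth_functionD:
  assumes "growth_function \<phi>"
  shows "0 < t \<Longrightarrow> 0 < \<phi> x t" "0 \<le> t \<Longrightarrow> (\<lambda>x. \<phi> x t) \<in> borel_measurable lebesgue"
    "\<phi> \<in> muckenhoupt_infinity"
  using assms by (auto simp: growth_function_def orlicz_function_def)

lemma growth_function_mass:
  fixes \<phi> :: "real^'n \<Rightarrow> real \<Rightarrow> real"
  assumes \<phi>: "growth_function \<phi>" and t: "0 < t" and B: "B \<in> balls"
  shows "mass \<phi> B t < \<infinity>" "0 < mass \<phi> B t"
proof -
  obtain q where q: "1 \<le> q" "\<phi> \<in> muckenhoupt q"
    using growth_functionD(3)[OF \<phi>] by (auto simp: muckenhoupt_infinity_def)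
  note gf = growth_functionD[OF \<phi>]
  show "mass \<phi> B t < \<infinity>"
  proof (cases "q = 1")
    case True
    with q have "\<phi> \<in> muckenhoupt 1" by simp
    then show ?thesis using gf t B by (elim muckenhoupt_oneD[of \<phi>]) auto
  next
    case False
    with q have "1 < q" by simp
    then show ?thesis using gf q t B by (elim muckenhouptD[of \<phi> q]) auto
  qed
  show "0 < mass \<phi> B t"
    unfolding mass_def
    by (rule set_nn_integral_pos) (use gf t B measure_balls_pos[OF B] in auto)
qed

lemma mass_scale_le:
  assumes meas: "(\<lambda>x. \<phi> x t) \<in> borel_measurable lebesgue" and E: "E \<in> sets lebesgue"
    and c: "0 \<le> c" and nonneg: "\<And>x. 0 \<le> \<phi> x t" and le: "\<And>x. \<phi> x t' \<le> c * \<phi> x t"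
  shows "mass \<phi> E t' \<le> ennreal c * mass \<phi> E t"
proof -
  have "mass \<phi> E t' \<le> (\<integral>\<^sup>+x. ennreal c * (ennreal (\<phi> x t) * indicator E x) \<partial>lebesgue)"
    unfolding mass_def using le c nonneg
    by (intro nn_integral_mono) (auto simp: indicator_def ennreal_mult[symmetric] intro!: ennreal_leI)
  also have "\<dots> = ennreal c * mass \<phi> E t"
    unfolding mass_def using meas E by (intro nn_integral_cmult) auto
  finally show ?thesis .
qed

lemma growth_function_types:
  fixes \<phi> :: "real^'n \<Rightarrow> real \<Rightarrow> real"
  assumes \<phi>: "growth_function \<phi>"
  obtains C p where "0 < C" "0 < p" "p \<le> 1"
    "\<And>t \<sigma> E. 0 < t \<Longrightarrow> 1 \<le> \<sigma> \<Longrightarrow> E \<in> sets lebesgue \<Longrightarrow> mass \<phi> E (\<sigma> * t) \<le> ennreal (C * \<sigma>) * mass \<phi> E t"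
    "\<And>t \<sigma> E. 0 < t \<Longrightarrow> 0 < \<sigma> \<Longrightarrow> \<sigma> \<le> 1 \<Longrightarrow> E \<in> sets lebesgue \<Longrightarrow>
       mass \<phi> E (\<sigma> * t) \<le> ennreal (C * \<sigma> powr p) * mass \<phi> E t"
proof -
  obtain p where p: "0 < p" "p \<le> 1" "uniformly_lower_type p \<phi>" and up: "uniformly_upper_type 1 \<phi>"
    using \<phi> by (auto simp: growth_function_def)
  obtain C1 where C1: "0 < C1" "\<And>x t \<sigma>. 0 \<le> t \<Longrightarrow> 1 \<le> \<sigma> \<Longrightarrow> \<phi> x (\<sigma> * t) \<le> C1 * \<sigma> powr 1 * \<phi> x t"
    using up unfolding uniformly_upper_type_def by blast
  obtain C2 where C2: "0 < C2" "\<And>x t \<sigma>. 0 \<le> t \<Longrightarrow> \<sigma> \<in> {0..1} \<Longrightarrow> \<phi> x (\<sigma> * t) \<le> C2 * \<sigma> powr p * \<phi> x t"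
    using p(3) unfolding uniformly_lower_type_def by blast
  define C where "C = max C1 C2"
  have C: "0 < C" "C1 \<le> C" "C2 \<le> C" using C1 by (auto simp: C_def)
  note gf = growth_functionD[OF \<phi>]
  show ?thesis
  proof (rule that[OF C(1) p(1,2)])
    fix t \<sigma> :: real and E :: "(real^'n) set" assume *: "0 < t" "1 \<le> \<sigma>" "E \<in> sets lebesgue"
    have "\<phi> x (\<sigma> * t) \<le> C * \<sigma> * \<phi> x t" for x
    proof -
      have "\<phi> x (\<sigma> * t) \<le> C1 * \<sigma> * \<phi> x t" using C1(2)[of t \<sigma> x] * by simp
      also have "\<dots> \<le> C * \<sigma> * \<phi> x t" using C * gf(1)[of t x] by (intro mult_right_mono) auto
      finally show ?thesis .
    qed
    then show "mass \<phi> E (\<sigma> * t) \<le> ennreal (C * \<sigma>) * mass \<phi> E t"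
      using * C gf by (intro mass_scale_le) (auto simp: less_imp_le)
  next
    fix t \<sigma> :: real and E :: "(real^'n) set" assume *: "0 < t" "0 < \<sigma>" "\<sigma> \<le> 1" "E \<in> sets lebesgue"
    have "\<phi> x (\<sigma> * t) \<le> C * \<sigma> powr p * \<phi> x t" for x
    proof -
      have "\<phi> x (\<sigma> * t) \<le> C2 * \<sigma> powr p * \<phi> x t" using C2(2)[of t \<sigma> x] * by simp
      also have "\<dots> \<le> C * \<sigma> powr p * \<phi> x t" using C * gf(1)[of t x] by (intro mult_right_mono) auto
      finally show ?thesis .
    qed
    then show "mass \<phi> E (\<sigma> * t) \<le> ennreal (C * \<sigma> powr p) * mass \<phi> E t"
      using * C gf by (intro mass_scale_le) (auto simp: less_imp_le)
  qed
qed

lemma norm_chi_le: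
  assumes "0 < l" "mass \<phi> B (1 / l) \<le> 1"
  shows "norm_chi \<phi> B \<le> l"
  unfolding norm_chi_def
  by (rule cInf_lower) (use assms in \<open>auto intro!: bdd_belowI[of _ 0]\<close>)

text \<open>
  All claims follow from comparing \<open>mass \<phi> B\<close> at two parameters. The last one is the bridge from
  the Campanato norm to a single weight: for \<open>l = K mass \<phi> B t / t\<close> the mass at \<open>1 / l\<close> is at most
  \<open>1\<close>. If \<open>1 / l \<le> t\<close> this uses the lower type and the bound \<open>M\<close> on the mass, otherwise the upper
  type \<open>1\<close>, which is exactly linear.
\<close>

lemma norm_chi_estimates:
  fixes \<phi> :: "real^'n \<Rightarrow> real \<Rightarrow> real"
  assumes \<phi>: "growth_function \<phi>"
  shows norm_chi_pos: "B \<in> balls \<Longrightarrow> 0 < norm_chi \<phi> B"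
    and mass_norm_chi: "\<exists>C>0. \<forall>B\<in>balls. mass \<phi> B (1 / norm_chi \<phi> B) \<le> ennreal C"
    and norm_chi_le_mass: "\<exists>K>0. \<forall>t>0. \<forall>B\<in>balls. mass \<phi> B t \<le> ennreal M \<longrightarrow>
      norm_chi \<phi> B \<le> K * enn2real (mass \<phi> B t) / t"
proof -
  obtain C p where C: "0 < C" and p: "0 < p" "p \<le> 1" and
    up: "\<And>t \<sigma> E. 0 < t \<Longrightarrow> 1 \<le> \<sigma> \<Longrightarrow> E \<in> sets lebesgue \<Longrightarrow> mass \<phi> E (\<sigma> * t) \<le> ennreal (C * \<sigma>) * mass \<phi> E t" and
    low: "\<And>t \<sigma> E. 0 < t \<Longrightarrow> 0 < \<sigma> \<Longrightarrow> \<sigma> \<le> 1 \<Longrightarrow> E \<in> sets lebesgue \<Longrightarrow>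
       mass \<phi> E (\<sigma> * t) \<le> ennreal (C * \<sigma> powr p) * mass \<phi> E t"
    using growth_function_types[OF \<phi>] by metis
  define m where "m B t = enn2real (mass \<phi> B t)" for B t
  have m: "mass \<phi> B t = ennreal (m B t)" "0 < m B t" if "0 < t" "B \<in> balls" for B t
    using growth_function_mass[OF \<phi> that] by (auto simp: m_def enn2real_positive_iff)
  let ?S = "\<lambda>B. {l. 0 < l \<and> mass \<phi> B (1 / l) \<le> 1}"
  have mem: "K * m B t / t \<in> ?S B"
    if t: "0 < t" and B: "B \<in> balls" and M: "m B t \<le> M" "1 \<le> M"
      and K: "0 < K" "C \<le> K" "(C * M) powr (1 / p) \<le> K" for K B t M
  proof -
    have Km: "0 < K * m B t" using K m(2)[OF t B] by simp
    have eq: "1 / (K * m B t / t) = 1 / (K * m B t) * t" by simp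
    have "mass \<phi> B (1 / (K * m B t / t)) \<le> 1"
    proof (cases "1 \<le> K * m B t")
      case True
      have "mass \<phi> B (1 / (K * m B t) * t) \<le> ennreal (C * (1 / (K * m B t)) powr p) * ennreal (m B t)"
        using low[of t "1 / (K * m B t)" B] t True Km B m(1)[OF t B] by simp
      also have "\<dots> = ennreal (C * (1 / (K * m B t)) powr p * m B t)"
        using C m(2)[OF t B] by (simp add: ennreal_mult)
      also have "C * (1 / (K * m B t)) powr p * m B t \<le> 1"
      proof -
        have "C * M = ((C * M) powr (1 / p)) powr p" using C M p by (simp add: powr_powr)
        also have "\<dots> \<le> K powr p" using K p by (intro powr_mono2) auto
        finally have CM: "C * M \<le> K powr p" .
        have "m B t powr (1 - p) \<le> M powr (1 - p)" using M m(2)[OF t B] p by (intro powr_mono2) auto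
        also have "\<dots> \<le> M powr 1" using M p by (intro powr_mono) auto
        finally have "C * m B t powr (1 - p) \<le> C * M" using C M by simp
        then have "C * m B t powr (1 - p) \<le> K powr p" using CM by simp
        then show ?thesis
          using K m(2)[OF t B] by (simp add: powr_divide powr_mult powr_diff field_simps)
      qed
      finally show ?thesis unfolding eq by (simp add: ennreal_leI)
    next
      case False
      have "mass \<phi> B (1 / (K * m B t) * t) \<le> ennreal (C * (1 / (K * m B t))) * ennreal (m B t)"
        using up[of t "1 / (K * m B t)" B] t False Km B m(1)[OF t B] by simp
      also have "\<dots> = ennreal (C / K)"
        using C K m(2)[OF t B] by (simp add: ennreal_mult[symmetric])
      also have "\<dots> \<le> 1" using C K by simp
      finally show ?thesis unfolding eq .
    qed
    then show ?thesis using Km t by simp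
  qed
  have ne: "?S B \<noteq> {}" if B: "B \<in> balls" for B
    using mem[of 1 B "max 1 (m B 1)" "max C ((C * max 1 (m B 1)) powr (1 / p))"] B C by auto
  show pos: "0 < norm_chi \<phi> B" if B: "B \<in> balls" for B
  proof -
    define d where "d = min 1 ((m B 1 / C) powr (1 / p))"
    have d: "0 < d" using C m(2)[of 1 B] B by (simp add: d_def)
    have "d \<le> l" if l: "0 < l" "mass \<phi> B (1 / l) \<le> 1" for l
    proof (cases "l \<le> 1")
      case True
      have "ennreal (m B 1) = mass \<phi> B (l * (1 / l))" using l B m(1)[of 1 B] by simp
      also have "\<dots> \<le> ennreal (C * l powr p) * mass \<phi> B (1 / l)"
        using l True B by (intro low) auto
      also have "\<dots> \<le> ennreal (C * l powr p) * 1" using l by (intro mult_left_mono) auto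
      finally have "m B 1 / C \<le> l powr p" using C by (simp add: field_simps)
      then have "(m B 1 / C) powr (1 / p) \<le> (l powr p) powr (1 / p)"
        using C m(2)[of 1 B] B p by (intro powr_mono2) auto
      then show ?thesis using l p by (simp add: powr_powr d_def)
    qed (auto simp: d_def)
    then have "d \<le> norm_chi \<phi> B"
      unfolding norm_chi_def by (intro cInf_greatest ne[OF B]) auto
    with d show ?thesis by simp
  qed
  show "\<exists>C>0. \<forall>B\<in>balls. mass \<phi> B (1 / norm_chi \<phi> B) \<le> ennreal C"
  proof (intro exI[of _ "2 * C"] conjI ballI)
    fix B :: "(real^'n) set" assume B: "B \<in> balls"
    let ?l = "norm_chi \<phi> B"
    have l: "0 < ?l" by (rule pos[OF B])
    \<comment> \<open>the infimum need not be attained, so it is compared with an admissible value within a factor \<open>2\<close>\<close>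
    have "Inf (?S B) < 2 * ?l" using l by (simp add: norm_chi_def)
    then obtain x where x: "x \<in> ?S B" "x < 2 * ?l"
      using cInf_lessD[OF ne[OF B]] by blast
    have lx: "?l \<le> x" using x(1) by (intro norm_chi_le) auto
    have "mass \<phi> B (1 / ?l) = mass \<phi> B (x / ?l * (1 / x))" using x by simp
    also have "\<dots> \<le> ennreal (C * (x / ?l)) * mass \<phi> B (1 / x)"
      using x lx l B by (intro up) auto
    also have "\<dots> \<le> ennreal (C * (x / ?l)) * 1" using x by (intro mult_left_mono) auto
    also have "\<dots> \<le> ennreal (2 * C)" using x l C by (auto simp: field_simps intro!: ennreal_leI)
    finally show "mass \<phi> B (1 / ?l) \<le> ennreal (2 * C)" .
  qed (use C in simp)
  define K where "K = max C ((C * max 1 M) powr (1 / p))"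
  have "norm_chi \<phi> B \<le> K * m B t / t" if t: "0 < t" and B: "B \<in> balls" and M: "mass \<phi> B t \<le> ennreal M" for t B
  proof (rule norm_chi_le)
    have "m B t \<le> max 1 M" using M m[OF t B] by (cases "0 \<le> M") (auto simp: ennreal_neg)
    then have "K * m B t / t \<in> ?S B" using t B C by (intro mem[of t B "max 1 M"]) (auto simp: K_def)
    then show "0 < K * m B t / t" "mass \<phi> B (1 / (K * m B t / t)) \<le> 1" by auto
  qed
  then show "\<exists>K>0. \<forall>t>0. \<forall>B\<in>balls. mass \<phi> B t \<le> ennreal M \<longrightarrow>
      norm_chi \<phi> B \<le> K * enn2real (mass \<phi> B t) / t"
    using C by (intro exI[of _ K]) (auto simp: K_def m_def)
qed

section \<open>Dyadic cubes\<close>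

text \<open>
  The half-open dyadic cubes of generation \<open>k\<close> in the grid with corner \<open>v\<close> and side \<open>L\<close> are
  labelled by integer vectors. Each cube is compared with its inscribed ball and with a concentric
  ball whose radius is \<open>CARD('n) + 1\<close> times as large; this factor stands for any number above \<open>\<surd>n\<close>
  and comes from bounding the Euclidean norm by the \<open>l\<^sup>1\<close> norm.
\<close>

definition dyadic_index :: "real^'n \<Rightarrow> real \<Rightarrow> nat \<Rightarrow> real^'n \<Rightarrow> int^'n" where
  "dyadic_index v L k x = (\<chi> i. \<lfloor>2 ^ k * (x $ i - v $ i) / L\<rfloor>)"

definition dyadic_center :: "real^'n \<Rightarrow> real \<Rightarrow> nat \<Rightarrow> int^'n \<Rightarrow> real^'n" where
  "dyadic_center v L k j = (\<chi> i. v $ i + L / 2 ^ k * (real_of_int (j $ i) + 1 / 2))"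

definition dyadic_cube :: "real^'n \<Rightarrow> real \<Rightarrow> nat \<Rightarrow> int^'n \<Rightarrow> (real^'n) set" where
  "dyadic_cube v L k j = {x. dyadic_index v L k x = j}"

lemma mem_dyadic_cube_iff:
  assumes "0 < L"
  shows "x \<in> dyadic_cube v L k j \<longleftrightarrow> (\<forall>i. dyadic_center v L k j $ i - L / 2 ^ Suc k \<le> x $ i \<and>
    x $ i < dyadic_center v L k j $ i + L / 2 ^ Suc k)"
proof -
  have "\<lfloor>2 ^ k * (x $ i - v $ i) / L\<rfloor> = j $ i \<longleftrightarrow> dyadic_center v L k j $ i - L / 2 ^ Suc k \<le> x $ i \<and>
    x $ i < dyadic_center v L k j $ i + L / 2 ^ Suc k" for i
  proof -
    define h where "h = L / 2 ^ Suc k"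
    have h: "0 < 2 * h" using assms by (simp add: h_def)
    have "2 ^ k * (x $ i - v $ i) / L = (x $ i - v $ i) / (2 * h)" "L / 2 ^ k = 2 * h"
      using assms by (simp_all add: h_def field_simps)
    then show ?thesis
      unfolding floor_eq_iff dyadic_center_def h_def[symmetric] vec_lambda_beta
      by (simp only: pos_le_divide_eq[OF h] pos_divide_less_eq[OF h]) (auto simp: algebra_simps)
  qed
  then show ?thesis by (simp add: dyadic_cube_def dyadic_index_def vec_eq_iff)
qed

lemma sets_dyadic_cube:
  assumes "0 < L"
  shows "dyadic_cube v L k j \<in> sets borel"
proof -
  have "dyadic_cube v L k j = (\<Inter>i. {x. dyadic_center v L k j $ i - L / 2 ^ Suc k \<le> x $ i} \<inter>
      {x. x $ i < dyadic_center v L k j $ i + L / 2 ^ Suc k})"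
    by (rule set_eqI) (simp add: mem_dyadic_cube_iff[OF assms] del: power_Suc)
  also have "\<dots> \<in> sets borel"
    by (intro sets.countable_INT'' sets.Int borel_closed borel_open closed_Collect_le open_Collect_less continuous_intros) auto
  finally show ?thesis .
qed

lemma ball_subset_dyadic_cube:
  assumes "0 < L"
  shows "ball (dyadic_center v L k j) (L / 2 ^ Suc k) \<subseteq> dyadic_cube v L k j"
proof
  fix x assume "x \<in> ball (dyadic_center v L k j) (L / 2 ^ Suc k)"
  then have n: "norm (x - dyadic_center v L k j) < L / 2 ^ Suc k" by (simp add: dist_norm norm_minus_commute)
  have "\<bar>x $ i - dyadic_center v L k j $ i\<bar> < L / 2 ^ Suc k" for i
    using component_le_norm_cart[of "x - dyadic_center v L k j" i] n by (simp del: power_Suc)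
  then have "dyadic_center v L k j $ i - L / 2 ^ Suc k \<le> x $ i \<and>
      x $ i < dyadic_center v L k j $ i + L / 2 ^ Suc k" for i
    unfolding abs_less_iff by (smt (verit, best))
  then show "x \<in> dyadic_cube v L k j"
    unfolding mem_dyadic_cube_iff[OF assms] by blast
qed

lemma norm_less_of_coordinates:
  fixes x :: "real^'n"
  assumes "\<And>i. \<bar>x $ i\<bar> \<le> \<rho>" "0 < \<rho>"
  shows "norm x < (real CARD('n) + 1) * \<rho>"
proof -
  have "norm x \<le> (\<Sum>i\<in>UNIV. \<bar>x $ i\<bar>)" by (rule norm_le_l1_cart)
  also have "\<dots> \<le> (\<Sum>i\<in>(UNIV :: 'n set). \<rho>)" using assms by (intro sum_mono) auto
  also have "\<dots> < (real CARD('n) + 1) * \<rho>" using assms by (simp add: distrib_right)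
  finally show ?thesis .
qed

lemma dyadic_cube_subset_ball:
  fixes v :: "real^'n"
  assumes "0 < L"
  shows "dyadic_cube v L k j \<subseteq> ball (dyadic_center v L k j) ((real CARD('n) + 1) * (L / 2 ^ Suc k))"
proof
  fix x assume "x \<in> dyadic_cube v L k j"
  then have "\<bar>(x - dyadic_center v L k j) $ i\<bar> \<le> L / 2 ^ Suc k" for i
    unfolding mem_dyadic_cube_iff[OF assms] by (auto simp: abs_le_iff algebra_simps less_imp_le simp del: power_Suc)
  then have "norm (x - dyadic_center v L k j) < (real CARD('n) + 1) * (L / 2 ^ Suc k)"
    using assms by (intro norm_less_of_coordinates) auto
  then show "x \<in> ball (dyadic_center v L k j) ((real CARD('n) + 1) * (L / 2 ^ Suc k))"
    by (simp add: dist_norm norm_minus_commute)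
qed

lemma measure_dyadic_cube:
  fixes v :: "real^'n"
  assumes "0 < L"
  shows "emeasure lebesgue (dyadic_cube v L k j) = ennreal ((2 * (L / 2 ^ Suc k)) ^ CARD('n))"
    and "measure lebesgue (dyadic_cube v L k j) = (2 * (L / 2 ^ Suc k)) ^ CARD('n)"
proof -
  define \<rho> where "\<rho> = L / 2 ^ Suc k"
  have \<rho>: "0 < \<rho>" using assms by (simp add: \<rho>_def)
  define a where "a = dyadic_center v L k j - (\<chi> i. \<rho>)"
  define b where "b = dyadic_center v L k j + (\<chi> i. \<rho>)"
  have ab: "a $ i \<le> b $ i" "b $ i - a $ i = 2 * \<rho>" for i using \<rho> by (simp_all add: a_def b_def)
  have le: "a \<bullet> e \<le> b \<bullet> e" "(b - a) \<bullet> e = 2 * \<rho>" if "e \<in> Basis" for e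
    using that ab by (auto simp: Basis_vec_def inner_axis simp flip: vector_minus_component)
  have sub: "box a b \<subseteq> dyadic_cube v L k j" "dyadic_cube v L k j \<subseteq> cbox a b"
    unfolding subset_iff mem_dyadic_cube_iff[OF assms] mem_box_cart \<rho>_def[symmetric]
    by (auto simp: a_def b_def less_imp_le)
  have prod: "(\<Prod>e\<in>(Basis :: (real^'n) set). (b - a) \<bullet> e) = (2 * \<rho>) ^ CARD('n)"
    by (subst prod.cong[OF refl le(2)]) auto
  have "ennreal ((2 * \<rho>) ^ CARD('n)) = emeasure lebesgue (box a b)"
    using le(1) prod by (simp add: emeasure_lborel_box_eq)
  also have "\<dots> \<le> emeasure lebesgue (dyadic_cube v L k j)"
    by (rule emeasure_mono[OF sub(1)]) (simp add: sets_dyadic_cube[OF assms])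
  finally have 1: "ennreal ((2 * \<rho>) ^ CARD('n)) \<le> emeasure lebesgue (dyadic_cube v L k j)" .
  have "emeasure lebesgue (dyadic_cube v L k j) \<le> emeasure lebesgue (cbox a b)"
    by (rule emeasure_mono[OF sub(2)]) simp
  also have "\<dots> = ennreal ((2 * \<rho>) ^ CARD('n))"
    using le(1) prod by (simp add: emeasure_lborel_cbox_eq)
  finally show e: "emeasure lebesgue (dyadic_cube v L k j) = ennreal ((2 * (L / 2 ^ Suc k)) ^ CARD('n))"
    using 1 by (simp add: \<rho>_def)
  show "measure lebesgue (dyadic_cube v L k j) = (2 * (L / 2 ^ Suc k)) ^ CARD('n)"
    unfolding measure_def e using assms by simp
qed

lemma measure_ball_le:
  fixes c :: "real^'n"
  assumes "0 < r"
  shows "measure lebesgue (ball c r) \<le> (2 * r) ^ CARD('n)"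
proof -
  let ?v = "c - (\<chi> i. r)"
  have c: "dyadic_center ?v (2 * r) 0 0 = c" by (simp add: dyadic_center_def vec_eq_iff)
  have "measure lebesgue (ball c r) \<le> measure lebesgue (dyadic_cube ?v (2 * r) 0 0)"
  proof (rule measure_mono_fmeasurable)
    show "dyadic_cube ?v (2 * r) 0 0 \<in> lmeasurable"
    proof (rule fmeasurableI)
      have "0 < 2 * r" using assms by simp
      then show "emeasure lebesgue (dyadic_cube ?v (2 * r) 0 0) < \<infinity>"
        by (subst measure_dyadic_cube(1)) simp_all
    qed (use sets_dyadic_cube[of "2 * r" ?v 0 0] assms in simp)
  qed (use ball_subset_dyadic_cube[of "2 * r" ?v 0 0] assms in \<open>simp_all add: c\<close>)
  also have "\<dots> = (2 * r) ^ CARD('n)" using assms by (subst measure_dyadic_cube) auto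
  finally show ?thesis .
qed

lemma nested_partitions_dyadic_index:
  fixes v :: "real^'n"
  assumes L: "0 < L"
  shows "nested_partitions (dyadic_index v L)"
proof
  fix k and x y :: "real^'n"
  assume eq: "dyadic_index v L (Suc k) x = dyadic_index v L (Suc k) y"
  have half: "\<lfloor>2 ^ k * z / L\<rfloor> = \<lfloor>2 ^ Suc k * z / L\<rfloor> div 2" for z :: real
    using floor_divide_real_eq_div[of 2 "2 ^ Suc k * z / L"] by simp
  have "\<lfloor>2 ^ Suc k * (x $ i - v $ i) / L\<rfloor> = \<lfloor>2 ^ Suc k * (y $ i - v $ i) / L\<rfloor>" for i
    using eq unfolding dyadic_index_def vec_eq_iff vec_lambda_beta by blast
  then show "dyadic_index v L k x = dyadic_index v L k y"
    unfolding dyadic_index_def vec_eq_iff vec_lambda_beta half by simp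
next
  fix k and j :: "int^'n"
  show "{y. dyadic_index v L k y = j} \<in> sets lebesgue"
    using sets_dyadic_cube[OF L, of v k j] by (simp add: dyadic_cube_def)
next
  fix U and x :: "real^'n" and k0
  assume "open U" "x \<in> U"
  then obtain \<epsilon> where \<epsilon>: "0 < \<epsilon>" "ball x \<epsilon> \<subseteq> U" by (meson openE)
  define R where "R = real CARD('n) + 1"
  have R: "0 < R" by (simp add: R_def add_nonneg_pos)
  obtain k1 :: nat where k1: "R * L / \<epsilon> < 2 ^ k1" using real_arch_pow[of 2 "R * L / \<epsilon>"] by auto
  define k where "k = max k0 k1"
  have "(2 :: real) ^ k1 \<le> 2 ^ k" by (simp add: k_def)
  with k1 have "R * L / \<epsilon> < 2 ^ k" by linarith
  moreover have "k0 \<le> k" by (simp add: k_def)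
  ultimately have k: "k0 \<le> k" "R * L / \<epsilon> < 2 ^ k" by blast+
  have small: "R * (L / 2 ^ k) < \<epsilon>" using k(2) \<epsilon> by (simp add: field_simps)
  have "{y. dyadic_index v L k y = dyadic_index v L k x} \<subseteq> ball x \<epsilon>"
  proof
    fix y assume "y \<in> {y. dyadic_index v L k y = dyadic_index v L k x}"
    then have "y \<in> dyadic_cube v L k (dyadic_index v L k x)" "x \<in> dyadic_cube v L k (dyadic_index v L k x)"
      by (auto simp: dyadic_cube_def)
    then have "\<bar>(y - x) $ i\<bar> \<le> L / 2 ^ k" for i
      unfolding mem_dyadic_cube_iff[OF L] by (auto simp: abs_le_iff field_simps dest!: spec[of _ i])
    then have "norm (y - x) < R * (L / 2 ^ k)"
      unfolding R_def using L by (intro norm_less_of_coordinates) auto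
    with small show "y \<in> ball x \<epsilon>" by (simp add: dist_norm norm_minus_commute)
  qed
  with \<epsilon> k show "\<exists>k\<ge>k0. {y. dyadic_index v L k y = dyadic_index v L k x} \<subseteq> U" by blast
qed

text \<open>
  A lower bound for the proportion that a cube occupies in the ball circumscribed about itself or
  about its dyadic parent, and that a ball occupies in the concentric ball of
  \<open>2 * (CARD('n) + 1)\<close> times its radius.
\<close>

definition fill_ratio :: "'n::finite itself \<Rightarrow> real" where
  "fill_ratio _ = 1 / (2 * (real CARD('n) + 1)) ^ CARD('n)"

lemma fill_ratio_pos: "0 < fill_ratio TYPE('n::finite)"
  by (simp add: fill_ratio_def add_pos_pos)

definition doubling_constant :: "(real^'n \<Rightarrow> real \<Rightarrow> real) \<Rightarrow> real \<Rightarrow> bool" where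
  "doubling_constant \<phi> D \<longleftrightarrow> (\<forall>t>0. \<forall>B\<in>balls. \<forall>E\<in>sets lebesgue. E \<subseteq> B \<longrightarrow>
     fill_ratio TYPE('n) * measure lebesgue B \<le> measure lebesgue E \<longrightarrow>
     measure (density lebesgue (\<lambda>x. \<phi> x t)) B \<le> D * measure (density lebesgue (\<lambda>x. \<phi> x t)) E)"

lemma measure_ball_le_dyadic_cube:
  fixes v z :: "real^'n"
  assumes L: "0 < L" and l: "k \<le> l"
  shows "fill_ratio TYPE('n) * measure lebesgue (ball z ((real CARD('n) + 1) * (L / 2 ^ l)))
      \<le> measure lebesgue (dyadic_cube v L k j)"
proof -
  define R where "R = real CARD('n) + 1"
  have R: "0 < R" by (simp add: R_def add_nonneg_pos)
  have "measure lebesgue (ball z (R * (L / 2 ^ l))) \<le> (2 * (R * (L / 2 ^ l))) ^ CARD('n)"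
    by (rule measure_ball_le) (use R L in simp)
  then have "fill_ratio TYPE('n) * measure lebesgue (ball z (R * (L / 2 ^ l)))
      \<le> fill_ratio TYPE('n) * (2 * (R * (L / 2 ^ l))) ^ CARD('n)"
    using fill_ratio_pos[where 'n='n] by (intro mult_left_mono) auto
  also have "\<dots> = (L / 2 ^ l) ^ CARD('n)"
    using R by (simp add: fill_ratio_def R_def[symmetric] power_mult_distrib power_divide)
  also have "\<dots> \<le> (L / 2 ^ k) ^ CARD('n)"
    using L l by (intro power_mono divide_left_mono power_increasing) auto
  also have "\<dots> = measure lebesgue (dyadic_cube v L k j)"
    using L by (simp add: measure_dyadic_cube)
  finally show ?thesis by (simp add: R_def)
qed

lemma dyadic_cube_in_ball:
  fixes v :: "real^'n"
  assumes "0 < L"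
  obtains B where "B \<in> balls" "dyadic_cube v L k j \<subseteq> B"
    "fill_ratio TYPE('n) * measure lebesgue B \<le> measure lebesgue (dyadic_cube v L k j)"
proof
  let ?B = "ball (dyadic_center v L k j) ((real CARD('n) + 1) * (L / 2 ^ Suc k))"
  show "?B \<in> balls" using assms by (intro ball_in_balls mult_pos_pos add_nonneg_pos) auto
  show "dyadic_cube v L k j \<subseteq> ?B" by (rule dyadic_cube_subset_ball[OF assms])
  show "fill_ratio TYPE('n) * measure lebesgue ?B \<le> measure lebesgue (dyadic_cube v L k j)"
    by (rule measure_ball_le_dyadic_cube[OF assms]) simp
qed


section \<open>Campanato functions along dyadic cubes\<close>

text \<open>
  The function is the pointwise limit of its restrictions to the balls of integer radius.
\<close>

lemma locally_integrable_measurable: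
  fixes f :: "real^'n \<Rightarrow> 'b::{real_normed_field,euclidean_space}"
  assumes "locally_integrable f"
  shows "f \<in> borel_measurable lebesgue"
proof (rule borel_measurable_LIMSEQ_metric)
  fix k :: nat
  have "f absolutely_integrable_on cball 0 (real k)"
    using assms unfolding locally_integrable_def by auto
  then show "(\<lambda>x. indicator (cball 0 (real k)) x *\<^sub>R f x) \<in> borel_measurable lebesgue"
    unfolding set_integrable_def by (rule borel_measurable_integrable)
next
  fix x :: "real^'n"
  obtain K :: nat where K: "norm x \<le> real K" using real_arch_simple by blast
  have "eventually (\<lambda>k. indicator (cball 0 (real k)) x *\<^sub>R f x = f x) sequentially"
    using eventually_ge_at_top[of K] by eventually_elim (use K in \<open>auto simp: indicator_def\<close>)
  then show "(\<lambda>k. indicator (cball 0 (real k)) x *\<^sub>R f x) \<longlonglongrightarrow> f x"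
    by (rule tendsto_eventually)
qed

lemma locally_integrable_ball:
  fixes f :: "real^'n \<Rightarrow> 'b::{real_normed_field,euclidean_space}"
  assumes "locally_integrable f"
  shows "set_integrable lebesgue (ball c r) f"
proof -
  have "f absolutely_integrable_on cball c r"
    using assms unfolding locally_integrable_def by auto
  then show ?thesis by (rule set_integrable_subset) auto
qed

lemma min_poly_ball_in_polynomials:
  fixes f :: "real^'n \<Rightarrow> 'b::{real_normed_field,euclidean_space}"
  assumes "locally_integrable f" "0 < r"
  shows "min_poly s (ball c r) f \<in> polynomials s"
  by (rule min_poly_in_polynomials[OF assms(2) locally_integrable_ball[OF assms(1)]])

lemma campanato_norm_bounds:
  fixes f :: "real^'n \<Rightarrow> 'b::{real_normed_field,euclidean_space}"
  assumes \<phi>: "growth_function \<phi>" and f: "f \<in> campanato_space \<phi> s"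
  shows campanato_norm_nonneg: "0 \<le> campanato_norm \<phi> s f"
    and integral_le_campanato_norm: "0 < r \<Longrightarrow> (\<integral>\<^sup>+y\<in>ball c r. ennreal (norm (f y - min_poly s (ball c r) f y)) \<partial>lebesgue) \<le>
      ennreal (campanato_norm \<phi> s f * norm_chi \<phi> (ball c r))"
proof -
  have li: "locally_integrable f" and bdd: "bdd_above (campanato_means \<phi> s f)"
    using f by (auto simp: campanato_space_def)
  define I where "I c r = (LINT x:ball c r|lebesgue. norm (f x - min_poly s (ball c r) f x))" for c r
  have I0: "0 \<le> I c r" for c r
    unfolding I_def set_lebesgue_integral_def by (intro integral_nonneg_AE AE_I2) simp
  have mean: "1 / norm_chi \<phi> (ball c r) * I c r \<le> campanato_norm \<phi> s f" if "0 < r" for c r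
    unfolding campanato_norm_def I_def
    by (rule cSup_upper[OF _ bdd]) (use ball_in_balls[OF that] in \<open>auto simp: campanato_means_def\<close>)
  have pos: "0 < norm_chi \<phi> (ball c r)" if "0 < r" for c :: "real^'n" and r
    using norm_chi_pos[OF \<phi> ball_in_balls[OF that]] .
  show "0 \<le> campanato_norm \<phi> s f"
    using mean[of 1 0] pos[of 1 0] I0[of 0 1] by (smt (verit) divide_nonneg_pos mult_nonneg_nonneg zero_le_one)
  show "(\<integral>\<^sup>+y\<in>ball c r. ennreal (norm (f y - min_poly s (ball c r) f y)) \<partial>lebesgue) \<le>
      ennreal (campanato_norm \<phi> s f * norm_chi \<phi> (ball c r))" if r: "0 < r"
  proof -
    let ?M = "lebesgue_on (ball c r)"
    have "integrable ?M f"
      using locally_integrable_ball[OF li, of c r] by (simp add: set_integrable_def integrable_restrict_space)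
    moreover have "integrable ?M (min_poly s (ball c r) f)"
      by (intro integrable_lebesgue_on_ball_continuous continuous_on_polynomials[OF min_poly_ball_in_polynomials[OF li r]])
    ultimately have int: "integrable ?M (\<lambda>y. norm (f y - min_poly s (ball c r) f y))"
      by (intro integrable_norm Bochner_Integration.integrable_diff)
    have "(\<integral>\<^sup>+y\<in>ball c r. ennreal (norm (f y - min_poly s (ball c r) f y)) \<partial>lebesgue) =
        (\<integral>\<^sup>+y. ennreal (norm (f y - min_poly s (ball c r) f y)) \<partial>?M)"
      by (subst nn_integral_restrict_space) auto
    also have "\<dots> = ennreal (I c r)"
      using int by (subst nn_integral_eq_integral) (auto simp: I_def set_integral_eq_lebesgue_on_ball)
    also have "\<dots> \<le> ennreal (campanato_norm \<phi> s f * norm_chi \<phi> (ball c r))"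
      using mean[OF r, of c] pos[OF r, of c] by (intro ennreal_leI) (simp add: field_simps)
    finally show ?thesis .
  qed
qed


text \<open>
  The oscillation attached to a cube is \<open>\<bar>f - P\<bar>\<close> with \<open>P\<close> the minimizing polynomial of the
  inscribed ball, so that the top cube, circumscribed about \<open>B\<close>, carries precisely the function
  in the level sets. The integral over a cube is estimated on the circumscribed ball first, and the
  two polynomials are then compared on the inscribed ball. All balls that occur lie in a fixed
  dilate of \<open>B\<close>, whose mass is bounded by doubling; this makes \<open>norm_chi_le_mass\<close> applicable with one
  constant.
\<close>

lemma campanato_oscillation:
  fixes \<phi> :: "real^'n \<Rightarrow> real \<Rightarrow> real" and s :: nat
  assumes \<phi>: "growth_function \<phi>" and D: "0 < D" and dbl: "doubling_constant \<phi> D"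
  shows "\<exists>a>0. \<exists>\<kappa>>0. \<exists>M>0. \<forall>f :: real^'n \<Rightarrow> 'b::{real_normed_field,euclidean_space}.
    f \<in> campanato_space \<phi> s \<longrightarrow> 0 < campanato_norm \<phi> s f \<longrightarrow> (\<forall>B\<in>balls. \<exists>v L u. 0 < L \<and>
      oscillation (dyadic_index v L) (\<lambda>x. \<phi> x (1 / norm_chi \<phi> B)) u 0
        (a * (campanato_norm \<phi> s f * norm_chi \<phi> B)) D \<kappa> \<and>
      v \<in> dyadic_cube v L 0 0 \<and> mass \<phi> (dyadic_cube v L 0 0) (1 / norm_chi \<phi> B) \<le> ennreal M \<and>
      (\<forall>\<alpha>. level_set \<phi> s f B \<alpha> \<subseteq> {y \<in> dyadic_cube v L 0 0. \<alpha> * \<phi> y (1 / norm_chi \<phi> B) < u 0 0 y}))"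
proof -
  define R where "R = real CARD('n) + 1"
  have R: "1 \<le> R" "0 < R" by (simp_all add: R_def add_nonneg_pos)
  let ?n = "CARD('n)"
  obtain Cm where Cm: "0 < Cm" "\<And>B :: (real^'n) set. B \<in> balls \<Longrightarrow> mass \<phi> B (1 / norm_chi \<phi> B) \<le> ennreal Cm"
    using mass_norm_chi[OF \<phi>] by blast
  define M where "M = D * Cm"
  have M: "0 < M" using D Cm by (simp add: M_def)
  obtain K where K: "0 < K" "\<And>t (B :: (real^'n) set). 0 < t \<Longrightarrow> B \<in> balls \<Longrightarrow> mass \<phi> B t \<le> ennreal M \<Longrightarrow>
      norm_chi \<phi> B \<le> K * enn2real (mass \<phi> B t) / t"
    using norm_chi_le_mass[OF \<phi>, of M] by blast
  obtain C where C: "0 < C" and bound_all: "\<forall>P \<in> (polynomials s :: (real^'n \<Rightarrow> 'b) set).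
    \<forall>c r z x. 0 < r \<longrightarrow> 0 \<le> z \<longrightarrow> (\<integral>\<^sup>+y\<in>ball c r. ennreal (norm (P y)) \<partial>lebesgue) \<le> ennreal z \<longrightarrow>
      x \<in> ball c (R * r) \<longrightarrow> norm (P x) \<le> C * z / r ^ ?n"
    using polynomials_bound_ball[OF R(1), of s] by (elim exE conjE) (rule that)
  have bound: "norm (P x) \<le> C * z / r ^ ?n" if "P \<in> polynomials s" "0 < r" "0 \<le> z"
    "(\<integral>\<^sup>+y\<in>ball c r. ennreal (norm (P y)) \<partial>lebesgue) \<le> ennreal z" "x \<in> ball c (R * r)"
    for P :: "real^'n \<Rightarrow> 'b" and c r z x
    using bound_all that by blast
  define a where "a = K * (1 + 2 * 2 ^ ?n * C) * D"
  have a: "0 < a" unfolding a_def using K C D by (intro mult_pos_pos add_pos_pos) auto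
  define \<kappa> where "\<kappa> = C * 2 ^ ?n"
  have \<kappa>: "0 < \<kappa>" using C by (simp add: \<kappa>_def)
  have main: "\<exists>v L u. 0 < L \<and>
      oscillation (dyadic_index v L) (\<lambda>x. \<phi> x (1 / norm_chi \<phi> B)) u 0
        (a * (campanato_norm \<phi> s f * norm_chi \<phi> B)) D \<kappa> \<and>
      v \<in> dyadic_cube v L 0 0 \<and> mass \<phi> (dyadic_cube v L 0 0) (1 / norm_chi \<phi> B) \<le> ennreal M \<and>
      (\<forall>\<alpha>. level_set \<phi> s f B \<alpha> \<subseteq> {y \<in> dyadic_cube v L 0 0. \<alpha> * \<phi> y (1 / norm_chi \<phi> B) < u 0 0 y})"
    if f: "f \<in> campanato_space \<phi> s" and N: "0 < campanato_norm \<phi> s f" and "B \<in> balls"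
    for f :: "real^'n \<Rightarrow> 'b" and B
  proof -
    obtain c r where B: "B = ball c r" and r: "0 < r" using \<open>B \<in> balls\<close> by (rule ballsE)
    define N where "N = campanato_norm \<phi> s f"
    define \<Lambda> where "\<Lambda> = norm_chi \<phi> (ball c r)"
    define t where "t = 1 / \<Lambda>"
    define v where "v = c - (\<chi> i. r)"
    define L where "L = 2 * r"
    define \<rho> where "\<rho> k = L / 2 ^ Suc k" for k
    define w where "w x = \<phi> x t" for x
    let ?Q = "dyadic_cube v L" and ?ctr = "dyadic_center v L"
    let ?\<omega> = "density lebesgue w"
    define W where "W E = measure ?\<omega> E" for E
    define Big where "Big = ball c (2 * R * r)"
    have N0: "0 < N" using N by (simp add: N_def)
    have \<Lambda>: "0 < \<Lambda>" unfolding \<Lambda>_def by (rule norm_chi_pos[OF \<phi> ball_in_balls[OF r]])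
    have t: "0 < t" using \<Lambda> by (simp add: t_def)
    have L: "0 < L" using r by (simp add: L_def)
    have \<rho>: "0 < \<rho> k" "\<rho> k \<le> r" for k
    proof -
      have "(1 :: real) \<le> 2 ^ k" by simp
      then show "\<rho> k \<le> r" using r by (simp add: \<rho>_def L_def field_simps)
    qed (use L in \<open>simp add: \<rho>_def\<close>)
    have [measurable]: "w \<in> borel_measurable lebesgue"
      unfolding w_def using growth_functionD(2)[OF \<phi>] t by simp
    have w: "0 < w x" for x unfolding w_def by (rule growth_functionD(1)[OF \<phi> t])
    have li: "locally_integrable f" using f by (simp add: campanato_space_def)
    have [measurable]: "f \<in> borel_measurable lebesgue" by (rule locally_integrable_measurable[OF li])
    have mass_W: "mass \<phi> E t = emeasure ?\<omega> E" "W E = enn2real (mass \<phi> E t)" if "E \<in> sets lebesgue" for E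
    proof -
      show "mass \<phi> E t = emeasure ?\<omega> E"
        unfolding w_def by (rule mass_eq_emeasure[OF _ that]) (use growth_functionD(2)[OF \<phi>] t in simp)
      then show "W E = enn2real (mass \<phi> E t)" by (simp add: W_def measure_def)
    qed
    have W0: "0 \<le> W E" for E by (simp add: W_def)
    have Big: "Big \<in> balls" unfolding Big_def using R r by (intro ball_in_balls) simp
    have massBig: "mass \<phi> Big t \<le> ennreal M"
    proof -
      have "measure lebesgue Big = (2 * R) ^ ?n * measure lebesgue (ball c r)"
        unfolding Big_def using r R content_ball_conv_unit_ball[of "2 * R * r" c] content_ball_conv_unit_ball[of r c]
        by (simp add: power_mult_distrib)
      then have "fill_ratio TYPE('n) * measure lebesgue Big \<le> measure lebesgue (ball c r)"
        using R by (simp add: fill_ratio_def R_def[symmetric])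
      moreover have "ball c r \<subseteq> Big"
      proof -
        have "1 * r \<le> 2 * R * r" using R r by (intro mult_right_mono) auto
        then show ?thesis unfolding Big_def by (intro subset_ball) simp
      qed
      ultimately have "W Big \<le> D * W (ball c r)"
        using dbl Big t unfolding doubling_constant_def W_def w_def by simp
      also have "D * W (ball c r) = D * enn2real (mass \<phi> (ball c r) t)" by (simp add: mass_W(2))
      also have "\<dots> \<le> D * Cm"
        using Cm(2)[OF ball_in_balls[OF r, of c]] D Cm(1) by (intro mult_left_mono) (auto simp: t_def \<Lambda>_def enn2real_leI)
      finally show ?thesis
        using growth_function_mass(1)[OF \<phi> t Big] mass_W(2)[OF sets_balls[OF Big]]
        by (cases "mass \<phi> Big t") (auto simp: M_def)
    qed
    have osc: "(\<integral>\<^sup>+y\<in>ball z \<delta>. ennreal (norm (f y - min_poly s (ball z \<delta>) f y)) \<partial>lebesgue) \<le> ennreal (K * N * \<Lambda> * W (ball z \<delta>))"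
      if "0 < \<delta>" "ball z \<delta> \<subseteq> Big" for z \<delta>
    proof -
      have "mass \<phi> (ball z \<delta>) t \<le> ennreal M" using mass_mono[OF that(2)] massBig by (rule order_trans)
      then have "norm_chi \<phi> (ball z \<delta>) \<le> K * W (ball z \<delta>) / t"
        using K(2)[OF t ball_in_balls[OF that(1)]] by (simp add: mass_W)
      then have "N * norm_chi \<phi> (ball z \<delta>) \<le> N * (K * W (ball z \<delta>) / t)"
        using N0 by (intro mult_left_mono) auto
      also have "\<dots> = K * N * \<Lambda> * W (ball z \<delta>)" by (simp add: t_def)
      finally show ?thesis
        using integral_le_campanato_norm[OF \<phi> f that(1), of z] unfolding N_def[symmetric]
        by (meson ennreal_leI order_trans)
    qed
    \<comment> \<open>two polynomials close to \<open>f\<close> on a ball are close to each other on a dilate of the ball\<close>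
    have compare: "norm (P1 y - P2 y) \<le> C * (z1 + z2) / \<delta> ^ ?n"
      if P: "P1 \<in> polynomials s" "P2 \<in> polynomials s" and \<delta>: "0 < \<delta>" and z: "0 \<le> z1" "0 \<le> z2"
        and i1: "(\<integral>\<^sup>+y\<in>ball z \<delta>. ennreal (norm (f y - P1 y)) \<partial>lebesgue) \<le> ennreal z1"
        and i2: "(\<integral>\<^sup>+y\<in>ball z \<delta>. ennreal (norm (f y - P2 y)) \<partial>lebesgue) \<le> ennreal z2"
        and y: "y \<in> ball z (R * \<delta>)" for P1 P2 z1 z2 z \<delta> y
    proof (rule bound[OF polynomials_diff[OF P] \<delta> _ _ y])
      have [measurable]: "P1 \<in> borel_measurable lebesgue" "P2 \<in> borel_measurable lebesgue"
        using P by (auto intro!: borel_measurable_continuous_onI continuous_on_polynomials measurable_completion)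
      have [measurable]: "ball z \<delta> \<in> sets lebesgue" by simp
      have "(\<integral>\<^sup>+y\<in>ball z \<delta>. ennreal (norm (P1 y - P2 y)) \<partial>lebesgue) \<le>
          (\<integral>\<^sup>+y. ennreal (norm (f y - P1 y)) * indicator (ball z \<delta>) y + ennreal (norm (f y - P2 y)) * indicator (ball z \<delta>) y \<partial>lebesgue)"
      proof (rule nn_integral_mono)
        fix y
        have "norm (P1 y - P2 y) \<le> norm (f y - P1 y) + norm (f y - P2 y)"
          using norm_triangle_ineq4[of "f y - P2 y" "f y - P1 y"] by (simp add: algebra_simps)
        then show "ennreal (norm (P1 y - P2 y)) * indicator (ball z \<delta>) y \<le>
            ennreal (norm (f y - P1 y)) * indicator (ball z \<delta>) y + ennreal (norm (f y - P2 y)) * indicator (ball z \<delta>) y"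
          by (auto simp: indicator_def ennreal_plus[symmetric] simp del: ennreal_plus intro!: ennreal_leI)
      qed
      also have "\<dots> = (\<integral>\<^sup>+y\<in>ball z \<delta>. ennreal (norm (f y - P1 y)) \<partial>lebesgue) + (\<integral>\<^sup>+y\<in>ball z \<delta>. ennreal (norm (f y - P2 y)) \<partial>lebesgue)"
        by (rule nn_integral_add) measurable
      also have "\<dots> \<le> ennreal z1 + ennreal z2" by (rule add_mono[OF i1 i2])
      finally show "(\<integral>\<^sup>+y\<in>ball z \<delta>. ennreal (norm (P1 y - P2 y)) \<partial>lebesgue) \<le> ennreal (z1 + z2)"
        using z by simp
    qed (use z in simp)
    interpret nested_partitions "dyadic_index v L" by (rule nested_partitions_dyadic_index[OF L])
    have cell: "cell k j = ?Q k j" for k j by (simp add: cell_def dyadic_cube_def)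
    have sets_Q [measurable]: "?Q k j \<in> sets lebesgue" for k j using sets_cell[of k j] by (simp add: cell)
    have top: "?ctr 0 0 = c" "\<rho> 0 = r" by (simp_all add: dyadic_center_def vec_eq_iff v_def L_def \<rho>_def)
    have inner: "ball (?ctr k j) (\<rho> k) \<subseteq> ?Q k j" for k j
      unfolding \<rho>_def by (rule ball_subset_dyadic_cube[OF L])
    have outer: "?Q k j \<subseteq> ball (?ctr k j) (R * \<rho> k)" for k j
      unfolding \<rho>_def R_def by (rule dyadic_cube_subset_ball[OF L])
    have vol: "measure lebesgue (?Q k j) = (2 * \<rho> k) ^ ?n" "emeasure lebesgue (?Q k j) = ennreal ((2 * \<rho> k) ^ ?n)" for k j
      unfolding \<rho>_def using measure_dyadic_cube[OF L, of v k j] by auto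
    have outer_Big: "ball (?ctr k (dyadic_index v L k x)) (R * \<rho> k) \<subseteq> Big" if x: "dyadic_index v L 0 x = 0" for k x
    proof -
      let ?j = "dyadic_index v L k x"
      have "?ctr k ?j \<in> ball (?ctr k ?j) (\<rho> k)" using \<rho> by simp
      also have "\<dots> \<subseteq> ?Q k ?j" by (rule inner)
      also have "\<dots> \<subseteq> ?Q 0 0" using cell_subset[of 0 k x] x by (simp add: cell)
      also have "\<dots> \<subseteq> ball c (R * r)" using outer[of 0 0] top by simp
      finally have "dist c (?ctr k ?j) < R * r" by simp
      moreover have "R * \<rho> k \<le> R * r" using \<rho>(2) R by simp
      ultimately have sum: "dist c (?ctr k ?j) + R * \<rho> k \<le> 2 * R * r" by simp
      show ?thesis
      proof
        fix y assume "y \<in> ball (?ctr k ?j) (R * \<rho> k)"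
        then show "y \<in> Big"
          using dist_triangle[of c y "?ctr k ?j"] sum by (simp add: Big_def)
      qed
    qed
    have W_mono: "W E \<le> W F" if "E \<in> sets lebesgue" "F \<in> sets lebesgue" "E \<subseteq> F" "F \<subseteq> Big" for E F
    proof -
      have "mass \<phi> F t \<le> ennreal M" using mass_mono[OF that(4)] massBig by (rule order_trans)
      then have "mass \<phi> F t < top" by (simp add: le_less_trans)
      then show ?thesis using that mass_mono[OF that(3), of \<phi> t] by (simp add: mass_W enn2real_mono)
    qed
    have W_dbl: "W (ball z (R * (L / 2 ^ l))) \<le> D * W (?Q k j)"
      if "k \<le> l" "?Q k j \<subseteq> ball z (R * (L / 2 ^ l))" for k l j z
    proof -
      have ball: "ball z (R * (L / 2 ^ l)) \<in> balls" using R L by (intro ball_in_balls) simp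
      have "fill_ratio TYPE('n) * measure lebesgue (ball z (R * (L / 2 ^ l))) \<le> measure lebesgue (?Q k j)"
        unfolding R_def by (rule measure_ball_le_dyadic_cube[OF L that(1)])
      then show ?thesis
        using dbl t ball sets_Q that(2) unfolding doubling_constant_def W_def w_def by blast
    qed
    define P where "P k j = min_poly s (ball (?ctr k j) (\<rho> k)) f" for k j
    define u where "u k j y = norm (f y - P k j y)" for k j y
    have P: "P k j \<in> polynomials s" for k j
      unfolding P_def by (rule min_poly_ball_in_polynomials[OF li \<rho>(1)])
    have P_meas [measurable]: "P k j \<in> borel_measurable lebesgue" for k j
      using P[of k j] by (auto intro!: borel_measurable_continuous_onI continuous_on_polynomials measurable_completion)
    have u_meas [measurable]: "u k j \<in> borel_measurable lebesgue" for k j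
      unfolding u_def by measurable
    have u_int: "emeasure (density lebesgue (u k j)) E = (\<integral>\<^sup>+y\<in>E. ennreal (norm (f y - P k j y)) \<partial>lebesgue)"
      if "E \<in> sets lebesgue" for k j E
      using that by (subst emeasure_density) (auto simp: u_def)
    have mean: "emeasure (density lebesgue (u k j)) (?Q k j) \<le> ennreal (a * N * \<Lambda> * W (?Q k j))"
      if x: "dyadic_index v L 0 x = 0" "j = dyadic_index v L k x" for x k j
    proof -
      let ?b = "ball (?ctr k j) (\<rho> k)" and ?B = "ball (?ctr k j) (R * \<rho> k)"
      define T where "T = min_poly s ?B f"
      have RB: "0 < R * \<rho> k" using R \<rho> by simp
      have [measurable]: "?B \<in> sets lebesgue" by simp
      have T: "T \<in> polynomials s" unfolding T_def by (rule min_poly_ball_in_polynomials[OF li RB])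
      have [measurable]: "T \<in> borel_measurable lebesgue"
        using T by (auto intro!: borel_measurable_continuous_onI continuous_on_polynomials measurable_completion)
      have sub: "?B \<subseteq> Big" using outer_Big[OF x(1), of k] x(2) by simp
      have bB: "?b \<subseteq> ?B" using inner[of k j] outer[of k j] by (rule subset_trans)
      define z where "z = K * N * \<Lambda> * W ?B"
      have KN: "0 \<le> K * N * \<Lambda>" using K N0 \<Lambda> by simp
      have z: "0 \<le> z" using KN W0 by (simp add: z_def)
      have iT: "(\<integral>\<^sup>+y\<in>?B. ennreal (norm (f y - T y)) \<partial>lebesgue) \<le> ennreal z"
        unfolding T_def z_def by (rule osc[OF RB sub])
      have ib: "(\<integral>\<^sup>+y\<in>?b. ennreal (norm (f y - P k j y)) \<partial>lebesgue) \<le> ennreal z"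
      proof -
        have "(\<integral>\<^sup>+y\<in>?b. ennreal (norm (f y - P k j y)) \<partial>lebesgue) \<le> ennreal (K * N * \<Lambda> * W ?b)"
          unfolding P_def using \<rho>(1) subset_trans[OF bB sub] by (rule osc)
        also have "\<dots> \<le> ennreal z"
          unfolding z_def using KN sub bB by (intro ennreal_leI mult_left_mono W_mono) auto
        finally show ?thesis .
      qed
      have iTb: "(\<integral>\<^sup>+y\<in>?b. ennreal (norm (f y - T y)) \<partial>lebesgue) \<le> ennreal z"
        by (rule order_trans[OF _ iT], rule nn_integral_mono) (use bB in \<open>auto simp: indicator_def\<close>)
      define d where "d = C * (z + z) / \<rho> k ^ ?n"
      have d: "0 \<le> d" using C z \<rho>(1)[of k] by (simp add: d_def)
      have Td: "norm (T y - P k j y) \<le> d" if "y \<in> ?B" for y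
        unfolding d_def by (rule compare[OF T P \<rho>(1) z z iTb ib that])
      have "emeasure (density lebesgue (u k j)) (?Q k j) \<le>
          (\<integral>\<^sup>+y. ennreal (norm (f y - T y)) * indicator ?B y + ennreal d * indicator (?Q k j) y \<partial>lebesgue)"
        unfolding u_int[OF sets_Q]
      proof (rule nn_integral_mono)
        fix y
        show "ennreal (norm (f y - P k j y)) * indicator (?Q k j) y \<le>
            ennreal (norm (f y - T y)) * indicator ?B y + ennreal d * indicator (?Q k j) y"
        proof (cases "y \<in> ?Q k j")
          case True
          then have y: "y \<in> ?B" using outer by blast
          have "norm (f y - P k j y) \<le> norm (f y - T y) + d"
            using norm_triangle_ineq[of "f y - T y" "T y - P k j y"] Td[OF y] by simp
          then show ?thesis using True y d
            by (simp add: ennreal_plus[symmetric] ennreal_leI del: ennreal_plus)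
        qed simp
      qed
      also have "\<dots> = (\<integral>\<^sup>+y\<in>?B. ennreal (norm (f y - T y)) \<partial>lebesgue) + ennreal d * emeasure lebesgue (?Q k j)"
        by (subst nn_integral_add, measurable) (simp add: nn_integral_cmult_indicator)
      also have "\<dots> \<le> ennreal z + ennreal d * ennreal ((2 * \<rho> k) ^ ?n)"
        using iT by (simp add: vol add_right_mono)
      also have "\<dots> = ennreal (z + d * (2 * \<rho> k) ^ ?n)"
        using z d \<rho>(1)[of k] by (simp add: ennreal_mult)
      also have "z + d * (2 * \<rho> k) ^ ?n = (1 + 2 * 2 ^ ?n * C) * z"
        using \<rho>(1)[of k] by (simp add: d_def power_mult_distrib field_simps)
      also have "\<dots> \<le> a * N * \<Lambda> * W (?Q k j)"
      proof -
        have "W ?B \<le> D * W (?Q k j)"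
          using W_dbl[of k "Suc k" j "?ctr k j"] outer[of k j] by (simp add: \<rho>_def)
        then have "(1 + 2 * 2 ^ ?n * C) * (K * N * \<Lambda>) * W ?B \<le> (1 + 2 * 2 ^ ?n * C) * (K * N * \<Lambda>) * (D * W (?Q k j))"
          using C KN by (intro mult_left_mono) auto
        then show ?thesis by (simp add: z_def a_def mult_ac)
      qed
      finally show ?thesis by (simp add: ennreal_leI)
    qed
    have doubling: "W (?Q k (dyadic_index v L k x)) \<le> D * W (?Q (Suc k) (dyadic_index v L (Suc k) x))"
      if x: "dyadic_index v L 0 x = 0" for k x
    proof -
      let ?j = "dyadic_index v L k x" and ?i = "dyadic_index v L (Suc k) x"
      let ?B = "ball (?ctr k ?j) (R * \<rho> k)"
      have "?Q (Suc k) ?i \<subseteq> ?Q k ?j" using cell_subset[of k "Suc k" x] by (simp add: cell)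
      then have "?Q (Suc k) ?i \<subseteq> ?B" using outer[of k ?j] by (rule subset_trans)
      then have "W ?B \<le> D * W (?Q (Suc k) ?i)"
        using W_dbl[of "Suc k" "Suc k" ?i "?ctr k ?j"] by (simp add: \<rho>_def)
      moreover have "W (?Q k ?j) \<le> W ?B" using outer_Big[OF x] outer by (intro W_mono) auto
      ultimately show ?thesis by simp
    qed
    have aN: "0 < a * N * \<Lambda>" using a N0 \<Lambda> by simp
    have change: "u k (dyadic_index v L k x) y \<le> u l (dyadic_index v L l x) y +
        \<kappa> * (z + a * N * \<Lambda> * W (?Q l (dyadic_index v L l x))) / measure lebesgue (?Q l (dyadic_index v L l x))"
      if x: "dyadic_index v L 0 x = 0" and z: "0 \<le> z"
        and i: "emeasure (density lebesgue (u k (dyadic_index v L k x))) (?Q l (dyadic_index v L l x)) \<le> ennreal z"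
        and y: "dyadic_index v L l y = dyadic_index v L l x" for k l x y z
    proof -
      let ?j = "dyadic_index v L k x" and ?i = "dyadic_index v L l x"
      let ?b = "ball (?ctr l ?i) (\<rho> l)"
      have b: "(\<integral>\<^sup>+y\<in>?b. ennreal (norm (f y - P m h y)) \<partial>lebesgue) \<le> emeasure (density lebesgue (u m h)) (?Q l ?i)" for m h
        unfolding u_int[OF sets_Q] using inner[of l ?i] by (intro nn_integral_mono) (auto simp: indicator_def)
      define z' where "z' = a * N * \<Lambda> * W (?Q l ?i)"
      have z': "0 \<le> z'" using aN W0 by (simp add: z'_def)
      have "y \<in> ?Q l ?i" using y by (simp add: dyadic_cube_def)
      then have y': "y \<in> ball (?ctr l ?i) (R * \<rho> l)" using outer by blast
      have "norm (P l ?i y - P k ?j y) \<le> C * (z' + z) / \<rho> l ^ ?n"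
        using order_trans[OF b mean[OF x refl, of l]] order_trans[OF b i]
        unfolding z'_def[symmetric] by (intro compare[OF P P \<rho>(1) z' z _ _ y'])
      also have "\<dots> = \<kappa> * (z + z') / measure lebesgue (?Q l ?i)"
        using \<rho>(1)[of l] by (simp add: vol \<kappa>_def power_mult_distrib field_simps)
      finally have "norm (P l ?i y - P k ?j y) \<le> \<kappa> * (z + z') / measure lebesgue (?Q l ?i)" .
      then show ?thesis
        using norm_triangle_ineq[of "f y - P l ?i y" "P l ?i y - P k ?j y"] by (simp add: u_def z'_def)
    qed
    have Q0: "?Q 0 0 \<subseteq> Big"
    proof -
      have "R * r \<le> 2 * R * r" using R r by simp
      then show ?thesis using outer[of 0 0] top by (auto simp: Big_def intro: subset_trans[OF _ subset_ball])
    qed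
    have massQ0: "mass \<phi> (?Q 0 0) t \<le> ennreal M" using mass_mono[OF Q0] massBig by (rule order_trans)
    have "oscillation (dyadic_index v L) w u 0 (a * N * \<Lambda>) D \<kappa>"
    proof (unfold_locales)
      show "emeasure ?\<omega> (cell 0 0) < \<infinity>"
        using massQ0 by (simp add: cell mass_W le_less_trans)
    qed (use w aN D \<kappa> mean doubling change in \<open>simp_all add: cell W_def\<close>)
    then have osc: "oscillation (dyadic_index v L) (\<lambda>x. \<phi> x (1 / norm_chi \<phi> B)) u 0
        (a * (campanato_norm \<phi> s f * norm_chi \<phi> B)) D \<kappa>"
      unfolding w_def[abs_def] t_def \<Lambda>_def N_def B mult.assoc .
    have "v \<in> ?Q 0 0" by (simp add: dyadic_cube_def dyadic_index_def vec_eq_iff)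
    moreover have "level_set \<phi> s f B \<alpha> \<subseteq> {y \<in> ?Q 0 0. \<alpha> * \<phi> y (1 / norm_chi \<phi> B) < u 0 0 y}" for \<alpha>
    proof
      fix x assume x: "x \<in> level_set \<phi> s f B \<alpha>"
      then have "x \<in> ?Q 0 0" using inner[of 0 0] top by (auto simp: level_set_def B)
      moreover have "\<alpha> * w x < u 0 0 x"
        using x w[of x] by (simp add: level_set_def B u_def P_def top pos_less_divide_eq w_def t_def \<Lambda>_def)
      ultimately show "x \<in> {y \<in> ?Q 0 0. \<alpha> * \<phi> y (1 / norm_chi \<phi> B) < u 0 0 y}"
        by (simp add: w_def t_def \<Lambda>_def B)
    qed
    ultimately show ?thesis
      using L osc massQ0 unfolding t_def \<Lambda>_def B by blast
  qed
  show ?thesis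
    by (rule exI[of _ a], intro conjI a, rule exI[of _ \<kappa>], intro conjI \<kappa>, rule exI[of _ M], intro conjI M)
      (use main in blast)
qed

section \<open>The two distribution estimates\<close>

lemma muckenhoupt_one_estimates:
  fixes \<phi> :: "real^'n \<Rightarrow> real \<Rightarrow> real"
  assumes \<phi>: "growth_function \<phi>" and A1: "\<phi> \<in> muckenhoupt 1"
  obtains A where "0 < A" "doubling_constant \<phi> A"
    "\<And>t B E. 0 < t \<Longrightarrow> B \<in> balls \<Longrightarrow> E \<in> sets lebesgue \<Longrightarrow> E \<subseteq> B \<Longrightarrow>
       fill_ratio TYPE('n) * measure lebesgue B \<le> measure lebesgue E \<Longrightarrow>
       AE y in lebesgue. y \<in> E \<longrightarrow>
         measure (density lebesgue (\<lambda>x. \<phi> x t)) E / measure lebesgue E \<le> A * \<phi> y t"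
proof -
  note gf = growth_functionD[OF \<phi>]
  obtain A where A: "0 < A" and
    "\<And>t B. 0 < t \<Longrightarrow> B \<in> balls \<Longrightarrow> mass \<phi> B t < \<infinity>" and
    A1': "\<And>t B. 0 < t \<Longrightarrow> B \<in> balls \<Longrightarrow>
       AE y in lebesgue. y \<in> B \<longrightarrow> enn2real (mass \<phi> B t) / measure lebesgue B \<le> A * \<phi> y t"
    by (rule muckenhoupt_oneD[OF A1 gf(1)]) (assumption, rule that)
  let ?\<eta> = "fill_ratio TYPE('n)"
  have est: "measure (density lebesgue (\<lambda>x. \<phi> x t)) B \<le> A / ?\<eta> * measure (density lebesgue (\<lambda>x. \<phi> x t)) E"
    "AE y in lebesgue. y \<in> E \<longrightarrow>
         measure (density lebesgue (\<lambda>x. \<phi> x t)) E / measure lebesgue E \<le> A / ?\<eta> * \<phi> y t"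
    if t: "0 < t" and B: "B \<in> balls" and E: "E \<in> sets lebesgue" "E \<subseteq> B"
      "?\<eta> * measure lebesgue B \<le> measure lebesgue E" for t B E
  proof -
    have meas: "(\<lambda>x. \<phi> x t) \<in> borel_measurable lebesgue" using gf(2) t by simp
    have B': "mass \<phi> B t = emeasure (density lebesgue (\<lambda>x. \<phi> x t)) B"
      by (rule mass_eq_emeasure[where \<phi>=\<phi> and t=t, OF meas sets_balls[OF B]])
    have fin: "emeasure (density lebesgue (\<lambda>x. \<phi> x t)) B < \<infinity>"
      using growth_function_mass(1)[OF \<phi> t B] by (simp add: B')
    have ae: "AE y in lebesgue. y \<in> B \<longrightarrow> measure (density lebesgue (\<lambda>x. \<phi> x t)) B / measure lebesgue B \<le> A * \<phi> y t"
      using A1'[OF t B] by (simp add: B' measure_def)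
    note * = A1_subset_estimates[OF meas gf(1)[OF t] B fin E(1,2) fill_ratio_pos E(3) A ae]
    show "measure (density lebesgue (\<lambda>x. \<phi> x t)) B \<le> A / ?\<eta> * measure (density lebesgue (\<lambda>x. \<phi> x t)) E"
      by (rule *(1))
    show "AE y in lebesgue. y \<in> E \<longrightarrow>
         measure (density lebesgue (\<lambda>x. \<phi> x t)) E / measure lebesgue E \<le> A / ?\<eta> * \<phi> y t"
      by (rule *(2))
  qed
  show ?thesis
  proof (rule that)
    show "0 < A / ?\<eta>" using A fill_ratio_pos by (intro divide_pos_pos)
    show "doubling_constant \<phi> (A / ?\<eta>)"
      unfolding doubling_constant_def
      by (intro allI impI ballI est(1))
  qed (rule est(2))
qed

lemma muckenhoupt_estimates:
  fixes \<phi> :: "real^'n \<Rightarrow> real \<Rightarrow> real"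
  assumes \<phi>: "growth_function \<phi>" and Aq: "\<phi> \<in> muckenhoupt q" and q: "1 < q"
  obtains D H where "0 < D" "0 \<le> H" "doubling_constant \<phi> D"
    "\<And>t B E \<rho>. 0 < t \<Longrightarrow> B \<in> balls \<Longrightarrow> E \<in> sets lebesgue \<Longrightarrow> E \<subseteq> B \<Longrightarrow>
       fill_ratio TYPE('n) * measure lebesgue B \<le> measure lebesgue E \<Longrightarrow> 0 < \<rho> \<Longrightarrow>
       emeasure (density lebesgue (\<lambda>x. \<phi> x t))
         {y \<in> E. \<rho> * \<phi> y t < measure (density lebesgue (\<lambda>x. \<phi> x t)) E / measure lebesgue E}
       \<le> ennreal (H * \<rho> powr - (q / (q - 1)) * measure (density lebesgue (\<lambda>x. \<phi> x t)) E)"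
proof -
  note gf = growth_functionD[OF \<phi>]
  have pos_meas: "(\<lambda>x. \<phi> x t) \<in> borel_measurable lebesgue" if "0 < t" for t
    using gf(2) that by simp
  obtain A where A: "0 < A" and
    "\<And>t B. 0 < t \<Longrightarrow> B \<in> balls \<Longrightarrow> mass \<phi> B t < \<infinity>" and
    Aq': "\<And>t B. 0 < t \<Longrightarrow> B \<in> balls \<Longrightarrow> (\<integral>\<^sup>+y\<in>B. ennreal (\<phi> y t powr (- 1 / (q - 1))) \<partial>lebesgue) \<le>
        ennreal ((A / (enn2real (mass \<phi> B t) / measure lebesgue B)) powr (1 / (q - 1)) * measure lebesgue B)"
    by (rule muckenhouptD[OF Aq q pos_meas gf(1)]) (assumption, assumption, rule that)
  let ?\<eta> = "fill_ratio TYPE('n)"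
  define D where "D = A * (2 / ?\<eta>) powr q"
  define H where "H = A powr (1 / (q - 1)) * ?\<eta> powr (- q / (q - 1))"
  have est: "measure (density lebesgue (\<lambda>x. \<phi> x t)) B \<le> D * measure (density lebesgue (\<lambda>x. \<phi> x t)) E"
    "0 < \<rho> \<Longrightarrow> emeasure (density lebesgue (\<lambda>x. \<phi> x t))
         {y \<in> E. \<rho> * \<phi> y t < measure (density lebesgue (\<lambda>x. \<phi> x t)) E / measure lebesgue E}
       \<le> ennreal (H * \<rho> powr - (q / (q - 1)) * measure (density lebesgue (\<lambda>x. \<phi> x t)) E)"
    if t: "0 < t" and B: "B \<in> balls" and E: "E \<in> sets lebesgue" "E \<subseteq> B"
      "?\<eta> * measure lebesgue B \<le> measure lebesgue E" for t B E \<rho>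
  proof -
    have meas: "(\<lambda>x. \<phi> x t) \<in> borel_measurable lebesgue" using gf(2) t by simp
    have B': "mass \<phi> B t = emeasure (density lebesgue (\<lambda>x. \<phi> x t)) B"
      by (rule mass_eq_emeasure[where \<phi>=\<phi> and t=t, OF meas sets_balls[OF B]])
    have fin: "emeasure (density lebesgue (\<lambda>x. \<phi> x t)) B < \<infinity>"
      using growth_function_mass(1)[OF \<phi> t B] by (simp add: B')
    note le = Aq'[OF t B, unfolded B' measure_def[symmetric]]
    note * = Aq_subset_estimates[OF meas gf(1)[OF t] B fin E(1,2) fill_ratio_pos E(3) A q le]
    show "measure (density lebesgue (\<lambda>x. \<phi> x t)) B \<le> D * measure (density lebesgue (\<lambda>x. \<phi> x t)) E"
      unfolding D_def by (rule *(1))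
    show "emeasure (density lebesgue (\<lambda>x. \<phi> x t))
         {y \<in> E. \<rho> * \<phi> y t < measure (density lebesgue (\<lambda>x. \<phi> x t)) E / measure lebesgue E}
       \<le> ennreal (H * \<rho> powr - (q / (q - 1)) * measure (density lebesgue (\<lambda>x. \<phi> x t)) E)" if "0 < \<rho>"
      using *(2)[OF that] by (simp add: H_def)
  qed
  show ?thesis
  proof (rule that)
    show "0 < D" using A fill_ratio_pos[where 'n='n] by (simp add: D_def)
    show "0 \<le> H" by (simp add: H_def)
    show "doubling_constant \<phi> D"
      unfolding doubling_constant_def
      by (intro allI impI ballI est(1))
  qed (rule est(2))
qed

text \<open>
  If the norm vanishes, then \<open>f\<close> agrees with its minimizing polynomial almost everywhere on \<open>B\<close>.
\<close>

lemma mass_level_set_norm_zero: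
  fixes f :: "real^'n \<Rightarrow> 'b::{real_normed_field,euclidean_space}"
  assumes \<phi>: "growth_function \<phi>" and f: "f \<in> campanato_space \<phi> s" and N: "campanato_norm \<phi> s f = 0"
    and B: "B \<in> balls" and \<alpha>: "0 < \<alpha>"
  shows "mass \<phi> (level_set \<phi> s f B \<alpha>) t = 0"
proof -
  obtain c r where B': "B = ball c r" and r: "0 < r" using B by (rule ballsE)
  have li: "locally_integrable f" using f by (simp add: campanato_space_def)
  have [measurable]: "f \<in> borel_measurable lebesgue" by (rule locally_integrable_measurable[OF li])
  have [measurable]: "min_poly s B f \<in> borel_measurable lebesgue"
    unfolding B' using min_poly_ball_in_polynomials[OF li r]
    by (auto intro!: borel_measurable_continuous_onI continuous_on_polynomials measurable_completion)
  have [measurable]: "B \<in> sets lebesgue" using B by simp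
  have "(\<integral>\<^sup>+y\<in>B. ennreal (norm (f y - min_poly s B f y)) \<partial>lebesgue) = 0"
    using integral_le_campanato_norm[OF \<phi> f r, of c] by (simp add: N B')
  then have "AE y in lebesgue. ennreal (norm (f y - min_poly s B f y)) * indicator B y = 0"
    by (subst (asm) nn_integral_0_iff_AE) auto
  then have "AE y in lebesgue. ennreal (\<phi> y t) * indicator (level_set \<phi> s f B \<alpha>) y = 0"
    by eventually_elim (use \<alpha> in \<open>auto simp: level_set_def indicator_def split: if_splits\<close>)
  then have "(\<integral>\<^sup>+y. ennreal (\<phi> y t) * indicator (level_set \<phi> s f B \<alpha>) y \<partial>lebesgue) = (\<integral>\<^sup>+y. 0 \<partial>(lebesgue :: (real^'n) measure))"
    by (rule nn_integral_cong_AE)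
  then show ?thesis by (simp add: mass_def)
qed

lemma exponential_decay:
  fixes \<phi> :: "real^'n \<Rightarrow> real \<Rightarrow> real" and s :: nat
  assumes \<phi>: "growth_function \<phi>" and A1: "\<phi> \<in> muckenhoupt 1"
  shows "\<exists>C1>0. \<exists>C2>0. \<forall>f :: real^'n \<Rightarrow> 'b::{real_normed_field,euclidean_space}.
    f \<in> campanato_space \<phi> s \<longrightarrow> 0 < campanato_norm \<phi> s f \<longrightarrow> (\<forall>B\<in>balls. \<forall>\<alpha>>0.
      mass \<phi> (level_set \<phi> s f B \<alpha>) (1 / norm_chi \<phi> B)
      \<le> ennreal (C1 * exp (- (C2 * \<alpha> / (campanato_norm \<phi> s f * norm_chi \<phi> B)))))"
proof -
  obtain A where A: "0 < A" and dbl: "doubling_constant \<phi> A" and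
    dens: "\<And>t B E. 0 < t \<Longrightarrow> B \<in> balls \<Longrightarrow> E \<in> sets lebesgue \<Longrightarrow> E \<subseteq> B \<Longrightarrow>
       fill_ratio TYPE('n) * measure lebesgue B \<le> measure lebesgue E \<Longrightarrow>
       AE y in lebesgue. y \<in> E \<longrightarrow>
         measure (density lebesgue (\<lambda>x. \<phi> x t)) E / measure lebesgue E \<le> A * \<phi> y t"
    by (rule muckenhoupt_one_estimates[OF \<phi> A1]) blast
  obtain a \<kappa> M where a_pos: "0 < a" and \<kappa>: "0 < \<kappa>" and M: "0 < M" and
    osc: "\<forall>f :: real^'n \<Rightarrow> 'b. f \<in> campanato_space \<phi> s \<longrightarrow> 0 < campanato_norm \<phi> s f \<longrightarrow>
      (\<forall>B\<in>balls. \<exists>v L u. 0 < L \<and>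
      oscillation (dyadic_index v L) (\<lambda>x. \<phi> x (1 / norm_chi \<phi> B)) u 0
        (a * (campanato_norm \<phi> s f * norm_chi \<phi> B)) A \<kappa> \<and>
      v \<in> dyadic_cube v L 0 0 \<and> mass \<phi> (dyadic_cube v L 0 0) (1 / norm_chi \<phi> B) \<le> ennreal M \<and>
      (\<forall>\<alpha>. level_set \<phi> s f B \<alpha> \<subseteq> {y \<in> dyadic_cube v L 0 0. \<alpha> * \<phi> y (1 / norm_chi \<phi> B) < u 0 0 y}))"
    using campanato_oscillation[OF \<phi> A dbl, of s] by (elim exE conjE) (rule that)
  define \<Lambda> where "\<Lambda> = max 2 (\<kappa> * (2 * A + 1) * A)"
  have \<Lambda>: "2 \<le> \<Lambda>" "\<kappa> * (2 * A + 1) * A \<le> \<Lambda>" by (auto simp: \<Lambda>_def)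
  have main: "mass \<phi> (level_set \<phi> s f B \<alpha>) (1 / norm_chi \<phi> B)
      \<le> ennreal (2 * M * exp (- (ln 2 / (\<Lambda> * a) * \<alpha> / (campanato_norm \<phi> s f * norm_chi \<phi> B))))"
    if f: "f \<in> campanato_space \<phi> s" and N: "0 < campanato_norm \<phi> s f" and B: "B \<in> balls" and \<alpha>: "0 < \<alpha>"
    for f :: "real^'n \<Rightarrow> 'b" and B \<alpha>
  proof -
    define t where "t = 1 / norm_chi \<phi> B"
    define d where "d = campanato_norm \<phi> s f * norm_chi \<phi> B"
    have chi: "0 < norm_chi \<phi> B" by (rule norm_chi_pos[OF \<phi> B])
    then have t: "0 < t" and d: "0 < d" using N by (simp_all add: t_def d_def)
    have ad: "0 < a * d" using a_pos d by simp
    define w where "w x = \<phi> x t" for x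
    obtain v L u where L: "0 < L" and
      osc_u: "oscillation (dyadic_index v L) (\<lambda>x. \<phi> x (1 / norm_chi \<phi> B)) u 0
        (a * (campanato_norm \<phi> s f * norm_chi \<phi> B)) A \<kappa>" and
      v: "v \<in> dyadic_cube v L 0 0" and
      mass_u: "mass \<phi> (dyadic_cube v L 0 0) (1 / norm_chi \<phi> B) \<le> ennreal M" and
      level_u: "\<forall>\<alpha>. level_set \<phi> s f B \<alpha> \<subseteq> {y \<in> dyadic_cube v L 0 0. \<alpha> * \<phi> y (1 / norm_chi \<phi> B) < u 0 0 y}"
      using osc[rule_format, OF f N B] by (elim exE conjE) (rule that)
    have o: "oscillation (dyadic_index v L) w u 0 (a * d) A \<kappa>"
      and M': "mass \<phi> (dyadic_cube v L 0 0) t \<le> ennreal M"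
      and level: "level_set \<phi> s f B \<alpha> \<subseteq> {y \<in> dyadic_cube v L 0 0. \<alpha> * w y < u 0 0 y}"
      unfolding w_def[abs_def] t_def d_def using osc_u mass_u level_u by blast+
    interpret oscillation "dyadic_index v L" w u 0 "a * d" A \<kappa> by (rule o)
    have cell: "cell k j = dyadic_cube v L k j" for k j by (simp add: cell_def dyadic_cube_def)
    have top: "(0, 0) \<in> cells" using v by (force simp: cells_def dyadic_cube_def)
    have wM: "weight (0, 0) \<le> M"
      using emeasure_cell[OF top] M' M sets_cell[of 0 0] w_measurable
      by (simp add: cell mass_eq_emeasure w_def[abs_def])
    have ae: "AE y in lebesgue. y \<in> case_prod cell C \<longrightarrow> density_on C \<le> A * w y" if "C \<in> cells" for C
    proof -
      obtain k j where C: "C = (k, j)" by (cases C)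
      obtain B where "B \<in> balls" "cell k j \<subseteq> B"
        "fill_ratio TYPE('n) * measure lebesgue B \<le> measure lebesgue (cell k j)"
        unfolding cell by (rule dyadic_cube_in_ball[OF L])
      then show ?thesis
        using dens[OF t _ sets_cell[of k j]]
        unfolding C density_on_def weight_def case_prod_conv unfolding w_def[abs_def] by blast
    qed
    have sub: "level_set \<phi> s f B \<alpha> \<subseteq> superlevel (\<alpha> / (a * d)) (0, 0)"
      using level a_pos d by (simp add: superlevel_def cell)
    have "mass \<phi> (level_set \<phi> s f B \<alpha>) t \<le> mass \<phi> (superlevel (\<alpha> / (a * d)) (0, 0)) t"
      by (rule mass_mono[OF sub])
    also have "\<dots> = emeasure \<mu> (superlevel (\<alpha> / (a * d)) (0, 0))"
      unfolding w_def[abs_def] by (rule mass_eq_emeasure[where \<phi>=\<phi> and t=t, OF w_measurable[unfolded w_def] sets_superlevel[unfolded w_def[abs_def]]])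
    also have "\<dots> \<le> ennreal (2 * exp (- (ln 2 / \<Lambda> * (\<alpha> / (a * d)))) * weight (0, 0))"
      using \<alpha> ad by (intro superlevel_exponential[OF ae A \<Lambda> _ top]) auto
    also have "\<dots> \<le> ennreal (2 * exp (- (ln 2 / \<Lambda> * (\<alpha> / (a * d)))) * M)"
      by (intro ennreal_leI mult_left_mono wM) auto
    also have "2 * exp (- (ln 2 / \<Lambda> * (\<alpha> / (a * d)))) * M = 2 * M * exp (- (ln 2 / (\<Lambda> * a) * \<alpha> / d))"
      by (simp add: mult_ac)
    finally show ?thesis by (simp add: t_def d_def)
  qed
  have "0 < 2 * M" "0 < ln 2 / (\<Lambda> * a)" using M a_pos \<Lambda>(1) by auto
  with main show ?thesis by blast
qed

lemma power_decay:
  fixes \<phi> :: "real^'n \<Rightarrow> real \<Rightarrow> real" and s :: nat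
  assumes \<phi>: "growth_function \<phi>" and Aq: "\<phi> \<in> muckenhoupt q" and q: "1 < q"
  shows "\<exists>C3>0. \<forall>f :: real^'n \<Rightarrow> 'b::{real_normed_field,euclidean_space}.
    f \<in> campanato_space \<phi> s \<longrightarrow> 0 < campanato_norm \<phi> s f \<longrightarrow> (\<forall>B\<in>balls. \<forall>\<alpha>>0.
      mass \<phi> (level_set \<phi> s f B \<alpha>) (1 / norm_chi \<phi> B)
      \<le> ennreal (C3 * (1 + \<alpha> / (campanato_norm \<phi> s f * norm_chi \<phi> B)) powr (- (q / (q - 1)))))"
proof -
  obtain D H where D: "0 < D" and H: "0 \<le> H" and dbl: "doubling_constant \<phi> D" and
    dens: "\<And>t B E \<rho>. 0 < t \<Longrightarrow> B \<in> balls \<Longrightarrow> E \<in> sets lebesgue \<Longrightarrow> E \<subseteq> B \<Longrightarrow>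
       fill_ratio TYPE('n) * measure lebesgue B \<le> measure lebesgue E \<Longrightarrow> 0 < \<rho> \<Longrightarrow>
       emeasure (density lebesgue (\<lambda>x. \<phi> x t))
         {y \<in> E. \<rho> * \<phi> y t < measure (density lebesgue (\<lambda>x. \<phi> x t)) E / measure lebesgue E}
       \<le> ennreal (H * \<rho> powr - (q / (q - 1)) * measure (density lebesgue (\<lambda>x. \<phi> x t)) E)"
    by (rule muckenhoupt_estimates[OF \<phi> Aq q]) blast
  obtain a \<kappa> M where a_pos: "0 < a" and \<kappa>: "0 < \<kappa>" and M: "0 < M" and
    osc: "\<forall>f :: real^'n \<Rightarrow> 'b. f \<in> campanato_space \<phi> s \<longrightarrow> 0 < campanato_norm \<phi> s f \<longrightarrow>
      (\<forall>B\<in>balls. \<exists>v L u. 0 < L \<and>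
      oscillation (dyadic_index v L) (\<lambda>x. \<phi> x (1 / norm_chi \<phi> B)) u 0
        (a * (campanato_norm \<phi> s f * norm_chi \<phi> B)) D \<kappa> \<and>
      v \<in> dyadic_cube v L 0 0 \<and> mass \<phi> (dyadic_cube v L 0 0) (1 / norm_chi \<phi> B) \<le> ennreal M \<and>
      (\<forall>\<alpha>. level_set \<phi> s f B \<alpha> \<subseteq> {y \<in> dyadic_cube v L 0 0. \<alpha> * \<phi> y (1 / norm_chi \<phi> B) < u 0 0 y}))"
    using campanato_oscillation[OF \<phi> D dbl, of s] by (elim exE conjE) (rule that)
  define p where "p = q / (q - 1)"
  have p: "0 < p" using q by (simp add: p_def)
  define \<sigma> :: real where "\<sigma> = 2 powr (p + 1)"
  define G where "G = max (\<sigma> powr p) (H * (\<kappa> * (\<sigma> * D + 1)) powr p)"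
  have G: "\<sigma> powr p \<le> G" "H * (\<kappa> * (\<sigma> * D + 1)) powr p \<le> G" by (auto simp: G_def)
  have G0: "0 \<le> G" using G(1) powr_ge_zero[of \<sigma> p] by (rule order_trans[rotated])
  define C3 where "C3 = 2 powr p * (G * a powr p + 1) * M"
  have C3: "0 < C3" unfolding C3_def using M G0 by (intro mult_pos_pos add_nonneg_pos) auto
  have main: "mass \<phi> (level_set \<phi> s f B \<alpha>) (1 / norm_chi \<phi> B)
      \<le> ennreal (C3 * (1 + \<alpha> / (campanato_norm \<phi> s f * norm_chi \<phi> B)) powr - p)"
    if f: "f \<in> campanato_space \<phi> s" and N: "0 < campanato_norm \<phi> s f" and B: "B \<in> balls" and \<alpha>: "0 < \<alpha>"
    for f :: "real^'n \<Rightarrow> 'b" and B \<alpha>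
  proof -
    define t where "t = 1 / norm_chi \<phi> B"
    define d where "d = campanato_norm \<phi> s f * norm_chi \<phi> B"
    have chi: "0 < norm_chi \<phi> B" by (rule norm_chi_pos[OF \<phi> B])
    then have t: "0 < t" and d: "0 < d" using N by (simp_all add: t_def d_def)
    have ad: "0 < a * d" using a_pos d by simp
    define w where "w x = \<phi> x t" for x
    obtain v L u where L: "0 < L" and
      osc_u: "oscillation (dyadic_index v L) (\<lambda>x. \<phi> x (1 / norm_chi \<phi> B)) u 0
        (a * (campanato_norm \<phi> s f * norm_chi \<phi> B)) D \<kappa>" and
      v: "v \<in> dyadic_cube v L 0 0" and
      mass_u: "mass \<phi> (dyadic_cube v L 0 0) (1 / norm_chi \<phi> B) \<le> ennreal M" and
      level_u: "\<forall>\<alpha>. level_set \<phi> s f B \<alpha> \<subseteq> {y \<in> dyadic_cube v L 0 0. \<alpha> * \<phi> y (1 / norm_chi \<phi> B) < u 0 0 y}"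
      using osc[rule_format, OF f N B] by (elim exE conjE) (rule that)
    have o: "oscillation (dyadic_index v L) w u 0 (a * d) D \<kappa>"
      and M': "mass \<phi> (dyadic_cube v L 0 0) t \<le> ennreal M"
      and level: "level_set \<phi> s f B \<alpha> \<subseteq> {y \<in> dyadic_cube v L 0 0. \<alpha> * w y < u 0 0 y}"
      unfolding w_def[abs_def] t_def d_def using osc_u mass_u level_u by blast+
    interpret oscillation "dyadic_index v L" w u 0 "a * d" D \<kappa> by (rule o)
    have cell: "cell k j = dyadic_cube v L k j" for k j by (simp add: cell_def dyadic_cube_def)
    have top: "(0, 0) \<in> cells" using v by (force simp: cells_def dyadic_cube_def)
    have wM: "weight (0, 0) \<le> M"
      using emeasure_cell[OF top] M' M sets_cell[of 0 0] w_measurable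
      by (simp add: cell mass_eq_emeasure w_def[abs_def])
    have low: "emeasure \<mu> {y \<in> case_prod cell C. \<rho> * w y < density_on C} \<le> ennreal (H * \<rho> powr - p * weight C)"
      if "C \<in> cells" "0 < \<rho>" for C \<rho>
    proof -
      obtain k j where C: "C = (k, j)" by (cases C)
      obtain B where "B \<in> balls" "cell k j \<subseteq> B"
        "fill_ratio TYPE('n) * measure lebesgue B \<le> measure lebesgue (cell k j)"
        unfolding cell by (rule dyadic_cube_in_ball[OF L])
      then show ?thesis
        using dens[OF t _ sets_cell[of k j] _ _ that(2)]
        unfolding C density_on_def weight_def case_prod_conv unfolding w_def[abs_def] p_def by blast
    qed
    have sub: "level_set \<phi> s f B \<alpha> \<subseteq> superlevel (\<alpha> / (a * d)) (0, 0)"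
      using level a_pos d by (simp add: superlevel_def cell)
    have "mass \<phi> (level_set \<phi> s f B \<alpha>) t \<le> mass \<phi> (superlevel (\<alpha> / (a * d)) (0, 0)) t"
      by (rule mass_mono[OF sub])
    also have "\<dots> = emeasure \<mu> (superlevel (\<alpha> / (a * d)) (0, 0))"
      unfolding w_def[abs_def] by (rule mass_eq_emeasure[where \<phi>=\<phi> and t=t, OF w_measurable[unfolded w_def] sets_superlevel[unfolded w_def[abs_def]]])
    also have "\<dots> \<le> ennreal (C3 * (1 + \<alpha> / d) powr - p)"
    proof -
      define x where "x = \<alpha> / d"
      have x: "0 < x" using \<alpha> d by (simp add: x_def)
      have xa: "\<alpha> / (a * d) = x / a" by (simp add: x_def mult.commute)
      \<comment> \<open>used for \<open>y = x\<close> if \<open>1 \<le> x\<close>, and for \<open>y = 1\<close> together with the trivial bound otherwise\<close>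
      have *: "y powr - p \<le> 2 powr p * (1 + x) powr - p" if "0 < y" "1 + x \<le> 2 * y" for y
      proof -
        have "y powr - p = 2 powr p * (2 * y) powr - p"
          using that by (simp add: powr_mult powr_minus field_simps)
        also have "\<dots> \<le> 2 powr p * (1 + x) powr - p"
          using that x p by (intro mult_left_mono powr_mono2') auto
        finally show ?thesis .
      qed
      show ?thesis
      proof (cases "1 \<le> x")
        case True
        have "emeasure \<mu> (superlevel (\<alpha> / (a * d)) (0, 0)) \<le> ennreal (G * (x / a) powr - p * weight (0, 0))"
          unfolding xa using x a_pos by (intro superlevel_power[OF low H p \<sigma>_def G _ top]) auto
        also have "G * (x / a) powr - p * weight (0, 0) \<le> G * (x / a) powr - p * M"
          using G0 by (intro mult_left_mono wM) simp
        also have "G * (x / a) powr - p * M = G * a powr p * x powr - p * M"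
          using x a_pos by (simp add: powr_divide powr_minus field_simps)
        also have "\<dots> \<le> (G * a powr p + 1) * (2 powr p * (1 + x) powr - p) * M"
          using *[of x] True G0 M by (intro mult_right_mono mult_mono) auto
        also have "\<dots> = C3 * (1 + x) powr - p" by (simp add: C3_def mult_ac)
        finally show ?thesis by (simp add: x_def ennreal_leI)
      next
        case False
        have "emeasure \<mu> (superlevel (\<alpha> / (a * d)) (0, 0)) \<le> ennreal (weight (0, 0))"
          by (rule superlevel_trivial[OF top])
        also have "weight (0, 0) \<le> 1 * 1 * M" using wM by simp
        also have "1 * 1 * M \<le> (G * a powr p + 1) * (2 powr p * (1 + x) powr - p) * M"
          using *[of 1] False G0 M by (intro mult_right_mono mult_mono) auto
        also have "\<dots> = C3 * (1 + x) powr - p" by (simp add: C3_def mult_ac)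
        finally show ?thesis by (simp add: x_def ennreal_leI)
      qed
    qed
    finally show ?thesis by (simp add: t_def d_def)
  qed
  then show ?thesis using C3 unfolding p_def by blast
qed

theorem theorem2p5:
  fixes \<phi> :: "real^'n \<Rightarrow> real \<Rightarrow> real" and s :: nat
  assumes "growth_function \<phi>"
  shows "(\<phi> \<in> muckenhoupt 1 \<longrightarrow>
           (\<exists>C\<^sub>1>0. \<exists>C\<^sub>2>0.
              \<forall>f :: real^'n \<Rightarrow> 'b::{real_normed_field, euclidean_space}.
              f \<in> campanato_space \<phi> s \<longrightarrow> (\<forall>B\<in>balls. \<forall>\<alpha>>0.
                mass \<phi> (level_set \<phi> s f B \<alpha>) (1 / norm_chi \<phi> B)
                \<le> ennreal (if campanato_norm \<phi> s f = 0 then 0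
                   else C\<^sub>1 * exp (- (C\<^sub>2 * \<alpha> / (campanato_norm \<phi> s f * norm_chi \<phi> B)))))))
       \<and> (\<forall>q q' :: real. 1 < q \<and> 1 / q + 1 / q' = 1 \<and> \<phi> \<in> muckenhoupt q \<longrightarrow>
           (\<exists>C\<^sub>3>0.
              \<forall>f :: real^'n \<Rightarrow> 'b.
              f \<in> campanato_space \<phi> s \<longrightarrow> (\<forall>B\<in>balls. \<forall>\<alpha>>0.
                mass \<phi> (level_set \<phi> s f B \<alpha>) (1 / norm_chi \<phi> B)
                \<le> ennreal (if campanato_norm \<phi> s f = 0 then 0
                   else C\<^sub>3 * (1 + \<alpha> / (campanato_norm \<phi> s f * norm_chi \<phi> B)) powr (- q')))))"
proof -
  have cases: "mass \<phi> (level_set \<phi> s f B \<alpha>) (1 / norm_chi \<phi> B) \<le> ennreal (if campanato_norm \<phi> s f = 0 then 0 else g)"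
    if "f \<in> campanato_space \<phi> s" "B \<in> balls" "0 < \<alpha>"
      "0 < campanato_norm \<phi> s f \<Longrightarrow> mass \<phi> (level_set \<phi> s f B \<alpha>) (1 / norm_chi \<phi> B) \<le> ennreal g"
    for f :: "real^'n \<Rightarrow> 'b" and B \<alpha> g
    using that mass_level_set_norm_zero[OF assms that(1) _ that(2,3)] campanato_norm_nonneg[OF assms that(1)]
    by (cases "campanato_norm \<phi> s f = 0") auto
  show ?thesis
  proof (intro conjI impI allI, goal_cases)
    case 1
    then obtain C1 C2 where "0 < C1" "0 < C2" and decay: "\<forall>f :: real^'n \<Rightarrow> 'b.
        f \<in> campanato_space \<phi> s \<longrightarrow> 0 < campanato_norm \<phi> s f \<longrightarrow> (\<forall>B\<in>balls. \<forall>\<alpha>>0.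
          mass \<phi> (level_set \<phi> s f B \<alpha>) (1 / norm_chi \<phi> B)
          \<le> ennreal (C1 * exp (- (C2 * \<alpha> / (campanato_norm \<phi> s f * norm_chi \<phi> B)))))"
      using exponential_decay[OF assms 1, of s] by (elim exE conjE) (rule that)
    show ?case
    proof (rule exI[of _ C1], intro conjI, fact, rule exI[of _ C2], intro conjI allI impI ballI, fact)
      fix f :: "real^'n \<Rightarrow> 'b" and B :: "(real^'n) set" and \<alpha> :: real
      assume *: "f \<in> campanato_space \<phi> s" "B \<in> balls" "0 < \<alpha>"
      show "mass \<phi> (level_set \<phi> s f B \<alpha>) (1 / norm_chi \<phi> B) \<le> ennreal (if campanato_norm \<phi> s f = 0 then 0
          else C1 * exp (- (C2 * \<alpha> / (campanato_norm \<phi> s f * norm_chi \<phi> B))))"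
        by (rule cases[OF *], rule decay[rule_format, OF *(1) _ *(2,3)])
    qed
  next
    case (2 q q')
    then have q: "1 < q" and Aq: "\<phi> \<in> muckenhoupt q" and conj: "1 / q + 1 / q' = 1" by auto
    have "q' \<noteq> 0" using conj q by auto
    then have q': "q / (q - 1) = q'" using conj q by (simp add: field_simps)
    obtain C3 where "0 < C3" and decay: "\<forall>f :: real^'n \<Rightarrow> 'b.
        f \<in> campanato_space \<phi> s \<longrightarrow> 0 < campanato_norm \<phi> s f \<longrightarrow> (\<forall>B\<in>balls. \<forall>\<alpha>>0.
          mass \<phi> (level_set \<phi> s f B \<alpha>) (1 / norm_chi \<phi> B)
          \<le> ennreal (C3 * (1 + \<alpha> / (campanato_norm \<phi> s f * norm_chi \<phi> B)) powr (- q')))"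
      using power_decay[OF assms Aq q, of s] unfolding q' by (elim exE conjE) (rule that)
    show ?case
    proof (rule exI[of _ C3], intro conjI allI impI ballI, fact)
      fix f :: "real^'n \<Rightarrow> 'b" and B :: "(real^'n) set" and \<alpha> :: real
      assume *: "f \<in> campanato_space \<phi> s" "B \<in> balls" "0 < \<alpha>"
      show "mass \<phi> (level_set \<phi> s f B \<alpha>) (1 / norm_chi \<phi> B) \<le> ennreal (if campanato_norm \<phi> s f = 0 then 0
          else C3 * (1 + \<alpha> / (campanato_norm \<phi> s f * norm_chi \<phi> B)) powr (- q'))"
        by (rule cases[OF *], rule decay[rule_format, OF *(1) _ *(2,3)])
    qed
  qed
qed

end
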